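(* Let $(W,S)$ be an arbitrary Coxeter system, $I\subseteq S$ arbitrary, $x\in\mathcal V(C)$, and use the notation of the context. For $(w,\gamma),(u,\beta)\in\mathcal R_x$, we have $r_x(w,\gamma)=r_x(u,\beta)$ if and only if $(w,\gamma)\sim(u,\beta)$. Moreover, for $2\le k<\infty$, the product $r_x(w,\gamma)r_x(u,\beta)$ has order $k$ if and only if there exist $(w',\gamma'),(u',\beta')\in\mathcal R_x$ such that $(w,\gamma)\sim(w',\gamma')\overset{k}{\sim}(u',\beta')\sim(u,\beta)$.
   Context: **Coxeter groups.** $(W,S)$ is a Coxeter system, $S$ possibly infinite; $m_{s,t}$ is the order of $st$; $\Gamma$ is the Coxeter graph ($s\ne t$ adjacent iff $m_{s,t}\ge 3$, including $\infty$). $V$ is the real space with basis $\{\alpha_s\mid s\in S\}$ and form $\langle\alpha_s,\alpha_t\rangle=-\cos(\pi/m_{s,t})$ ($=-1$ if $m_{s,t}=\infty$); $W$ acts by $s\cdot v=v-2\langle\alpha_s,v\rangle\alpha_s$. $\Phi=\{w\cdot\alpha_s\}$ is the root system, $\Phi^+$ the positive roots; $s_\gamma=wsw^{-1}$ for $\gamma=w\cdot\alpha_s$. For $J\subseteq S$, $W_J=\langle J\rangle$; $J$ is of finite type if $W_J$ is finite, and then $w_0(J)$ is the longest element of $W_J$. For $J,K\subseteq S$, $J_{\sim K}$ is the union of those connected components of the full subgraph of $\Gamma$ on $J\cup K$ which meet $K$; $J_{\sim s}=J_{\sim\{s\}}$. $\Phi^{\perp J}=\{\gamma\in\Phi\mid\langle\gamma,\alpha_s\rangle=0\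 \forall s\in J\}$, $(\Phi^{\perp J})^+=\Phi^{\perp J}\cap\Phi^+$, $W^{\perp J}=\langle s_\gamma\mid\gamma\in\Phi^{\perp J}\rangle$. **Groupoids.** Fix a set $\Lambda$ with $|\Lambda|=|I|$. $S^{(\Lambda)}$ is the set of injections $x:\Lambda\to S$, $x_\lambda=x(\lambda)$, $[x]=x(\Lambda)$. Fix $x_I\in S^{(\Lambda)}$ with $[x_I]=I$. For $x,y\in S^{(\Lambda)}$ put $C_{x,y}=\{w\in W\mid\alpha_{x_\lambda}=w\cdot\alpha_{y_\lambda}\ \forall\lambda\}$, $\mathcal V(C)=\{x\mid C_{x,x_I}\ne\emptyset\}$. $C=\{C_{x,y}\}_{x,y\in\mathcal V(C)}$ is a groupoid under multiplication in $W$ (elements of $C_{x,y}$ have source $y$, target $x$; write $x=w\cdot y$). $Y_{x,y}=\{w\in C_{x,y}\mid w\cdot(\Phi^{\perp[y]})^+\subseteq\Phi^+\}$. **Graph and tree.** For $x\in\mathcal V(C)$ and $s\in S\smallsetminus[x]$ with $[x]_{\sim s}$ of finite type, let $w_x^s=w_0([x]_{\sim s})w_0([x]_{\sim s}\smallsetminus\{s\})$; it lies in $C_{y,x}$ for a unique $y\in\mathcal V(C)$. $\mathcal C$ is the graph with vertex set $\mathcal V(C)$ and edges $w_x^s$ from $x$ to $w_x^s\cdot x$, where $w_x^s$ and its inverse $w_y^t$ ($y=w_x^s\cdot x$, $\{t\}=([x]\cup\{s\})\smallsetminus[y]$) are identified as the two orientations of one edge. Paths are written from right to left and represent elements of $C$.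 A loop generator is a $w_z^s$ with $w_z^s\cdot z=z$ (a loop of $\mathcal C$ at $z$); it is a reflection $s_\gamma$ for a unique positive root $\gamma$. Loop generators are regarded as elements of the groupoid, i.e. the vertex $z$ is remembered. $\mathcal Y^1$ is $\mathcal C$ with all loops deleted; it is connected, and every path in $\mathcal Y^1$ represents an element of $Y$. Fix a maximal tree $\mathcal T$ of $\mathcal Y^1$; $p_{z,y}$ is the non-backtracking path in $\mathcal T$ from $y$ to $z$. For a path $q$ from $y$ to $z$ (or a loop $q$ at $y=z$), $q_{(x)}=p_{x,z}\,q\,p_{y,x}$. **Shuttling tours.** For $x\in\mathcal V(C)$ and $s\ne t$ in $S\smallsetminus[x]$ with $[x]_{\sim\{s,t\}}$ of finite type, put $J=[x]\cup\{s,t\}$, let $\mathcal C(J)$ be the subgraph of $\mathcal C$ of vertices $y$ with $[y]\subseteq J$ and edges $w_y^{s'}$ with $[y]\cup\{s'\}\subseteq J$, and let $\mathcal G$ be its connected component containing $x$. $\mathcal G$ is either a cycle without loops or a simple path (possibly a single vertex) together with two loops, one at each end (both at the vertex if it is single). In the latter case a shuttling tour is a closed path in $\mathcal G$ visiting each vertex exactly twice (except the start point) and passing each of the two loops exactly once; in particular, if $s_\gamma$ is one of the loops, at $y$, $s_\beta$ the other, at $z$, and $q$ the simple path in $\mathcal G$ from $z$ to $y$, then $s_\gamma q s_\beta q^{-1}$ is a shuttling tour. Its order is its (finite) order as an element of $W$. **Generators and relations.** $\mathcal R_x$ is the set of pairs $(w,u)$ with $w\in Y_{x,x}$ and $u$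 a loop generator of $C$ (at any vertex); if $u=s_\gamma$ with $\gamma$ positive, the pair is also written $(w,\gamma)$. $r_x(w,u)=w\,u_{(x)}\,w^{-1}\in W^{\perp[x]}$. For $1\le k<\infty$, $(w,\gamma)\overset{k}{\sim}(wq_{(x)},\beta)$ if there is a shuttling tour of order $k$ of the form $s_\gamma q s_\beta q^{-1}$ (with $s_\gamma,s_\beta$ the given loop generators). This relation is symmetric. $\sim$ is the equivalence relation on $\mathcal R_x$ generated by $\overset{1}{\sim}$. *)

theory Defs
  imports Complex_Main "HOL-Algebra.Algebra"
begin

section \<open>Coxeter systems\<close>

text \<open>
  The congruence on words over \<open>S\<close> generated by the relators \<open>(s t)\<^sup>m\<close>, where \<open>m\<close> is the order of
  \<open>s t\<close>.  \<^const>\<open>group.ord\<close> is \<open>0\<close> for elements of infinite order, so such pairs contribute the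
  trivial relator.  The case \<open>s = t\<close> yields the relator \<open>s s\<close> (if \<open>s\<close> is an involution), hence no
  formal inverses are needed and the quotient is the group presented by the relators.
\<close>

inductive coxeter_cong :: "('a, 'b) monoid_scheme \<Rightarrow> 'a set \<Rightarrow> 'a list \<Rightarrow> 'a list \<Rightarrow> bool"
  for G (structure) and S where
  relator: "\<lbrakk>s \<in> S; t \<in> S; us \<in> lists S; vs \<in> lists S\<rbrakk> \<Longrightarrow>
     coxeter_cong G S (us @ concat (replicate (group.ord G (s \<otimes> t)) [s, t]) @ vs) (us @ vs)"
| refl: "us \<in> lists S \<Longrightarrow> coxeter_cong G S us us"
| sym: "coxeter_cong G S us vs \<Longrightarrow> coxeter_cong G S vs us"
| trans: "\<lbrakk>coxeter_cong G S us vs; coxeter_cong G S vs ws\<rbrakk> \<Longrightarrow> coxeter_cong G S us ws"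

definition word_prod :: "('a, 'b) monoid_scheme \<Rightarrow> 'a list \<Rightarrow> 'a" where
  "word_prod G ws = foldr (\<otimes>\<^bsub>G\<^esub>) ws \<one>\<^bsub>G\<^esub>"

locale coxeter_system = group G for G (structure) +
  fixes S :: "'a set"
  assumes gens_carrier: "S \<subseteq> carrier G"
    and gens_involution: "s \<in> S \<Longrightarrow> ord s = 2"
    and gens_generate: "generate G S = carrier G"
    and presentation:
      "\<lbrakk>us \<in> lists S; vs \<in> lists S; word_prod G us = word_prod G vs\<rbrakk> \<Longrightarrow> coxeter_cong G S us vs"
begin

definition adjacent :: "'a \<Rightarrow> 'a \<Rightarrow> bool" where
  "adjacent s t \<longleftrightarrow> s \<in> S \<and> t \<in> S \<and> s \<noteq> t \<and> (ord (s \<otimes> t) = 0 \<or> ord (s \<otimes> t) \<ge> 3)"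

definition length_S :: "'a \<Rightarrow> nat" where
  "length_S w = (LEAST n. \<exists>ws \<in> lists S. length ws = n \<and> word_prod G ws = w)"

definition finite_type :: "'a set \<Rightarrow> bool" where
  "finite_type J \<longleftrightarrow> finite (generate G J)"

definition longest :: "'a set \<Rightarrow> 'a" where
  "longest J = (THE w. w \<in> generate G J \<and> (\<forall>v \<in> generate G J. length_S v \<le> length_S w))"

text \<open>The set \<open>J\<^bsub>\<sim>K\<^esub>\<close>.\<close>

definition comps_meeting :: "'a set \<Rightarrow> 'a set \<Rightarrow> 'a set" where
  "comps_meeting J K = {a. \<exists>k \<in> K.
     (\<lambda>b c. b \<in> J \<union> K \<and> c \<in> J \<union> K \<and> adjacent b c)\<^sup>*\<^sup>* k a}"

text \<open>
  Elements of the geometric representation space \<open>V\<close> are their coefficient functions, which have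
  finite support contained in \<open>S\<close>.
\<close>

definition simple_root :: "'a \<Rightarrow> 'a \<Rightarrow> real" where
  "simple_root s = (\<lambda>t. if t = s then 1 else 0)"

definition gram :: "'a \<Rightarrow> 'a \<Rightarrow> real" where
  "gram s t = (if ord (s \<otimes> t) = 0 then -1 else - cos (pi / real (ord (s \<otimes> t))))"

definition bform :: "('a \<Rightarrow> real) \<Rightarrow> ('a \<Rightarrow> real) \<Rightarrow> real" where
  "bform u v = (\<Sum>s | u s \<noteq> 0. \<Sum>t | v t \<noteq> 0. u s * v t * gram s t)"

definition simple_refl :: "'a \<Rightarrow> ('a \<Rightarrow> real) \<Rightarrow> 'a \<Rightarrow> real" where
  "simple_refl s v = (\<lambda>t. v t - 2 * bform (simple_root s) v * simple_root s t)"

text \<open>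
  The action of \<open>w\<close> is the composite of the simple reflections along any word over \<open>S\<close>
  representing \<open>w\<close>; on \<open>V\<close> it does not depend on the word, since the simple reflections satisfy the
  relations of the presentation.
\<close>

definition act :: "'a \<Rightarrow> ('a \<Rightarrow> real) \<Rightarrow> 'a \<Rightarrow> real" where
  "act w v = foldr simple_refl (SOME ws. ws \<in> lists S \<and> word_prod G ws = w) v"

definition roots :: "('a \<Rightarrow> real) set" where
  "roots = {act w (simple_root s) | w s. w \<in> carrier G \<and> s \<in> S}"

definition pos_roots :: "('a \<Rightarrow> real) set" where
  "pos_roots = {\<gamma> \<in> roots. \<forall>s. \<gamma> s \<ge> 0}"

definition orth_roots :: "'a set \<Rightarrow> ('a \<Rightarrow> real) set" where
  "orth_roots J = {\<gamma> \<in> roots. \<forall>s \<in> J. bform \<gamma> (simple_root s) = 0}"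

end


section \<open>Paths in graphs whose oriented edges are arrows of a groupoid\<close>

text \<open>
  An arrow \<open>(z, w, y)\<close> has target \<open>z\<close>, source \<open>y\<close> and underlying group element \<open>w\<close>.  Paths are lists
  of arrows written from right to left, i.e. the last list element is traversed first.
\<close>

type_synonym ('v, 'a) arrow = "'v \<times> 'a \<times> 'v"

definition tgt :: "('v, 'a) arrow \<Rightarrow> 'v" where "tgt e = fst e"
definition elt :: "('v, 'a) arrow \<Rightarrow> 'a" where "elt e = fst (snd e)"
definition src :: "('v, 'a) arrow \<Rightarrow> 'v" where "src e = snd (snd e)"

text \<open>\<open>arrow_path E z p y\<close>: \<open>p\<close> is a path from \<open>y\<close> to \<open>z\<close> with edges in \<open>E\<close>.\<close>

fun arrow_path :: "('v, 'a) arrow set \<Rightarrow> 'v \<Rightarrow> ('v, 'a) arrow list \<Rightarrow> 'v \<Rightarrow> bool" where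
  "arrow_path E z [] y \<longleftrightarrow> z = y"
| "arrow_path E z (e # p) y \<longleftrightarrow> e \<in> E \<and> tgt e = z \<and> arrow_path E (src e) p y"


section \<open>The groupoid, its graph, and shuttling tours\<close>

locale coxeter_groupoid = coxeter_system G S for G (structure) and S +
  fixes I :: "'a set" and \<Lambda> :: "'l set" and xI :: "'l \<Rightarrow> 'a"
  assumes I_subset: "I \<subseteq> S"
    and xI_extensional: "xI \<in> extensional \<Lambda>"
    and xI_bij: "bij_betw xI \<Lambda> I"
begin

text \<open>
  Members of \<open>S\<^bsup>(\<Lambda>)\<^esup>\<close> are extensional functions, so that injections \<open>\<Lambda> \<rightarrow> S\<close> are equal iff they agree
  on \<open>\<Lambda>\<close>.
\<close>

definition injections :: "('l \<Rightarrow> 'a) set" where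
  "injections = {x \<in> \<Lambda> \<rightarrow>\<^sub>E S. inj_on x \<Lambda>}"

definition C_hom :: "('l \<Rightarrow> 'a) \<Rightarrow> ('l \<Rightarrow> 'a) \<Rightarrow> 'a set" where
  "C_hom x y = {w \<in> carrier G. \<forall>l \<in> \<Lambda>. simple_root (x l) = act w (simple_root (y l))}"

definition vertices :: "('l \<Rightarrow> 'a) set" where
  "vertices = {x \<in> injections. C_hom x xI \<noteq> {}}"

definition Y_hom :: "('l \<Rightarrow> 'a) \<Rightarrow> ('l \<Rightarrow> 'a) \<Rightarrow> 'a set" where
  "Y_hom x y = {w \<in> C_hom x y. act w ` (orth_roots (y ` \<Lambda>) \<inter> pos_roots) \<subseteq> pos_roots}"

text \<open>The element \<open>w\<^sub>x\<^sup>s\<close> and the condition under which it is defined.\<close>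

definition step_ok :: "('l \<Rightarrow> 'a) \<Rightarrow> 'a \<Rightarrow> bool" where
  "step_ok x s \<longleftrightarrow> s \<in> S - x ` \<Lambda> \<and> finite_type (comps_meeting (x ` \<Lambda>) {s})"

definition step :: "('l \<Rightarrow> 'a) \<Rightarrow> 'a \<Rightarrow> 'a" where
  "step x s = longest (comps_meeting (x ` \<Lambda>) {s}) \<otimes> longest (comps_meeting (x ` \<Lambda>) {s} - {s})"

text \<open>
  The graph is given by its set of oriented edges, where \<open>flip\<close> exchanges the two orientations of
  an edge: if \<open>e\<close> is \<open>w\<^sub>x\<^sup>s\<close>, regarded as an arrow from \<open>x\<close> to \<open>y\<close>, then \<open>flip e\<close> is its inverse \<open>w\<^sub>y\<^sup>t\<close>
  in the groupoid.
\<close>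

definition edges_within :: "'a set \<Rightarrow> ('l \<Rightarrow> 'a, 'a) arrow set" where
  "edges_within J = {(y, step x s, x) | y x s.
     x \<in> vertices \<and> y \<in> vertices \<and> step_ok x s \<and> step x s \<in> C_hom y x \<and> x ` \<Lambda> \<union> {s} \<subseteq> J}"

abbreviation edges :: "('l \<Rightarrow> 'a, 'a) arrow set" where
  "edges \<equiv> edges_within S"

definition flip :: "('l \<Rightarrow> 'a, 'a) arrow \<Rightarrow> ('l \<Rightarrow> 'a, 'a) arrow" where
  "flip e = (src e, inv (elt e), tgt e)"

definition path_elt :: "('l \<Rightarrow> 'a, 'a) arrow list \<Rightarrow> 'a" where
  "path_elt p = word_prod G (map elt p)"

definition inv_path :: "('l \<Rightarrow> 'a, 'a) arrow list \<Rightarrow> ('l \<Rightarrow> 'a, 'a) arrow list" where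
  "inv_path p = rev (map flip p)"

definition nonbacktracking :: "('l \<Rightarrow> 'a, 'a) arrow list \<Rightarrow> bool" where
  "nonbacktracking p \<longleftrightarrow> successively (\<lambda>e f. e \<noteq> flip f) p"

text \<open>Loop generators are arrows, hence remember their vertex.\<close>

definition loop_gens :: "('l \<Rightarrow> 'a, 'a) arrow set" where
  "loop_gens = {e \<in> edges. tgt e = src e}"

definition nonloop_edges :: "('l \<Rightarrow> 'a, 'a) arrow set" where
  "nonloop_edges = {e \<in> edges. tgt e \<noteq> src e}"

text \<open>
  Subtrees of the graph without loops, with vertex set \<open>TV\<close> and oriented edges \<open>TE\<close>: nonempty
  connected subgraphs without circuits.
\<close>

definition subtree :: "('l \<Rightarrow> 'a) set \<Rightarrow> ('l \<Rightarrow> 'a, 'a) arrow set \<Rightarrow> bool" where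
  "subtree TV TE \<longleftrightarrow>
     TV \<subseteq> vertices \<and> TV \<noteq> {} \<and> TE \<subseteq> nonloop_edges \<and> flip ` TE \<subseteq> TE \<and>
     (\<forall>e \<in> TE. src e \<in> TV \<and> tgt e \<in> TV) \<and>
     (\<forall>y \<in> TV. \<forall>z \<in> TV. \<exists>p. arrow_path TE z p y) \<and>
     (\<nexists>y p. p \<noteq> [] \<and> arrow_path TE y p y \<and> nonbacktracking p)"

definition maximal_tree :: "('l \<Rightarrow> 'a) set \<Rightarrow> ('l \<Rightarrow> 'a, 'a) arrow set \<Rightarrow> bool" where
  "maximal_tree TV TE \<longleftrightarrow> subtree TV TE \<and>
     (\<forall>TV' TE'. subtree TV' TE' \<longrightarrow> TV \<subseteq> TV' \<longrightarrow> TE \<subseteq> TE' \<longrightarrow> TV' = TV \<and> TE' = TE)"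

definition tree_path ::
    "('l \<Rightarrow> 'a, 'a) arrow set \<Rightarrow> ('l \<Rightarrow> 'a) \<Rightarrow> ('l \<Rightarrow> 'a) \<Rightarrow> ('l \<Rightarrow> 'a, 'a) arrow list" where
  "tree_path TE z y = (THE p. arrow_path TE z p y \<and> nonbacktracking p)"

text \<open>
  \<open>based_elt TE x z q y\<close> is the element represented by \<open>q\<^bsub>(x)\<^esub>\<close> for a path \<open>q\<close> from \<open>y\<close> to \<open>z\<close>.
\<close>

definition based_elt :: "('l \<Rightarrow> 'a, 'a) arrow set \<Rightarrow> ('l \<Rightarrow> 'a) \<Rightarrow> ('l \<Rightarrow> 'a) \<Rightarrow>
    ('l \<Rightarrow> 'a, 'a) arrow list \<Rightarrow> ('l \<Rightarrow> 'a) \<Rightarrow> 'a" where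
  "based_elt TE x z q y = path_elt (tree_path TE x z @ q @ tree_path TE y x)"

text \<open>
  For \<open>x\<close>, \<open>s\<close>, \<open>t\<close> and \<open>J = [x] \<union> {s, t}\<close>, the vertices and the oriented edges of the connected
  component of \<open>x\<close> in the subgraph of vertices and edges within \<open>J\<close>.
\<close>

definition comp_vertices :: "('l \<Rightarrow> 'a) \<Rightarrow> 'a \<Rightarrow> 'a \<Rightarrow> ('l \<Rightarrow> 'a) set" where
  "comp_vertices x s t = {y. \<exists>p. arrow_path (edges_within (x ` \<Lambda> \<union> {s, t})) y p x}"

definition comp_edges :: "('l \<Rightarrow> 'a) \<Rightarrow> 'a \<Rightarrow> 'a \<Rightarrow> ('l \<Rightarrow> 'a, 'a) arrow set" where
  "comp_edges x s t = {e \<in> edges_within (x ` \<Lambda> \<union> {s, t}). src e \<in> comp_vertices x s t}"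

text \<open>
  A graph that is a simple path \<open>q\<close> together with two distinct loops \<open>a\<close>, \<open>b\<close>, one at each end; for
  \<open>q = []\<close> both loops are at the single vertex.
\<close>

definition path_with_loops :: "('l \<Rightarrow> 'a) set \<Rightarrow> ('l \<Rightarrow> 'a, 'a) arrow set \<Rightarrow>
    ('l \<Rightarrow> 'a, 'a) arrow \<Rightarrow> ('l \<Rightarrow> 'a, 'a) arrow \<Rightarrow> bool" where
  "path_with_loops GV GE a b \<longleftrightarrow> a \<noteq> b \<and>
     (\<exists>y z q. arrow_path GE y q z \<and> distinct (y # map src q) \<and>
        tgt a = y \<and> src a = y \<and> tgt b = z \<and> src b = z \<and>
        GV = set (y # map src q) \<and> GE = set q \<union> flip ` set q \<union> {a, b})"

text \<open>
  In a shuttling tour, each vertex is the source of exactly two of the edges traversed; so each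
  vertex is visited twice, where the start point occurs once more as the end of the closed path.
\<close>

definition shuttling_tour ::
    "('l \<Rightarrow> 'a) \<Rightarrow> 'a \<Rightarrow> 'a \<Rightarrow> ('l \<Rightarrow> 'a, 'a) arrow list \<Rightarrow> bool" where
  "shuttling_tour x s t p \<longleftrightarrow>
     x \<in> vertices \<and> s \<in> S - x ` \<Lambda> \<and> t \<in> S - x ` \<Lambda> \<and> s \<noteq> t \<and>
     finite_type (comps_meeting (x ` \<Lambda>) {s, t}) \<and>
     (\<exists>y. arrow_path (comp_edges x s t) y p y) \<and>
     (\<forall>y \<in> comp_vertices x s t. count_list (map src p) y = 2) \<and>
     (\<exists>a b. path_with_loops (comp_vertices x s t) (comp_edges x s t) a b \<and>
        count_list p a = 1 \<and> count_list p b = 1)"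

definition refl_pairs :: "('l \<Rightarrow> 'a) \<Rightarrow> ('a \<times> ('l \<Rightarrow> 'a, 'a) arrow) set" where
  "refl_pairs x = Y_hom x x \<times> loop_gens"

text \<open>
  \<open>refl_of TE x (w, u)\<close> is \<open>r\<^sub>x(w, u)\<close>, and \<open>tour_rel TE x k\<close> and \<open>tour_equiv TE x\<close> are the relations
  \<open>\<sim>\<close> with index \<open>k\<close> and \<open>\<sim>\<close> on \<^const>\<open>refl_pairs\<close>.  A pair denoted by \<open>(w, \<gamma>)\<close> with a positive root
  \<open>\<gamma>\<close> is the pair of \<open>w\<close> and the loop generator \<open>s\<^sub>\<gamma>\<close> at its vertex.
\<close>

fun refl_of :: "('l \<Rightarrow> 'a, 'a) arrow set \<Rightarrow> ('l \<Rightarrow> 'a) \<Rightarrow> 'a \<times> ('l \<Rightarrow> 'a, 'a) arrow \<Rightarrow> 'a" where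
  "refl_of TE x (w, u) = w \<otimes> based_elt TE x (tgt u) [u] (src u) \<otimes> inv w"

fun tour_rel :: "('l \<Rightarrow> 'a, 'a) arrow set \<Rightarrow> ('l \<Rightarrow> 'a) \<Rightarrow> nat \<Rightarrow>
    'a \<times> ('l \<Rightarrow> 'a, 'a) arrow \<Rightarrow> 'a \<times> ('l \<Rightarrow> 'a, 'a) arrow \<Rightarrow> bool" where
  "tour_rel TE x k (w, u) (w', u') \<longleftrightarrow>
     (w, u) \<in> refl_pairs x \<and> (w', u') \<in> refl_pairs x \<and> k \<ge> 1 \<and>
     (\<exists>v s t q. arrow_path (comp_edges v s t) (src u) q (src u') \<and>
        shuttling_tour v s t (u # q @ u' # inv_path q) \<and>
        ord (path_elt (u # q @ u' # inv_path q)) = k \<and>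
        w' = w \<otimes> based_elt TE x (src u) q (src u'))"

definition tour_equiv :: "('l \<Rightarrow> 'a, 'a) arrow set \<Rightarrow> ('l \<Rightarrow> 'a) \<Rightarrow>
    'a \<times> ('l \<Rightarrow> 'a, 'a) arrow \<Rightarrow> 'a \<times> ('l \<Rightarrow> 'a, 'a) arrow \<Rightarrow> bool" where
  "tour_equiv TE x a b \<longleftrightarrow> a \<in> refl_pairs x \<and> b \<in> refl_pairs x \<and> equivclp (tour_rel TE x 1) a b"

end

end

theory Submission
  imports Defs
begin

text \<open>
  A pair \<open>(w, u)\<close> with \<open>u\<close> a loop at \<open>z\<close> amounts to the arrow \<open>v = w p\<^bsub>x,z\<^esub>\<close> of \<open>Y\<close>, and
  \<open>r\<^bsub>x\<^esub>(w, u) = v u v\<^sup>-\<^sup>1\<close> is the reflection in the positive root \<open>v \<cdot> \<gamma>\<close>, where \<open>u = s\<^bsub>\<gamma>\<^esub>\<close>. If two pairs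
  define the same reflection, then \<open>g = v\<^sup>-\<^sup>1 v'\<close> carries not only \<open>[z]\<close> to \<open>[y]\<close>, but also the
  enlarged index set \<open>[z] \<union> {s'}\<close> that supports the second loop to the enlarged index set \<open>[y] \<union> {s}\<close>
  that supports the first one. By the decomposition of Brink and Howlett, \<open>g\<close> is a product of
  steps for the enlarged index sets. Each of these steps runs through a rank two component from
  the loop at one of its ends to the loop at the other end, and is therefore a shuttling tour of
  order \<open>1\<close>.

  If the product of the two reflections has finite order \<open>k \<ge> 2\<close>, then the average of a generic
  dominant functional over the finite dihedral group which they generate vanishes on both roots
  and is negative on finitely many positive roots only, none of them orthogonal to \<open>[y]\<close>. An arrow
  of \<open>Y\<close> makes this functional dominant, and then both roots are supported in a single rank two
  component, whose two loops they define up to the first part of the theorem; the corresponding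
  shuttling tour has order \<open>k\<close>.
\<close>

text \<open>Finite type is a condition on a component of the Coxeter graph, whereas the elements
  constructed below are known through their inversions. The working notion of finiteness is
  therefore that of \<open>rel_roots J A\<close>, the roots supported on J but not on A: it is read
  off inversion sets, it is carried along edges within J, and \<open>finite_type_comps\<close> turns
  it into finite type. Inversion sets also identify elements: a nontrivial element of the parabolic
  subgroup of A and one further index that sends the simple roots of A to simple roots has a
  prescribed inversion set, so it is the step. Edges, and loops as reflections, are recognised in
  this way. A step for an enlarged index set carries the loop along because the root of the loop is
  supported on that set, whose simple roots go to simple roots. That the component is a path with
  two loops has to be derived: a second loop is produced from the first, and a walk between them
  exhausts the component since two edges leave each vertex. S may be infinite and the form
  degenerate, so chamber arguments use functionals on V instead of vectors, and averages are taken
  over finite groups only.\<close>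

context coxeter_system begin

section \<open>The geometric representation\<close>

lemma S_carrier: "s \<in> S \<Longrightarrow> s \<in> carrier G"
  using gens_carrier by blast

lemma S_sq: "s \<in> S \<Longrightarrow> s \<otimes> s = \<one>"
  using pow_ord_eq_1[of s] gens_involution[of s] S_carrier[of s] by (simp add: numeral_2_eq_2)

lemma S_inv: "s \<in> S \<Longrightarrow> inv s = s"
  using S_sq S_carrier by (simp add: inv_equality)

lemma word_prod_Nil [simp]: "word_prod G [] = \<one>"
  by (simp add: word_prod_def)

lemma word_prod_Cons [simp]: "word_prod G (w # ws) = w \<otimes> word_prod G ws"
  by (simp add: word_prod_def)

lemma word_prod_closed [simp]: "set ws \<subseteq> carrier G \<Longrightarrow> word_prod G ws \<in> carrier G"
  by (induction ws) auto

lemma word_prod_append: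
  "set us \<subseteq> carrier G \<Longrightarrow> set vs \<subseteq> carrier G \<Longrightarrow> word_prod G (us @ vs) = word_prod G us \<otimes> word_prod G vs"
  by (induction us) (auto simp: m_assoc)

lemma lists_S_carrier: "ws \<in> lists S \<Longrightarrow> set ws \<subseteq> carrier G"
  using gens_carrier by auto

lemma generate_word:
  assumes "J \<subseteq> S" "w \<in> generate G J"
  shows "\<exists>ws \<in> lists J. word_prod G ws = w"
  using assms(2)
proof (induction rule: generate.induct)
  case one
  then show ?case by (auto intro: bexI[of _ "[]"])
next
  case (incl h)
  then show ?case using assms(1) S_carrier by (intro bexI[of _ "[h]"]) auto
next
  case (inv h)
  then show ?case using assms(1) S_carrier S_inv by (intro bexI[of _ "[h]"]) auto
next
  case (eng h1 h2)
  then obtain u v where "u \<in> lists J" "v \<in> lists J" "word_prod G u = h1" "word_prod G v = h2"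
    by blast
  moreover from this have "set u \<subseteq> carrier G" "set v \<subseteq> carrier G" using assms(1) gens_carrier
    by auto
  ultimately show ?case by (intro bexI[of _ "u @ v"]) (auto simp: word_prod_append)
qed

lemma generate_subset_carrier: "J \<subseteq> S \<Longrightarrow> w \<in> generate G J \<Longrightarrow> w \<in> carrier G"
  by (meson gens_carrier generate_in_carrier subset_trans)

lemma word_prod_generate: "ws \<in> lists J \<Longrightarrow> word_prod G ws \<in> generate G J"
  by (induction ws) (auto intro: generate.intros)

lemma carrier_word: "w \<in> carrier G \<Longrightarrow> \<exists>ws \<in> lists S. word_prod G ws = w"
  using generate_word[of S w] gens_generate by simp

text \<open>The generators are involutions, so every element is a word in them and the induction
  needs no case for inverses.\<close>

lemma generate_induct [consumes 2, case_names one mult]: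
  assumes "w \<in> generate G J" "J \<subseteq> S" "P \<one>"
    "\<And>s w. s \<in> J \<Longrightarrow> w \<in> generate G J \<Longrightarrow> P w \<Longrightarrow> P (s \<otimes> w)"
  shows "P w"
proof -
  obtain ws where ws: "ws \<in> lists J" "word_prod G ws = w" using generate_word assms by blast
  have "P (word_prod G ws)" using ws(1)
    by (induction ws) (auto intro: assms word_prod_generate)
  then show ?thesis using ws by simp
qed

section \<open>The space V, its form and the simple reflections\<close>

definition supp :: "('a \<Rightarrow> real) \<Rightarrow> 'a set" where
  "supp v = {s. v s \<noteq> 0}"

definition span_on :: "'a set \<Rightarrow> ('a \<Rightarrow> real) set" where
  "span_on J = {v. finite (supp v) \<and> supp v \<subseteq> J}"

abbreviation "V \<equiv> span_on S"

lemma span_on_mono: "J \<subseteq> K \<Longrightarrow> v \<in> span_on J \<Longrightarrow> v \<in> span_on K"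
  by (auto simp: span_on_def)

lemma supp_lin: "supp (\<lambda>s. a * u s + b * v s) \<subseteq> supp u \<union> supp v"
  by (auto simp: supp_def)

lemma span_on_lin: "u \<in> span_on J \<Longrightarrow> v \<in> span_on J \<Longrightarrow> (\<lambda>s. a * u s + b * v s) \<in> span_on J"
  unfolding span_on_def using supp_lin[of a u b v] by (auto intro: finite_subset)

lemma span_on_scale: "u \<in> span_on J \<Longrightarrow> (\<lambda>s. a * u s) \<in> span_on J"
  using span_on_lin[of u J u a 0] by simp

lemma span_on_uminus: "u \<in> span_on J \<Longrightarrow> (\<lambda>s. - u s) \<in> span_on J"
  using span_on_scale[of u J "-1"] by simp

lemma supp_simple_root [simp]: "supp (simple_root s) = {s}"
  by (auto simp: supp_def simple_root_def)

lemma simple_root_span: "s \<in> J \<Longrightarrow> simple_root s \<in> span_on J"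
  by (auto simp: span_on_def)

lemma span_on_zero: "v \<in> span_on J \<Longrightarrow> s \<notin> J \<Longrightarrow> v s = 0"
  by (auto simp: span_on_def supp_def)

lemma gram_self: "s \<in> S \<Longrightarrow> gram s s = 1"
  by (simp add: gram_def S_sq)

lemma ord_inv_eq: "s \<in> S \<Longrightarrow> t \<in> S \<Longrightarrow> ord (s \<otimes> t) = ord (t \<otimes> s)"
  using ord_inv[of "s \<otimes> t"] by (simp add: inv_mult_group S_carrier S_inv)

lemma gram_sym: "s \<in> S \<Longrightarrow> t \<in> S \<Longrightarrow> gram s t = gram t s"
  by (simp add: gram_def ord_inv_eq)

lemma bform_on:
  assumes "finite A" "supp u \<subseteq> A" "finite B" "supp v \<subseteq> B"
  shows "bform u v = (\<Sum>s\<in>A. \<Sum>t\<in>B. u s * v t * gram s t)"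
proof -
  have "bform u v = (\<Sum>s\<in>supp u. \<Sum>t\<in>supp v. u s * v t * gram s t)"
    by (simp add: bform_def supp_def)
  also have "\<dots> = (\<Sum>s\<in>supp u. \<Sum>t\<in>B. u s * v t * gram s t)"
    by (intro sum.cong HOL.refl sum.mono_neutral_left) (use assms in \<open>auto simp: supp_def\<close>)
  also have "\<dots> = (\<Sum>s\<in>A. \<Sum>t\<in>B. u s * v t * gram s t)"
    by (intro sum.mono_neutral_left) (use assms in \<open>auto simp: supp_def\<close>)
  finally show ?thesis .
qed

lemma bform_sym: "u \<in> V \<Longrightarrow> v \<in> V \<Longrightarrow> bform u v = bform v u"
  using bform_on[of "supp u" u "supp v" v] bform_on[of "supp v" v "supp u" u]
  unfolding span_on_def
  by simp (subst sum.swap, intro sum.cong HOL.refl, auto simp: gram_sym subset_iff)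

lemma bform_lin_right:
  assumes "u \<in> V" "v \<in> V" "w \<in> V"
  shows "bform u (\<lambda>s. a * v s + b * w s) = a * bform u v + b * bform u w"
proof -
  let ?B = "supp v \<union> supp w"
  have B: "finite ?B" and A: "finite (supp u)" using assms by (auto simp: span_on_def)
  have "bform u (\<lambda>s. a * v s + b * w s) = (\<Sum>s\<in>supp u. \<Sum>t\<in>?B. u s * (a * v t + b * w t) * gram s t)"
    by (rule bform_on[OF A order_refl B supp_lin])
  moreover have "bform u v = (\<Sum>s\<in>supp u. \<Sum>t\<in>?B. u s * v t * gram s t)"
    by (rule bform_on[OF A order_refl B]) auto
  moreover have "bform u w = (\<Sum>s\<in>supp u. \<Sum>t\<in>?B. u s * w t * gram s t)"
    by (rule bform_on[OF A order_refl B]) auto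
  ultimately show ?thesis
    by (simp add: sum_distrib_left flip: sum.distrib) (simp add: algebra_simps)
qed

lemma bform_lin_left:
  assumes "u \<in> V" "v \<in> V" "w \<in> V"
  shows "bform (\<lambda>s. a * v s + b * w s) u = a * bform v u + b * bform w u"
  using assms by (simp add: bform_sym[of _ u] span_on_lin bform_lin_right)

lemma bform_scale_right: "u \<in> V \<Longrightarrow> v \<in> V \<Longrightarrow> bform u (\<lambda>s. a * v s) = a * bform u v"
  using bform_lin_right[of u v v a 0] by simp

lemma bform_uminus_right: "u \<in> V \<Longrightarrow> v \<in> V \<Longrightarrow> bform u (\<lambda>s. - v s) = - bform u v"
  using bform_scale_right[of u v "-1"] by simp

lemma bform_simple: "bform (simple_root s) (simple_root t) = gram s t"
  by (subst bform_on[of "{s}" _ "{t}"]) (auto simp: simple_root_def supp_def)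

lemma bform_sum_right:
  assumes "u \<in> V" "finite A" "supp v \<subseteq> A" "A \<subseteq> S"
  shows "bform u v = (\<Sum>t\<in>A. v t * bform u (simple_root t))"
proof -
  have A: "finite (supp u)" using assms by (auto simp: span_on_def)
  have "bform u v = (\<Sum>s\<in>supp u. \<Sum>t\<in>A. u s * v t * gram s t)"
    using bform_on[OF A order_refl assms(2,3)] .
  also have "\<dots> = (\<Sum>t\<in>A. \<Sum>s\<in>supp u. u s * v t * gram s t)" by (rule sum.swap)
  also have "\<dots> = (\<Sum>t\<in>A. v t * bform u (simple_root t))"
  proof (intro sum.cong HOL.refl)
    fix t
    have "bform u (simple_root t) = (\<Sum>s\<in>supp u. \<Sum>t'\<in>{t}. u s * simple_root t t' * gram s t')"
      by (rule bform_on[OF A]) auto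
    then show "(\<Sum>s\<in>supp u. u s * v t * gram s t) = v t * bform u (simple_root t)"
      by (simp add: simple_root_def sum_distrib_left algebra_simps)
  qed
  finally show ?thesis .
qed

lemma simple_refl_span:
  assumes "s \<in> J" "v \<in> span_on J"
  shows "simple_refl s v \<in> span_on J"
  using span_on_lin[OF assms(2) simple_root_span[OF assms(1)], of 1 "- 2 * bform (simple_root s) v"]
  by (simp add: simple_refl_def)

lemma simple_refl_lin:
  assumes "s \<in> S" "u \<in> V" "v \<in> V"
  shows "simple_refl s (\<lambda>t. a * u t + b * v t) = (\<lambda>t. a * simple_refl s u t + b * simple_refl s v t)"
  using assms
  by (simp add: simple_refl_def bform_lin_right simple_root_span fun_eq_iff algebra_simps)

lemma simple_refl_self: "s \<in> S \<Longrightarrow> simple_refl s (simple_root s) = (\<lambda>t. - simple_root s t)"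
  by (simp add: simple_refl_def bform_simple gram_self)

lemma simple_refl_bform:
  assumes "s \<in> S" "v \<in> V"
  shows "bform (simple_root s) (simple_refl s v) = - bform (simple_root s) v"
  using bform_lin_right[of "simple_root s" v "simple_root s" 1 "- 2 * bform (simple_root s) v"] assms
  by (simp add: simple_refl_def simple_root_span bform_simple gram_self)

lemma simple_refl_invol: "s \<in> S \<Longrightarrow> v \<in> V \<Longrightarrow> simple_refl s (simple_refl s v) = v"
  using simple_refl_bform
  by (simp add: simple_refl_def[of s "simple_refl s v"]) (simp add: simple_refl_def)

lemma simple_refl_isom:
  assumes s: "s \<in> S" and u: "u \<in> V" and v: "v \<in> V"
  shows "bform (simple_refl s u) (simple_refl s v) = bform u v"
proof -
  have a: "simple_root s \<in> V" using s simple_root_span by blast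
  have "bform (simple_refl s u) (simple_refl s v)
      = bform (simple_refl s u) v - 2 * bform (simple_root s) v * bform (simple_refl s u) (simple_root s)"
    using bform_lin_right[OF simple_refl_span[OF s u] v a, of 1 "- 2 * bform (simple_root s) v"]
    by (simp add: simple_refl_def[of s v])
  moreover have "bform (simple_refl s u) (simple_root s) = - bform (simple_root s) u"
    using simple_refl_bform[OF s u] bform_sym[OF a simple_refl_span[OF s u]] by simp
  moreover have "bform (simple_refl s u) v = bform u v - 2 * bform (simple_root s) u * bform (simple_root s) v"
    using bform_lin_left[OF v u a, of 1 "- 2 * bform (simple_root s) u"]
    by (simp add: simple_refl_def[of s u])
  ultimately show ?thesis by simp
qed

section \<open>The action of words and of group elements\<close>

abbreviation "word_act \<equiv> foldr simple_refl"

lemma word_act_span: "ws \<in> lists J \<Longrightarrow> v \<in> span_on J \<Longrightarrow> word_act ws v \<in> span_on J"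
  by (induction ws) (auto intro: simple_refl_span)

lemma word_act_lin:
  assumes "ws \<in> lists S" "u \<in> V" "v \<in> V"
  shows "word_act ws (\<lambda>t. a * u t + b * v t) = (\<lambda>t. a * word_act ws u t + b * word_act ws v t)"
  using assms(1) by (induction ws) (simp_all add: simple_refl_lin word_act_span assms)

lemma word_act_orth:
  assumes "ws \<in> lists {s, t}" "bform (simple_root s) v = 0" "bform (simple_root t) v = 0"
  shows "word_act ws v = v"
  using assms by (induction ws) (auto simp: simple_refl_def)

text \<open>The coefficients \<open>sin (n \<theta>) / sin \<theta>\<close> of the dihedral root strings, including the limit case
  \<open>\<theta> = 0\<close>, where they become \<open>n\<close>.\<close>

fun dih :: "real \<Rightarrow> nat \<Rightarrow> real" where
  "dih c 0 = 0"
| "dih c (Suc 0) = 1"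
| "dih c (Suc (Suc n)) = 2 * c * dih c (Suc n) - dih c n"

lemma dih_sin: "sin \<theta> * dih (cos \<theta>) n = sin (real n * \<theta>)"
proof (induction "cos \<theta>" n rule: dih.induct)
  case (3 n)
  have "sin (real (Suc (Suc n)) * \<theta>) + sin (real n * \<theta>) = 2 * cos \<theta> * sin (real (Suc n) * \<theta>)"
    using sin_times_cos[of "real (Suc n) * \<theta>" \<theta>] by (simp add: algebra_simps)
  with 3 show ?case by (simp add: algebra_simps)
qed auto

lemma dih_one: "dih 1 n = real n"
  by (induction "1::real" n rule: dih.induct) auto

text \<open>Alternating words are extended on the left, so that \<open>t\<close> is always the last letter.\<close>

fun alt :: "'a \<Rightarrow> 'a \<Rightarrow> nat \<Rightarrow> 'a list" where
  "alt s t 0 = []"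
| "alt s t (Suc n) = (if even n then t else s) # alt s t n"

lemma alt_lists: "alt s t n \<in> lists {s, t}"
  by (induction n) auto

lemma length_alt [simp]: "length (alt s t n) = n"
  by (induction n) auto

text \<open>Each new letter replaces one of the two coefficients by the recursion of
  \<open>dih\<close>. Which one depends on the parity, hence the alternating order of the indices n
  and n + 1.\<close>

lemma alt_act:
  assumes s: "s \<in> S" and t: "t \<in> S" and c: "c = - gram s t"
  shows "word_act (alt s t n) (simple_root s) =
    (\<lambda>r. dih c (if even n then Suc n else n) * simple_root s r + dih c (if even n then n else Suc n) * simple_root t r)"
proof (induction n)
  case (Suc n)
  have st: "simple_root s \<in> V" "simple_root t \<in> V" using s t simple_root_span by auto
  have ts: "simple_refl t (simple_root s) = (\<lambda>r. simple_root s r + 2 * c * simple_root t r)"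
    "simple_refl s (simple_root t) = (\<lambda>r. simple_root t r + 2 * c * simple_root s r)"
    using s t gram_sym[of s t] by (simp_all add: simple_refl_def bform_simple c)
  show ?case
  proof (cases "even n")
    case True
    then have "word_act (alt s t (Suc n)) (simple_root s) =
        (\<lambda>r. dih c (Suc n) * (simple_root s r + 2 * c * simple_root t r) + dih c n * (- simple_root t r))"
      by (simp add: Suc simple_refl_lin[OF t st] ts simple_refl_self t)
    then show ?thesis using True by (simp add: fun_eq_iff algebra_simps)
  next
    case False
    then have "word_act (alt s t (Suc n)) (simple_root s) =
        (\<lambda>r. dih c n * (- simple_root s r) + dih c (Suc n) * (simple_root t r + 2 * c * simple_root s r))"
      by (simp add: Suc simple_refl_lin[OF s st] ts simple_refl_self s)
    then show ?thesis using False by (simp add: fun_eq_iff algebra_simps)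
  qed
qed simp

lemma ord_ge_2: "s \<in> S \<Longrightarrow> t \<in> S \<Longrightarrow> s \<noteq> t \<Longrightarrow> ord (s \<otimes> t) \<noteq> 0 \<Longrightarrow> ord (s \<otimes> t) \<ge> 2"
proof -
  assume a: "s \<in> S" "t \<in> S" "s \<noteq> t" "ord (s \<otimes> t) \<noteq> 0"
  have "ord (s \<otimes> t) \<noteq> 1"
  proof
    assume "ord (s \<otimes> t) = 1"
    then have "s \<otimes> t = \<one>" using ord_eq_1 a S_carrier by simp
    then have "s = inv t" using a S_carrier inv_equality by (metis inv_inv)
    then show False using a S_inv by simp
  qed
  then show ?thesis using a by linarith
qed

lemma alt_even: "alt s t (2 * m) = concat (replicate m [s, t])"
  by (induction m) auto

lemma alt_snoc: "alt s t (Suc n) = alt t s n @ [t]"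
  by (induction n) auto

text \<open>For finite order m \<ge> 2 the form is nondegenerate on the plane of the two simple
  roots, with determinant \<open>1 - c^2\<close>, the square of sin (\<pi> / m). So v splits into a
  part in the plane, on which the word is a rotation by 2 \<pi>, and a part orthogonal to both
  roots, which every letter fixes.\<close>

lemma dihedral_relation:
  assumes s: "s \<in> S" and t: "t \<in> S" and v: "v \<in> V"
  shows "word_act (concat (replicate (ord (s \<otimes> t)) [s, t])) v = v"
\<comment> \<open>For s = t the order is 1 and the relator is s s; infinite order is recorded as 0,
  which makes the relator empty.\<close>
proof (cases "s = t \<or> ord (s \<otimes> t) = 0")
  case True
  moreover have "ord (s \<otimes> s) = 1" using S_sq[OF s] by simp
  ultimately show ?thesis using simple_refl_invol[OF s v] by auto
next
  case False
  define m where "m = ord (s \<otimes> t)"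
  have m: "m \<ge> 2" using False ord_ge_2 s t m_def by blast
  define \<theta> where "\<theta> = pi / real m"
  define c where "c = cos \<theta>"
  have gr: "gram s t = - c" using False by (simp add: gram_def m_def c_def \<theta>_def)
  have \<theta>: "0 < \<theta>" "\<theta> < pi" using m by (auto simp: \<theta>_def field_simps)
  have sn: "sin \<theta> > 0" using \<theta> sin_gt_zero by blast
  have m\<theta>: "real m * \<theta> = pi" using m by (simp add: \<theta>_def)
  have st: "simple_root s \<in> V" "simple_root t \<in> V" using s t simple_root_span by auto
  have det: "1 - c^2 > 0" using sn by (simp add: c_def sin_squared_eq[symmetric] cos_squared_eq)
  define ws where "ws = concat (replicate m [s, t])"
  have ws: "ws \<in> lists {s, t}" "ws \<in> lists S" using alt_lists[of s t "2*m"] s t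
    by (auto simp: ws_def simp flip: alt_even)
  \<comment> \<open>Since m \<theta> = \<pi>, the values at 2m, 2m + 1 and 2m - 1 are those at 0, 1
    and -1.\<close>
  have d1: "dih c (2 * m) = 0"
  proof -
    have "sin (real (2 * m) * \<theta>) = 0" using m\<theta> by (simp add: mult.assoc)
    then show ?thesis using dih_sin[of \<theta> "2*m"] sn by (simp add: c_def)
  qed
  have d2: "dih c (Suc (2 * m)) = 1"
  proof -
    have "real (Suc (2 * m)) * \<theta> = \<theta> + 2 * pi" using m\<theta> by (simp add: algebra_simps)
    then have "sin (real (Suc (2 * m)) * \<theta>) = sin \<theta>" by simp
    then show ?thesis using dih_sin[of \<theta> "Suc (2*m)"] sn by (simp add: c_def)
  qed
  have d3: "dih c (2 * m - 1) = -1"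
  proof -
    have "real (2 * m - 1) * \<theta> = - \<theta> + 2 * pi" using m\<theta> m by (simp add: of_nat_diff algebra_simps)
    then have "sin (real (2 * m - 1) * \<theta>) = - sin \<theta>" by simp
    then have "sin \<theta> * (dih c (2 * m - 1) + 1) = 0" using dih_sin[of \<theta> "2*m-1"]
      by (simp add: c_def algebra_simps)
    then show ?thesis using sn by auto
  qed
  have ws_s: "word_act ws (simple_root s) = simple_root s"
    using alt_act[OF s t HOL.refl, of "2*m"] d1 d2 gr by (simp add: ws_def alt_even)
  \<comment> \<open>Taking off the last letter t negates the root of t and leaves an alternating
    word ending in s, to which \<open>alt_act\<close> applies with the generators exchanged.\<close>
  have "word_act ws (simple_root t) = word_act (alt t s (2 * m - 1)) (simple_refl t (simple_root t))"
    using alt_snoc[of s t "2*m-1"] m by (simp add: ws_def flip: alt_even)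
  also have "\<dots> = word_act (alt t s (2 * m - 1)) (\<lambda>r. (-1) * simple_root t r + 0 * simple_root t r)"
    using simple_refl_self[OF t] by simp
  also have "\<dots> = (\<lambda>r. - word_act (alt t s (2 * m - 1)) (simple_root t) r)"
    using word_act_lin[of "alt t s (2 * m - 1)" "simple_root t" "simple_root t" "-1" 0]
      subsetD[OF lists_mono alt_lists[of t s "2*m-1"], of S] s t st by simp
  also have "\<dots> = simple_root t"
    using alt_act[OF t s HOL.refl, of "2*m-1"] d1 d3 gr m gram_sym[OF s t]
    by (auto simp: fun_eq_iff)
  finally have ws_t: "word_act ws (simple_root t) = simple_root t" .
  define a b where "a = bform (simple_root s) v" and "b = bform (simple_root t) v"
  \<comment> \<open>Cramer's rule: p and q are the coefficients of the vector in the plane that has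
    the same products a and b with the two simple roots as v.\<close>
  define p q where "p = (a + c * b) / (1 - c^2)" and "q = (b + c * a) / (1 - c^2)"
  have e: "p * (1 - c^2) = a + c * b" "q * (1 - c^2) = b + c * a" using det
    by (simp_all add: p_def q_def)
  have m: "(p - c * q - a) * (1 - c^2) = p * (1 - c^2) - c * (q * (1 - c^2)) - a * (1 - c^2)"
    "(q - c * p - b) * (1 - c^2) = q * (1 - c^2) - c * (p * (1 - c^2)) - b * (1 - c^2)"
    by (simp_all add: algebra_simps)
  have "(p - c * q - a) * (1 - c^2) = 0" "(q - c * p - b) * (1 - c^2) = 0"
    unfolding m e by (simp_all add: algebra_simps power2_eq_square)
  then have pq: "p - c * q = a" "q - c * p = b" using det by simp_all
  define u where "u = (\<lambda>r. p * simple_root s r + q * simple_root t r)"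
  have uV: "u \<in> V" unfolding u_def by (rule span_on_lin[OF st])
  define v' where "v' = (\<lambda>r. 1 * v r + (-1) * u r)"
  have v'V: "v' \<in> V" unfolding v'_def by (rule span_on_lin[OF v uV])
  have "bform (simple_root s) u = p - c * q" "bform (simple_root t) u = q - c * p"
    using bform_lin_right[OF st(1) st, of p q] bform_lin_right[OF st(2) st, of p q] gram_sym[OF s t, symmetric]
    by (simp_all add: u_def bform_simple gram_self s t gr algebra_simps)
  then have orth: "bform (simple_root s) v' = 0" "bform (simple_root t) v' = 0"
    using pq bform_lin_right[OF _ v uV, of _ 1 "-1"] st by (simp_all add: v'_def a_def b_def)
  have fu: "word_act ws u = u" unfolding u_def using word_act_lin[OF ws(2) st] ws_s ws_t by simp
  have "word_act ws v = word_act ws (\<lambda>r. 1 * v' r + 1 * u r)" by (simp add: v'_def)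
  also have "\<dots> = v" using word_act_lin[OF ws(2) v'V uV, of 1 1] fu word_act_orth[OF ws(1) orth]
    by (simp add: v'_def)
  finally show ?thesis by (simp add: ws_def m_def)
qed

lemma coxeter_cong_act: "coxeter_cong G S us vs \<Longrightarrow> v \<in> V \<Longrightarrow> word_act us v = word_act vs v"
proof (induction rule: coxeter_cong.induct)
  case (relator s t us vs)
  then show ?case using dihedral_relation word_act_span[of vs S v] by simp
qed auto

text \<open>\<open>act\<close> uses some chosen word; the presentation makes any other word for the
  element congruent to it, and congruent words act alike on V.\<close>

lemma act_word:
  assumes "ws \<in> lists S" "v \<in> V"
  shows "act (word_prod G ws) v = word_act ws v"
proof -
  let ?P = "\<lambda>us. us \<in> lists S \<and> word_prod G us = word_prod G ws"
  have "?P (SOME us. ?P us)" using assms by (intro someI[of ?P ws]) auto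
  then have "coxeter_cong G S (SOME us. ?P us) ws" using presentation assms by metis
  then show ?thesis using coxeter_cong_act assms by (simp add: act_def)
qed

lemma act_one [simp]: "v \<in> V \<Longrightarrow> act \<one> v = v"
  using act_word[of "[]"] by simp

lemma act_S: "s \<in> S \<Longrightarrow> v \<in> V \<Longrightarrow> act s v = simple_refl s v"
  using act_word[of "[s]"] S_carrier by simp

lemma act_V:
  assumes "w \<in> carrier G" "v \<in> V"
  shows "act w v \<in> V"
  using carrier_word[OF assms(1)] act_word assms word_act_span by metis

lemma act_mult:
  assumes "g \<in> carrier G" "h \<in> carrier G" "v \<in> V"
  shows "act (g \<otimes> h) v = act g (act h v)"
proof -
  obtain us vs where "us \<in> lists S" "word_prod G us = g" "vs \<in> lists S" "word_prod G vs = h"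
    using carrier_word assms by metis
  moreover have "word_prod G (us @ vs) = g \<otimes> h" using calculation word_prod_append lists_S_carrier
    by simp
  ultimately show ?thesis
    using act_word[of "us @ vs" v] act_word[of us "word_act vs v"] act_word[of vs v] assms(3) word_act_span[of vs S v]
    by simp
qed

lemma act_lin:
  assumes "w \<in> carrier G" "u \<in> V" "v \<in> V"
  shows "act w (\<lambda>t. a * u t + b * v t) = (\<lambda>t. a * act w u t + b * act w v t)"
proof -
  obtain us where us: "us \<in> lists S" "word_prod G us = w" using carrier_word assms by metis
  show ?thesis using act_word[OF us(1)] word_act_lin[OF us(1)] assms span_on_lin[of u S v a b] us(2)
    by simp
qed

lemma act_scale: "w \<in> carrier G \<Longrightarrow> u \<in> V \<Longrightarrow> act w (\<lambda>t. a * u t) = (\<lambda>t. a * act w u t)"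
  using act_lin[of w u u a 0] by simp

lemma act_uminus: "w \<in> carrier G \<Longrightarrow> u \<in> V \<Longrightarrow> act w (\<lambda>t. - u t) = (\<lambda>t. - act w u t)"
  using act_scale[of w u "-1"] by simp

lemma act_bform:
  assumes "w \<in> carrier G" "u \<in> V" "v \<in> V"
  shows "bform (act w u) (act w v) = bform u v"
proof -
  obtain us where us: "us \<in> lists S" "word_prod G us = w" using carrier_word assms by metis
  have "bform (word_act us u) (word_act us v) = bform u v" using us(1)
    by (induction us) (auto simp: simple_refl_isom word_act_span assms)
  then show ?thesis using us act_word assms by metis
qed

lemma act_inv_act [simp]: "w \<in> carrier G \<Longrightarrow> v \<in> V \<Longrightarrow> act (inv w) (act w v) = v"
  by (simp flip: act_mult)

lemma act_act_inv [simp]: "w \<in> carrier G \<Longrightarrow> v \<in> V \<Longrightarrow> act w (act (inv w) v) = v"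
  by (simp flip: act_mult)

lemma act_inj: "w \<in> carrier G \<Longrightarrow> u \<in> V \<Longrightarrow> v \<in> V \<Longrightarrow> act w u = act w v \<Longrightarrow> u = v"
  by (metis act_inv_act)

text \<open>A simple reflection changes no coordinate but its own. Hence a nonzero coordinate
  outside J fixes the sign of a root throughout its orbit under the parabolic subgroup.\<close>

lemma act_generate_outside:
  assumes "J \<subseteq> S" "w \<in> generate G J" "v \<in> V" "r \<notin> J"
  shows "act w v r = v r"
  using assms(2,1)
proof (induction w rule: generate_induct)
  case (mult s w)
  have w: "w \<in> carrier G" "s \<in> carrier G" "s \<in> S" using mult generate_subset_carrier S_carrier assms
    by auto
  then show ?case using mult assms
    by (auto simp: act_mult act_S act_V simple_refl_def simple_root_def)
qed (use assms in auto)

lemma act_span: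
  assumes "J \<subseteq> S" "w \<in> generate G J" "v \<in> span_on J"
  shows "act w v \<in> span_on J"
proof -
  obtain us where "us \<in> lists J" "word_prod G us = w" using generate_word assms by metis
  then show ?thesis using act_word[of us v] word_act_span assms lists_mono[OF assms(1)] span_on_mono
    by (metis subsetD)
qed

text \<open>Linearity is asked for on V only, so that the expansion serves both for the coordinates
  of \<open>act w v\<close> and for averaged functionals.\<close>

lemma linear_expand:
  fixes \<phi> :: "('a \<Rightarrow> real) \<Rightarrow> real"
  assumes lin: "\<And>u v a b. u \<in> V \<Longrightarrow> v \<in> V \<Longrightarrow> \<phi> (\<lambda>r. a * u r + b * v r) = a * \<phi> u + b * \<phi> v"
    and A: "finite A" "supp v \<subseteq> A" "A \<subseteq> S"
  shows "\<phi> v = (\<Sum>t\<in>A. v t * \<phi> (simple_root t))"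
  using A
proof (induction A arbitrary: v)
  case empty
  then have v: "v = (\<lambda>_. 0)" by (auto simp: supp_def)
  have zV: "(\<lambda>_. 0) \<in> V" by (simp add: span_on_def supp_def)
  show ?case using lin[OF zV zV, of 0 0] v by simp
next
  case (insert x A)
  define u where "u = v(x := 0)"
  have u: "supp u \<subseteq> A" "u \<in> V" using insert
    by (auto simp: u_def supp_def span_on_def intro: finite_subset[of _ A])
  have x: "simple_root x \<in> V" using insert simple_root_span by auto
  have "v = (\<lambda>t. 1 * u t + v x * simple_root x t)" by (auto simp: u_def simple_root_def)
  then have "\<phi> v = \<phi> u + v x * \<phi> (simple_root x)" using lin[OF u(2) x, of 1 "v x"]
    by (metis (no_types, lifting) mult_1)
  moreover have "\<phi> u = (\<Sum>t\<in>A. u t * \<phi> (simple_root t))" using insert.IH[OF u(1)] insert.prems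
    by blast
  moreover have "\<dots> = (\<Sum>t\<in>A. v t * \<phi> (simple_root t))"
    by (intro sum.cong) (use insert.hyps in \<open>auto simp: u_def\<close>)
  ultimately show ?case using insert.hyps by simp
qed

lemma act_expand:
  assumes "w \<in> carrier G" "finite A" "supp v \<subseteq> A" "A \<subseteq> S"
  shows "act w v r = (\<Sum>t\<in>A. v t * act w (simple_root t) r)"
  by (rule linear_expand[of "\<lambda>v. act w v r"]) (use assms in \<open>simp_all add: act_lin\<close>)

section \<open>Positive and negative roots\<close>

abbreviation "len \<equiv> length_S"

lemma len_witness:
  assumes "w \<in> carrier G"
  shows "\<exists>ws \<in> lists S. length ws = len w \<and> word_prod G ws = w"
proof -
  obtain us where "us \<in> lists S" "word_prod G us = w" using carrier_word assms by blast
  then have "\<exists>n. \<exists>ws\<in>lists S. length ws = n \<and> word_prod G ws = w" by blast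
  then show ?thesis unfolding length_S_def by (rule LeastI_ex)
qed

lemma len_le: "ws \<in> lists S \<Longrightarrow> len (word_prod G ws) \<le> length ws"
  unfolding length_S_def by (rule Least_le) auto

lemma len_mult:
  assumes "v \<in> carrier G" "w \<in> carrier G"
  shows "len (v \<otimes> w) \<le> len v + len w"
proof -
  obtain us vs where "us \<in> lists S" "length us = len v" "word_prod G us = v"
      "vs \<in> lists S" "length vs = len w" "word_prod G vs = w"
    using len_witness assms by metis
  then show ?thesis using len_le[of "us @ vs"] word_prod_append[of us vs] lists_S_carrier by auto
qed

lemma len_S: "s \<in> S \<Longrightarrow> len s \<le> 1"
  using len_le[of "[s]"] S_carrier by simp

lemma len_mult_S: "w \<in> carrier G \<Longrightarrow> s \<in> S \<Longrightarrow> len (w \<otimes> s) \<le> Suc (len w)"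
  using len_mult[of w s] len_S[of s] S_carrier by fastforce

lemma mult_S_S: "w \<in> carrier G \<Longrightarrow> s \<in> S \<Longrightarrow> w \<otimes> s \<otimes> s = w"
  using S_carrier S_sq by (simp add: m_assoc)

text \<open>The last letter of a shortest word does it; the length drops by exactly one because
  multiplying back by t adds at most one.\<close>

lemma len_descent:
  assumes "w \<in> carrier G" "w \<noteq> \<one>"
  shows "\<exists>t \<in> S. len w = Suc (len (w \<otimes> t))"
proof -
  obtain ws where ws: "ws \<in> lists S" "length ws = len w" "word_prod G ws = w"
    using len_witness assms by blast
  then have "ws \<noteq> []" using assms by auto
  then obtain us t where ut: "ws = us @ [t]" by (cases ws rule: rev_cases) auto
  then have t: "t \<in> S" "us \<in> lists S" using ws by auto
  then have w: "w = word_prod G us \<otimes> t"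
    using ws ut word_prod_append[of us "[t]"] lists_S_carrier S_carrier by auto
  then have "w \<otimes> t = word_prod G us" using mult_S_S t lists_S_carrier by simp
  then have "len (w \<otimes> t) \<le> length us" using len_le t by simp
  then have "len w = Suc (len (w \<otimes> t))"
    using ws ut len_mult_S[of "w \<otimes> t" t] t assms S_carrier mult_S_S[of w t] by simp
  then show ?thesis using t by blast
qed

lemma alt_prod_pow:
  assumes "s \<in> S" "t \<in> S"
  shows "word_prod G (alt s t (2 * m)) = (s \<otimes> t) [^] m"
proof (induction m)
  case (Suc m)
  have "word_prod G (alt s t (2 * Suc m)) = s \<otimes> t \<otimes> (s \<otimes> t) [^] m"
    using Suc assms S_carrier by (simp add: m_assoc)
  also have "\<dots> = (s \<otimes> t) [^] m \<otimes> (s \<otimes> t)" using assms S_carrier nat_pow_comm[of "s \<otimes> t" 1 m] by simp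
  finally show ?case by simp
qed simp

lemma alt_carrier: "s \<in> S \<Longrightarrow> t \<in> S \<Longrightarrow> set (alt s t n) \<subseteq> carrier G"
  using alt_lists[of s t n] S_carrier by auto

text \<open>The reversed word cancels the last n letters one by one, and the parity of n decides
  whether the rest ends in t or in s. With k = n = m this turns \<open>(s t)^m = 1\<close> into the
  braid relation.\<close>

lemma alt_cancel:
  assumes "s \<in> S" "t \<in> S"
  shows "word_prod G (alt s t (k + n)) \<otimes> word_prod G (rev (alt s t n)) =
    word_prod G (if even n then alt s t k else alt t s k)"
  using assms
proof (induction n arbitrary: s t)
  case (Suc n)
  have c: "set (alt t s (k + n)) \<subseteq> carrier G" "set (rev (alt t s n)) \<subseteq> carrier G" "t \<in> carrier G"
    using alt_carrier Suc S_carrier by auto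
  have "word_prod G (alt s t (k + Suc n)) = word_prod G (alt t s (k + n)) \<otimes> t"
    using alt_snoc[of s t "k + n"] word_prod_append[OF c(1), of "[t]"] c by simp
  moreover have "word_prod G (rev (alt s t (Suc n))) = t \<otimes> word_prod G (rev (alt t s n))"
    by (subst alt_snoc) simp
  ultimately have "word_prod G (alt s t (k + Suc n)) \<otimes> word_prod G (rev (alt s t (Suc n)))
      = word_prod G (alt t s (k + n)) \<otimes> (t \<otimes> t) \<otimes> word_prod G (rev (alt t s n))"
    using c by (simp add: m_assoc)
  also have "\<dots> = word_prod G (alt t s (k + n)) \<otimes> word_prod G (rev (alt t s n))"
    using c S_sq[of t] Suc by simp
  finally show ?case using Suc.IH[of t s] Suc.prems by auto
qed (use alt_carrier in auto)

lemma alt_braid: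
  assumes st: "s \<in> S" "t \<in> S" and m: "m = ord (s \<otimes> t)"
  shows "word_prod G (alt s t m) = word_prod G (alt t s m)"
proof -
  have c: "word_prod G (alt s t m) \<in> carrier G" "word_prod G (alt t s m) \<in> carrier G"
    "word_prod G (rev (alt s t m)) \<in> carrier G"
    using alt_carrier st by simp_all
  have one: "word_prod G (alt s t (m + m)) = \<one>"
    using alt_prod_pow[OF st, of m] pow_ord_eq_1[of "s \<otimes> t"] S_carrier st m by (simp add: mult_2)
  have b: "word_prod G (rev (alt s t m)) = word_prod G (if even m then alt s t m else alt t s m)"
    using alt_cancel[OF st, of m m] one c by simp
  have "rev (alt s t n) = (if even n then alt t s n else alt s t n)" for n
  proof (induction n arbitrary: s t)
    case (Suc n)
    show ?case by (subst alt_snoc) (use Suc in auto)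
  qed simp
  then show ?thesis using b by (cases "even m") simp_all
qed

lemma adjacent_free_alt:
  assumes "ws \<in> lists {s, t}" "successively (\<noteq>) (ws @ [t'])" "t' \<in> {s, t}" "s \<noteq> t"
  shows "ws @ [t'] = (if t' = t then alt s t (Suc (length ws)) else alt t s (Suc (length ws)))"
  using assms
proof (induction ws arbitrary: t' rule: rev_induct)
  case (snoc x ws)
  have "successively (\<noteq>) (ws @ [x])" "x \<noteq> t'" using snoc.prems
    by (auto simp: successively_append_iff)
  moreover have x: "x \<in> {s, t}" "ws \<in> lists {s, t}" using snoc.prems by auto
  ultimately have eq: "ws @ [x] = (if x = t then alt s t (Suc (length ws)) else alt t s (Suc (length ws)))"
    using snoc.IH[of x] snoc.prems by blast
  show ?case
  proof (cases "t' = t")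
    case True
    then have "x = s" using \<open>x \<in> {s, t}\<close> \<open>x \<noteq> t'\<close> by auto
    then show ?thesis using eq True \<open>s \<noteq> t\<close> alt_snoc[of s t "Suc (length ws)"]
      by (simp del: alt.simps append_assoc)
  next
    case False
    then have "x = t" "t' = s" using \<open>x \<in> {s, t}\<close> \<open>x \<noteq> t'\<close> snoc.prems by auto
    then show ?thesis using eq False alt_snoc[of t s "Suc (length ws)"]
      by (simp del: alt.simps append_assoc)
  qed
qed auto

text \<open>Split \<open>w = v p\<close> with \<open>p\<close> in the dihedral subgroup of \<open>s\<close> and the last letter \<open>t\<close> of \<open>w\<close>, and \<open>v\<close> as
  short as possible; then \<open>p\<close> maps the root of \<open>s\<close> to a nonnegative combination of the roots of \<open>s\<close> and
  \<open>t\<close>, and the induction hypothesis applies to \<open>v\<close>.\<close>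

theorem len_nonneg:
  assumes "w \<in> carrier G" "s \<in> S" "len w \<le> len (w \<otimes> s)"
  shows "0 \<le> act w (simple_root s) r"
  using assms
proof (induction "len w" arbitrary: w s rule: less_induct)
  case less
  note w = less.prems(1) and s = less.prems(2)
  show ?case
  proof (cases "w = \<one>")
    case True
    then show ?thesis using s simple_root_span by (simp add: simple_root_def)
  next
    case False
    then obtain t where t: "t \<in> S" "len w = Suc (len (w \<otimes> t))" using len_descent w by blast
    have st: "s \<noteq> t" using t less.prems by auto
    have sc: "s \<in> carrier G" "t \<in> carrier G" using s t S_carrier by auto
    define P where "P = (\<lambda>v. v \<in> carrier G \<and> (\<exists>ws \<in> lists {s, t}. w = v \<otimes> word_prod G ws \<and> len v + length ws = len w))"
    have Pwt: "P (w \<otimes> t)" unfolding P_def using w t sc mult_S_S[of w t]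
      by (intro conjI bexI[of _ "[t]"]) auto
    define v where "v = (ARG_MIN len v. P v)"
    have Pv: "P v" "\<And>v'. P v' \<Longrightarrow> len v \<le> len v'"
      using arg_min_natI[of P _ len, OF Pwt] arg_min_nat_le[of P _ len] by (auto simp: v_def)
    have v: "v \<in> carrier G" using Pv by (simp add: P_def)
    obtain ws where ws: "ws \<in> lists {s, t}" "w = v \<otimes> word_prod G ws" "len v + length ws = len w"
      using Pv by (auto simp: P_def)
    have wsS: "ws \<in> lists S" "set ws \<subseteq> carrier G" using ws s t S_carrier by auto
    have lv: "len v < len w" using Pv(2)[OF Pwt] t by simp
    \<comment> \<open>Otherwise x could be moved from v into the dihedral factor, against the choice
      of v.\<close>
    have up: "len v \<le> len (v \<otimes> x)" if "x \<in> {s, t}" for x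
    proof (rule ccontr)
      assume n: "\<not> len v \<le> len (v \<otimes> x)"
      have x: "x \<in> S" "x \<in> carrier G" using that s t sc by auto
      have e: "w = (v \<otimes> x) \<otimes> word_prod G (x # ws)"
        using ws v x wsS mult_S_S[OF v x(1)] by (simp flip: m_assoc)
      have "len w \<le> len (v \<otimes> x) + length (x # ws)"
        using len_mult[of "v \<otimes> x" "word_prod G (x # ws)"] len_le[of "x # ws"] e v x wsS by simp
      then have "P (v \<otimes> x)" unfolding P_def using e n ws that v x
        by (intro conjI bexI[of _ "x # ws"]) auto
      then show False using Pv(2) n by blast
    qed
    have vs: "0 \<le> act v (simple_root x) r" if "x \<in> {s, t}" for x
      using less.hyps[OF lv v _ up[OF that]] that s t by auto
    have short: "length ws \<le> length us" if "us \<in> lists S" "word_prod G us = word_prod G ws" for us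
      using len_mult[of v "word_prod G us"] len_le[of us] that ws v wsS(2) by simp
    have "ws \<noteq> []" using lv ws by auto
    then obtain us x where us: "ws = us @ [x]" by (cases ws rule: rev_cases) auto
    have x: "x \<in> {s, t}" "us \<in> lists {s, t}" using us ws by auto
    \<comment> \<open>Such a word would make w s shorter than w, against the hypothesis on lengths.
      So no shortest expression of the dihedral factor ends in s.\<close>
    have notend: False if "us' \<in> lists {s, t}" "word_prod G (us' @ [s]) = word_prod G ws"
      "length us' = length us" for us'
    proof -
      have c: "set us' \<subseteq> carrier G" "us' \<in> lists S" using that sc s t by auto
      have "w \<otimes> s = v \<otimes> word_prod G us'"
        using ws that(2) word_prod_append[OF c(1), of "[s]"] sc v c S_sq[OF s]
        by (metis (no_types, lifting) m_assoc m_closed mult_S_S s word_prod_Cons word_prod_Nil r_one set_simps(1) set_simps(2) word_prod_closed insert_subset empty_subsetI)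
      then have "len (w \<otimes> s) \<le> len v + length us'"
        using len_mult[of v "word_prod G us'"] len_le[OF c(2)] v c by simp
      then show False using less.prems(3) ws us that(3) by simp
    qed
    have xt: "x = t" using notend[of us] x us by auto
    have succ: "successively (\<noteq>) ws"
    proof (rule ccontr)
      assume "\<not> successively (\<noteq>) ws"
      then obtain i where i: "Suc i < length ws" "ws ! i = ws ! Suc i"
        by (auto simp: successively_conv_nth)
      define b where "b = drop (Suc (Suc i)) ws"
      have dec: "ws = take i ws @ [ws ! i, ws ! i] @ b"
        using i
        by (simp add: b_def Cons_nth_drop_Suc id_take_nth_drop[symmetric]) (metis Cons_nth_drop_Suc Suc_lessD append_take_drop_id)
      have c: "set (take i ws) \<subseteq> carrier G" "set b \<subseteq> carrier G" "ws ! i \<in> S" "ws ! i \<in> carrier G"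
        "take i ws \<in> lists S" "b \<in> lists S"
        using wsS i S_carrier set_take_subset[of i ws] set_drop_subset[of "Suc (Suc i)" ws]
        unfolding b_def by auto
      have "word_prod G ws = word_prod G (take i ws) \<otimes> (ws ! i \<otimes> (ws ! i \<otimes> word_prod G b))"
        by (subst dec) (use c in \<open>simp add: word_prod_append\<close>)
      also have "\<dots> = word_prod G (take i ws @ b)" using c S_sq[of "ws ! i"]
        by (simp add: word_prod_append flip: m_assoc[of "ws ! i"])
      finally have "length ws \<le> length (take i ws @ b)" using c by (intro short) auto
      then show False using i by (simp add: b_def)
    qed
    define n where "n = length ws"
    have alt: "ws = alt s t n" using adjacent_free_alt[of us s t x] x succ us xt st
      by (simp add: n_def)
    define c where "c = - gram s t"
    have dpos: "0 \<le> dih c k" if "k \<le> Suc n" for k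
    proof (cases "ord (s \<otimes> t) = 0")
      case True
      then show ?thesis by (simp add: c_def gram_def dih_one)
    next
      case False
      define m where "m = ord (s \<otimes> t)"
      have m: "m \<ge> 2" using ord_ge_2 False s t st m_def by blast
      \<comment> \<open>Otherwise the braid relation could rewrite the last m letters so that the
        word ends in s.\<close>
      have "n < m"
      proof (rule ccontr)
        assume "\<not> n < m"
        then have "n = (n - m) + m" by simp
        moreover have "alt s t (k + m) = (if even m then alt s t k else alt t s k) @ alt s t m" for k
          by (induction k) (auto split: if_splits)
        ultimately obtain ys where ys: "ws = ys @ alt s t m" "ys \<in> lists {s, t}"
          using alt alt_lists[of s t "n-m"] alt_lists[of t s "n-m"]
          by (metis (full_types) insert_commute)
        have cy: "set ys \<subseteq> carrier G" using ys sc by auto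
        have "word_prod G ws = word_prod G (ys @ alt t s m)"
          using ys cy alt_braid[OF s t(1) m_def] word_prod_append alt_carrier s t by simp
        also have "ys @ alt t s m = (ys @ alt s t (m - 1)) @ [s]" using alt_snoc[of t s "m - 1"] m
          by simp
        finally have e: "word_prod G ws = word_prod G ((ys @ alt s t (m - 1)) @ [s])" .
        have "length ws = length ys + m" using arg_cong[OF ys(1), of length] by simp
        moreover have "length ws = Suc (length us)" using arg_cong[OF us, of length] by simp
        ultimately have "length (ys @ alt s t (m - 1)) = length us" using m by simp
        then show False using notend[of "ys @ alt s t (m - 1)"] e ys(2) alt_lists[of s t "m - 1"]
          by simp
      qed
      define \<theta> where "\<theta> = pi / real m"
      have \<theta>: "0 < \<theta>" "\<theta> < pi" "real m * \<theta> = pi" using m by (auto simp: \<theta>_def field_simps)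
      have "sin \<theta> > 0" using \<theta> sin_gt_zero by blast
      moreover have "c = cos \<theta>" using False by (simp add: c_def gram_def m_def \<theta>_def)
      \<comment> \<open>The largest index that occurs is n + 1 \<le> m, so the angle stays between 0
        and \<pi>.\<close>
      moreover have "sin (real k * \<theta>) \<ge> 0"
      proof (rule sin_ge_zero)
        have "real k * \<theta> \<le> real m * \<theta>" using \<theta> \<open>n < m\<close> that by (intro mult_right_mono) auto
        then show "real k * \<theta> \<le> pi" using \<theta> by simp
      qed (use \<theta> in simp)
      ultimately show ?thesis using dih_sin[of \<theta> k]
        by (metis zero_le_mult_iff less_eq_real_def not_less)
    qed
    have sr: "simple_root s \<in> V" "simple_root t \<in> V" using s t simple_root_span by auto
    have "act w (simple_root s) = act v (act (word_prod G ws) (simple_root s))"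
      using ws v wsS sr by (simp add: act_mult)
    also have "act (word_prod G ws) (simple_root s) =
        (\<lambda>r. dih c (if even n then Suc n else n) * simple_root s r + dih c (if even n then n else Suc n) * simple_root t r)"
      using act_word[OF wsS(1) sr(1)] alt_act[OF s t(1) c_def, of n] alt by simp
    finally show ?thesis using act_lin[OF v sr] vs dpos
      by (auto intro!: add_nonneg_nonneg mult_nonneg_nonneg)
  qed
qed

section \<open>Roots, inversions and reflections\<close>

lemma root_V: "\<gamma> \<in> roots \<Longrightarrow> \<gamma> \<in> V"
  unfolding roots_def using act_V simple_root_span by blast

lemma pos_root: "\<gamma> \<in> pos_roots \<Longrightarrow> \<gamma> \<in> roots"
  by (simp add: pos_roots_def)

lemma pos_root_V: "\<gamma> \<in> pos_roots \<Longrightarrow> \<gamma> \<in> V"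
  using pos_root root_V by blast

lemma act_root: "w \<in> carrier G \<Longrightarrow> \<gamma> \<in> roots \<Longrightarrow> act w \<gamma> \<in> roots"
proof -
  assume w: "w \<in> carrier G" and "\<gamma> \<in> roots"
  then obtain v s where v: "v \<in> carrier G" "s \<in> S" "\<gamma> = act v (simple_root s)"
    by (auto simp: roots_def)
  then have "act w \<gamma> = act (w \<otimes> v) (simple_root s)" using w simple_root_span by (simp add: act_mult)
  then show ?thesis unfolding roots_def using v w by blast
qed

lemma simple_root_root: "s \<in> S \<Longrightarrow> simple_root s \<in> roots"
  unfolding roots_def using act_one[OF simple_root_span] by (force intro: exI[of _ \<one>])

lemma simple_root_pos: "s \<in> S \<Longrightarrow> simple_root s \<in> pos_roots"
  using simple_root_root by (simp add: pos_roots_def simple_root_def)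

lemma root_norm: "\<gamma> \<in> roots \<Longrightarrow> bform \<gamma> \<gamma> = 1"
  unfolding roots_def using act_bform simple_root_span by (force simp: bform_simple gram_self)

lemma root_uminus:
  assumes "\<gamma> \<in> roots"
  shows "(\<lambda>s. - \<gamma> s) \<in> roots"
proof -
  obtain w s where ws: "w \<in> carrier G" "s \<in> S" "\<gamma> = act w (simple_root s)" using assms
    by (auto simp: roots_def)
  have a: "simple_root s \<in> V" using ws simple_root_span by blast
  have "(\<lambda>s. - \<gamma> s) = act (w \<otimes> s) (simple_root s)"
    using ws a S_carrier by (simp add: act_mult act_S simple_refl_self act_uminus)
  then show ?thesis unfolding roots_def using ws S_carrier by blast
qed

lemma root_nonzero: "\<gamma> \<in> roots \<Longrightarrow> \<exists>r. \<gamma> r \<noteq> 0"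
proof (rule ccontr)
  assume g: "\<gamma> \<in> roots" "\<nexists>r. \<gamma> r \<noteq> 0"
  then have "bform \<gamma> \<gamma> = 0" by (simp add: bform_def)
  then show False using root_norm g by simp
qed

text \<open>\<open>len_nonneg\<close> applies either to w or to w s, which represents the negative
  of the root.\<close>

lemma root_pos_or_neg:
  assumes "\<gamma> \<in> roots"
  shows "\<gamma> \<in> pos_roots \<or> (\<lambda>s. - \<gamma> s) \<in> pos_roots"
proof -
  obtain w s where ws: "w \<in> carrier G" "s \<in> S" "\<gamma> = act w (simple_root s)" using assms
    by (auto simp: roots_def)
  have a: "simple_root s \<in> V" using ws simple_root_span by blast
  show ?thesis
  proof (cases "len w \<le> len (w \<otimes> s)")
    case True
    then show ?thesis using len_nonneg ws assms by (simp add: pos_roots_def)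
  next
    case False
    have "0 \<le> act (w \<otimes> s) (simple_root s) r" for r
      using len_nonneg[of "w \<otimes> s" s r] False mult_S_S ws S_carrier by simp
    then have "0 \<le> - \<gamma> r" for r
      using ws a S_carrier by (simp add: act_mult act_S simple_refl_self act_uminus)
    then show ?thesis using root_uminus[OF assms] by (simp add: pos_roots_def)
  qed
qed

lemma pos_not_neg: "\<gamma> \<in> pos_roots \<Longrightarrow> (\<lambda>s. - \<gamma> s) \<notin> pos_roots"
proof
  assume g: "\<gamma> \<in> pos_roots" "(\<lambda>s. - \<gamma> s) \<in> pos_roots"
  then have "0 \<le> \<gamma> r" "0 \<le> - \<gamma> r" for r by (auto simp: pos_roots_def)
  then have "\<gamma> r = 0" for r by (simp add: order_antisym)
  then show False using root_nonzero[of \<gamma>] pos_root g by blast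
qed

lemma not_pos_iff: "\<gamma> \<in> roots \<Longrightarrow> \<gamma> \<notin> pos_roots \<longleftrightarrow> (\<lambda>s. - \<gamma> s) \<in> pos_roots"
  using root_pos_or_neg pos_not_neg by blast

lemma pos_rootI: "\<gamma> \<in> roots \<Longrightarrow> \<gamma> r > 0 \<Longrightarrow> \<gamma> \<in> pos_roots"
  using root_pos_or_neg[of \<gamma>] by (auto simp: pos_roots_def dest: spec[of _ r])

lemma neg_rootI: "\<gamma> r < 0 \<Longrightarrow> \<gamma> \<notin> pos_roots"
  by (auto simp: pos_roots_def intro!: exI[of _ r])

lemma len_less:
  assumes "w \<in> carrier G" "s \<in> S" "act w (simple_root s) \<in> pos_roots"
  shows "len w < len (w \<otimes> s)"
proof (rule ccontr)
  assume n: "\<not> len w < len (w \<otimes> s)"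
  have a: "simple_root s \<in> V" using assms simple_root_span by blast
  have "0 \<le> act (w \<otimes> s) (simple_root s) r" for r
    using len_nonneg[of "w \<otimes> s" s r] n mult_S_S assms S_carrier by simp
  then have "0 \<le> - act w (simple_root s) r" for r
    using assms a S_carrier by (simp add: act_mult act_S simple_refl_self act_uminus)
  then have "(\<lambda>r. - act w (simple_root s) r) \<in> pos_roots"
    using root_uminus[OF pos_root[OF assms(3)]] by (simp add: pos_roots_def)
  then show False using pos_not_neg[OF assms(3)] by simp
qed

lemma act_nonneg:
  assumes "w \<in> carrier G" "v \<in> V" "\<And>s. 0 \<le> v s" "\<And>s. v s \<noteq> 0 \<Longrightarrow> act w (simple_root s) \<in> pos_roots"
  shows "0 \<le> act w v r"
proof -
  have "act w v r = (\<Sum>t\<in>supp v. v t * act w (simple_root t) r)"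
    using assms by (intro act_expand) (auto simp: span_on_def)
  also have "\<dots> \<ge> 0" using assms
    by (intro sum_nonneg mult_nonneg_nonneg) (auto simp: supp_def pos_roots_def)
  finally show ?thesis .
qed

lemma act_pos:
  assumes "w \<in> carrier G" "\<beta> \<in> pos_roots" "\<And>s. \<beta> s \<noteq> 0 \<Longrightarrow> act w (simple_root s) \<in> pos_roots"
  shows "act w \<beta> \<in> pos_roots"
proof -
  have "0 \<le> act w \<beta> r" for r
    using act_nonneg[OF assms(1) pos_root_V[OF assms(2)] _ assms(3)] assms(2)
    unfolding pos_roots_def by blast
  then show ?thesis using act_root[OF assms(1) pos_root[OF assms(2)]] unfolding pos_roots_def
    by blast
qed

text \<open>A nontrivial element has a right descent, and by \<open>len_less\<close> the simple root
  of a descent does not stay positive.\<close>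

lemma simple_pos_one:
  assumes "w \<in> carrier G" "\<And>s. s \<in> S \<Longrightarrow> act w (simple_root s) \<in> pos_roots"
  shows "w = \<one>"
proof (rule ccontr)
  assume "w \<noteq> \<one>"
  then obtain t where "t \<in> S" "len w = Suc (len (w \<otimes> t))" using len_descent assms by blast
  then show False using len_less[of w t] assms by simp
qed

lemma pos_root_simple:
  assumes "\<beta> \<in> pos_roots" "supp \<beta> \<subseteq> {s}" "s \<in> S"
  shows "\<beta> = simple_root s"
proof -
  have b: "\<beta> = (\<lambda>r. \<beta> s * simple_root s r)" using assms(2) by (force simp: supp_def simple_root_def)
  have a: "simple_root s \<in> V" using assms simple_root_span by blast
  have bV: "\<beta> \<in> V" using assms pos_root_V by blast
  have "bform \<beta> (simple_root s) = bform (simple_root s) (\<lambda>r. \<beta> s * simple_root s r)"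
    using bform_sym[OF bV a] arg_cong[OF b, of "bform (simple_root s)"] by (rule HOL.trans)
  then have "bform \<beta> (simple_root s) = \<beta> s"
    using bform_scale_right[OF a a, of "\<beta> s"] by (simp add: bform_simple gram_self assms)
  moreover have "bform \<beta> \<beta> = bform \<beta> (\<lambda>r. \<beta> s * simple_root s r)"
    using arg_cong[OF b, of "bform \<beta>"] .
  ultimately have "bform \<beta> \<beta> = \<beta> s * \<beta> s" using bform_scale_right[OF bV a, of "\<beta> s"] by simp
  then have "\<beta> s * \<beta> s = 1" using root_norm pos_root assms by simp
  moreover have "\<beta> s \<ge> 0" using assms by (simp add: pos_roots_def)
  ultimately have "\<beta> s = 1" by (simp add: square_eq_1_iff)
  then show ?thesis using b by simp
qed

text \<open>A positive root other than that of s has a further nonzero coordinate, which the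
  reflection leaves alone.\<close>

lemma simple_refl_permutes:
  assumes "s \<in> S" "\<beta> \<in> pos_roots" "\<beta> \<noteq> simple_root s"
  shows "act s \<beta> \<in> pos_roots"
proof -
  obtain r where r: "r \<noteq> s" "\<beta> r \<noteq> 0" using pos_root_simple[of \<beta> s] assms by (auto simp: supp_def)
  then have "\<beta> r > 0" using assms by (auto simp: pos_roots_def order_less_le)
  moreover have "act s \<beta> r = \<beta> r" using r assms pos_root_V
    by (simp add: act_S simple_refl_def simple_root_def)
  ultimately show ?thesis using pos_rootI[of "act s \<beta>" r] act_root assms S_carrier pos_root by simp
qed

text \<open>Inverted roots are collected at the source of w. The set is finite and determines w, and
  its cardinality is the measure in the decompositions of groupoid elements.\<close>

definition inversions :: "'a \<Rightarrow> ('a \<Rightarrow> real) set" where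
  "inversions w = {\<beta> \<in> pos_roots. act w \<beta> \<notin> pos_roots}"

lemma inversions_pos: "\<beta> \<in> inversions w \<Longrightarrow> \<beta> \<in> pos_roots"
  by (simp add: inversions_def)

lemma inversions_neg: "w \<in> carrier G \<Longrightarrow> \<beta> \<in> inversions w \<Longrightarrow> (\<lambda>r. - act w \<beta> r) \<in> pos_roots"
  using not_pos_iff act_root pos_root by (auto simp: inversions_def)

lemma finite_inversions:
  assumes "w \<in> carrier G"
  shows "finite (inversions w)"
proof -
  have "w \<in> generate G S" "S \<subseteq> S" using assms gens_generate by simp_all
  then show ?thesis
  proof (induction rule: generate_induct)
    case one
    have "inversions \<one> = {}" by (auto simp: inversions_def pos_root_V)
    then show ?case by simp
  next
    case (mult s w)
    have w: "w \<in> carrier G" "s \<in> carrier G" using mult generate_subset_carrier S_carrier by auto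
    have "inversions (s \<otimes> w) \<subseteq> inversions w \<union> {act (inv w) (simple_root s)}"
    proof
      fix \<beta> assume b: "\<beta> \<in> inversions (s \<otimes> w)"
      then have bV: "\<beta> \<in> pos_roots" "\<beta> \<in> V" using inversions_pos pos_root_V by auto
      show "\<beta> \<in> inversions w \<union> {act (inv w) (simple_root s)}"
      proof (cases "act w \<beta> \<in> pos_roots")
        case True
        then have "act w \<beta> = simple_root s" using simple_refl_permutes[OF mult(1) True] b w bV
          by (auto simp: inversions_def act_mult)
        then have "act (inv w) (simple_root s) = \<beta>" using w bV by (metis act_inv_act)
        then show ?thesis by simp
      qed (use bV in \<open>simp add: inversions_def\<close>)
    qed
    then show ?case using mult finite_subset by blast
  qed
qed

lemma inversions_empty: "w \<in> carrier G \<Longrightarrow> inversions w = {} \<Longrightarrow> w = \<one>"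
  using simple_pos_one[of w] simple_root_pos by (auto simp: inversions_def)

text \<open>It suffices that \<open>u \<otimes> inv w\<close> inverts nothing. A positive root
  pulled back along w is positive up to sign, and there u and w behave alike.\<close>

lemma inversions_inj:
  assumes u: "u \<in> carrier G" and w: "w \<in> carrier G" and eq: "inversions u = inversions w"
  shows "u = w"
proof -
  have "inversions (u \<otimes> inv w) = {}"
  proof (rule ccontr)
    assume "inversions (u \<otimes> inv w) \<noteq> {}"
    then obtain \<beta> where b: "\<beta> \<in> pos_roots" "act (u \<otimes> inv w) \<beta> \<notin> pos_roots"
      by (auto simp: inversions_def)
    define \<gamma> where "\<gamma> = act (inv w) \<beta>"
    have V: "\<beta> \<in> V" using b pos_root_V by blast
    have g: "\<gamma> \<in> roots" "\<gamma> \<in> V" using b w act_root pos_root root_V by (auto simp: \<gamma>_def)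
    have wg: "act w \<gamma> = \<beta>" using w V by (simp add: \<gamma>_def)
    have ug: "act u \<gamma> \<notin> pos_roots" using b u w V by (simp add: \<gamma>_def act_mult)
    show False
    proof (cases "\<gamma> \<in> pos_roots")
      case True
      then show False using ug wg eq b by (auto simp: inversions_def)
    next
      case False
      then have p: "(\<lambda>r. - \<gamma> r) \<in> pos_roots" using not_pos_iff g by blast
      have "(\<lambda>r. - \<gamma> r) \<in> inversions w" using p wg w g b pos_not_neg
        by (simp add: inversions_def act_uminus)
      then have "act u (\<lambda>r. - \<gamma> r) \<notin> pos_roots" using eq by (auto simp: inversions_def)
      then show False using u g ug not_pos_iff[OF act_root[OF u g(1)]] by (simp add: act_uminus)
    qed
  qed
  then have "u \<otimes> inv w = \<one>" using inversions_empty u w by simp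
  then show ?thesis using u w by (metis inv_closed inv_inv inv_equality)
qed

section \<open>Roots supported on a set of generators, and parabolic subgroups\<close>

definition roots_on :: "'a set \<Rightarrow> ('a \<Rightarrow> real) set" where
  "roots_on J = {\<beta> \<in> roots. supp \<beta> \<subseteq> J}"

lemma roots_on_span: "\<beta> \<in> roots_on J \<Longrightarrow> \<beta> \<in> span_on J"
  using root_V by (auto simp: roots_on_def span_on_def)

lemma roots_onI: "\<beta> \<in> roots \<Longrightarrow> \<beta> \<in> span_on J \<Longrightarrow> \<beta> \<in> roots_on J"
  by (auto simp: roots_on_def span_on_def)

lemma roots_on_uminus: "\<beta> \<in> roots_on J \<Longrightarrow> (\<lambda>r. - \<beta> r) \<in> roots_on J"
  using root_uminus by (auto simp: roots_on_def supp_def)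

lemma roots_on_act: "J \<subseteq> S \<Longrightarrow> w \<in> generate G J \<Longrightarrow> \<beta> \<in> roots_on J \<Longrightarrow> act w \<beta> \<in> roots_on J"
  using roots_onI[OF act_root act_span] generate_subset_carrier roots_on_span
  by (simp add: roots_on_def)

lemma generate_pos_outside:
  assumes "J \<subseteq> S" "w \<in> generate G J" "\<beta> \<in> pos_roots" "\<not> supp \<beta> \<subseteq> J"
  shows "act w \<beta> \<in> pos_roots"
proof -
  have w: "w \<in> carrier G" using generate_subset_carrier assms by blast
  obtain r where r: "r \<notin> J" "\<beta> r \<noteq> 0" using assms by (auto simp: supp_def)
  then have "\<beta> r > 0" using assms by (auto simp: pos_roots_def order_less_le)
  then show ?thesis
    using pos_rootI[of "act w \<beta>" r] act_root w pos_root act_generate_outside[of J w \<beta> r] assms r pos_root_V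
    by simp
qed

lemma inversions_generate: "J \<subseteq> S \<Longrightarrow> w \<in> generate G J \<Longrightarrow> inversions w \<subseteq> roots_on J"
  using generate_pos_outside[of J w] pos_root by (auto simp: inversions_def roots_on_def)

text \<open>A root that involves an index outside J stays positive under the parabolic subgroup, so
  the simple roots of J decide.\<close>

lemma generate_pos_one:
  assumes "J \<subseteq> S" "w \<in> generate G J" "\<And>s. s \<in> J \<Longrightarrow> act w (simple_root s) \<in> pos_roots"
  shows "w = \<one>"
proof (rule inversions_empty)
  show w: "w \<in> carrier G" using assms generate_subset_carrier by blast
  show "inversions w = {}"
  proof (rule ccontr)
    assume "inversions w \<noteq> {}"
    then obtain \<beta> where b: "\<beta> \<in> inversions w" by blast
    then have "\<beta> \<in> roots_on J" using inversions_generate assms by blast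
    then have "act w \<beta> \<in> pos_roots"
      using act_pos[OF w inversions_pos[OF b]] assms(3) by (auto simp: roots_on_def supp_def)
    then show False using b by (simp add: inversions_def)
  qed
qed

lemma simple_root_inj: "simple_root s = simple_root t \<longleftrightarrow> s = t"
  by (metis simple_root_def zero_neq_one)

text \<open>Indecomposability of simple roots; the sign \<open>e\<close> is needed for longest elements, which turn all
  positive roots into negative ones.\<close>

lemma simple_preimage_sign:
  assumes g: "g \<in> carrier G" and b: "\<beta> \<in> pos_roots" "supp \<beta> \<subseteq> J"
    and i: "i \<in> S" "(\<lambda>r. e * act g \<beta> r) = simple_root i" and e: "e = 1 \<or> e = -1"
    and J: "J \<subseteq> S" "\<And>j. j \<in> J \<Longrightarrow> (\<lambda>r. e * act g (simple_root j) r) \<in> pos_roots"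
  shows "\<exists>j \<in> J. \<beta> = simple_root j"
proof -
  have V: "\<beta> \<in> V" and fin: "finite (supp \<beta>)" using b pos_root_V by (auto simp: span_on_def)
  obtain j where j: "\<beta> j \<noteq> 0" using root_nonzero pos_root b by blast
  then have jJ: "j \<in> J" using b by (auto simp: supp_def)
  have "supp (\<lambda>r. e * act g (simple_root j) r) \<subseteq> {i}"
  proof
    fix r assume r: "r \<in> supp (\<lambda>r. e * act g (simple_root j) r)"
    show "r \<in> {i}"
    proof (rule ccontr)
      assume "r \<notin> {i}"
      then have "e * act g \<beta> r = 0" using fun_cong[OF i(2), of r] by (simp add: simple_root_def)
      moreover have "e * act g \<beta> r = (\<Sum>t\<in>supp \<beta>. \<beta> t * (e * act g (simple_root t) r))"
        by (subst act_expand[OF g fin order_refl]) (use V in \<open>auto simp: span_on_def sum_distrib_left intro!: sum.cong\<close>)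
      ultimately have "(\<Sum>t\<in>supp \<beta>. \<beta> t * (e * act g (simple_root t) r)) = 0" by simp
      moreover have nn: "0 \<le> \<beta> t * (e * act g (simple_root t) r)" if "t \<in> supp \<beta>" for t
      proof (rule mult_nonneg_nonneg)
        show "0 \<le> \<beta> t" using b by (simp add: pos_roots_def)
        have "(\<lambda>r. e * act g (simple_root t) r) \<in> pos_roots" using J(2) b that by blast
        then show "0 \<le> e * act g (simple_root t) r" unfolding pos_roots_def by blast
      qed
      ultimately have "\<forall>t \<in> supp \<beta>. \<beta> t * (e * act g (simple_root t) r) = 0"
        using sum_nonneg_eq_0_iff[OF fin, of "\<lambda>t. \<beta> t * (e * act g (simple_root t) r)"] by blast
      then have "\<beta> j * (e * act g (simple_root j) r) = 0" using j unfolding supp_def by blast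
      then show False using j r by (simp add: supp_def)
    qed
  qed
  then have "(\<lambda>r. e * act g (simple_root j) r) = (\<lambda>r. e * act g \<beta> r)"
    using pos_root_simple J jJ i by (metis (no_types, lifting))
  then have "act g (simple_root j) = act g \<beta>" using e by (auto simp: fun_eq_iff)
  then have "\<beta> = simple_root j" using act_inj[OF g V, of "simple_root j"] jJ J simple_root_span
    by auto
  then show ?thesis using jJ by blast
qed

lemma simple_preimage:
  assumes "g \<in> carrier G" "\<beta> \<in> pos_roots" "supp \<beta> \<subseteq> J" "i \<in> S" "act g \<beta> = simple_root i"
    "J \<subseteq> S" "\<And>j. j \<in> J \<Longrightarrow> act g (simple_root j) \<in> pos_roots"
  shows "\<exists>j \<in> J. \<beta> = simple_root j"
  using simple_preimage_sign[of g \<beta> J i 1] assms by simp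

text \<open>Choose a so that w a is as short as possible: a simple root of J that became negative
  would be a descent, and appending it would shorten w a.\<close>

lemma coset_min:
  assumes J: "J \<subseteq> S" and w: "w \<in> carrier G"
  shows "\<exists>a \<in> generate G J. \<forall>j\<in>J. act (w \<otimes> a) (simple_root j) \<in> pos_roots"
proof -
  define P where "P = (\<lambda>a. a \<in> generate G J)"
  define a where "a = (ARG_MIN (\<lambda>a. len (w \<otimes> a)) a. P a)"
  have "P \<one>" by (simp add: P_def generate.one)
  then have a: "P a" "\<And>b. P b \<Longrightarrow> len (w \<otimes> a) \<le> len (w \<otimes> b)"
    using arg_min_natI[of P] arg_min_nat_le[of P _ "\<lambda>a. len (w \<otimes> a)"] by (auto simp: a_def)
  have ac: "a \<in> carrier G" using a J generate_subset_carrier by (auto simp: P_def)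
  have "act (w \<otimes> a) (simple_root j) \<in> pos_roots" if j: "j \<in> J" for j
  proof (rule ccontr)
    assume n: "act (w \<otimes> a) (simple_root j) \<notin> pos_roots"
    have js: "j \<in> S" "j \<in> carrier G" "simple_root j \<in> V" using j J S_carrier simple_root_span
      by auto
    have "(\<lambda>r. - act (w \<otimes> a) (simple_root j) r) \<in> pos_roots"
      using n not_pos_iff act_root simple_root_root js w ac by simp
    then have "act (w \<otimes> a \<otimes> j) (simple_root j) \<in> pos_roots"
      using js w ac by (simp add: act_mult[of "w \<otimes> a" j] act_S simple_refl_self act_uminus)
    then have "len (w \<otimes> a \<otimes> j) < len (w \<otimes> a)" using len_less[of "w \<otimes> a \<otimes> j" j] js w ac mult_S_S
      by simp
    moreover have "P (a \<otimes> j)" using a j by (auto simp: P_def intro: generate.intros)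
    ultimately show False using a(2)[of "a \<otimes> j"] w ac js by (simp add: m_assoc)
  qed
  then show ?thesis using a by (auto simp: P_def)
qed

text \<open>Identifies \<open>roots_on J\<close> with the root system of the parabolic subgroup. If
  \<gamma> = w \<alpha> with \<alpha> simple, \<open>coset_min\<close> gives u =
  \<open>inv w \<otimes> a\<close> that keeps the simple roots of J positive and sends the root
  \<beta> = \<open>act (inv a) \<gamma>\<close> on J to \<alpha>. As \<alpha> is indecomposable,
  \<beta> is simple.\<close>

lemma roots_on_orbit:
  assumes J: "J \<subseteq> S" and g: "\<gamma> \<in> roots_on J"
  shows "\<exists>a \<in> generate G J. \<exists>j \<in> J. \<gamma> = act a (simple_root j)"
proof -
  obtain w s where ws: "w \<in> carrier G" "s \<in> S" "\<gamma> = act w (simple_root s)" using g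
    by (auto simp: roots_on_def roots_def)
  have sV: "simple_root s \<in> V" using ws simple_root_span by blast
  obtain a where a: "a \<in> generate G J" "\<And>j. j \<in> J \<Longrightarrow> act (inv w \<otimes> a) (simple_root j) \<in> pos_roots"
    using coset_min[OF J, of "inv w"] ws by auto
  have ac: "a \<in> carrier G" using a J generate_subset_carrier by auto
  define u where "u = inv w \<otimes> a"
  have u: "u \<in> carrier G" using ws ac by (simp add: u_def)
  define \<beta> where "\<beta> = act (inv a) \<gamma>"
  have gV: "\<gamma> \<in> V" using g root_V by (auto simp: roots_on_def)
  have ia: "inv a \<in> generate G J" using a J
    by (meson gens_carrier generate_m_inv_closed subset_trans)
  have b: "\<beta> \<in> roots_on J" using roots_on_act[OF J ia g] by (simp add: \<beta>_def)
  then have bV: "\<beta> \<in> V" using root_V by (auto simp: roots_on_def)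
  have ub: "act u \<beta> = simple_root s" using ws sV ac by (simp add: u_def \<beta>_def act_mult act_V)
  have "\<beta> \<in> pos_roots"
  proof (rule ccontr)
    assume "\<beta> \<notin> pos_roots"
    then have p: "(\<lambda>r. - \<beta> r) \<in> pos_roots" using not_pos_iff b by (auto simp: roots_on_def)
    have "act u (\<lambda>r. - \<beta> r) \<in> pos_roots"
      using a b by (intro act_pos[OF u p]) (auto simp: u_def roots_on_def supp_def)
    then show False using ub act_uminus[OF u bV] pos_not_neg simple_root_pos ws by simp
  qed
  then obtain j where "j \<in> J" "\<beta> = simple_root j"
    using simple_preimage[OF u _ _ ws(2) ub J] a b by (auto simp: u_def roots_on_def)
  moreover have "\<gamma> = act a \<beta>" using ac gV by (simp add: \<beta>_def)
  ultimately show ?thesis using a by blast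
qed

lemma act_faithful:
  assumes "g \<in> carrier G" "h \<in> carrier G"
    "\<And>s. s \<in> S \<Longrightarrow> act g (simple_root s) = act h (simple_root s)"
  shows "g = h"
proof -
  have "act (inv h \<otimes> g) (simple_root s) \<in> pos_roots" if "s \<in> S" for s
    using assms that simple_root_pos simple_root_span by (simp add: act_mult)
  then have "inv h \<otimes> g = \<one>" using simple_pos_one assms by simp
  then show ?thesis using assms by (metis inv_closed inv_equality inv_inv inv_comm)
qed

definition is_refl :: "('a \<Rightarrow> real) \<Rightarrow> 'a \<Rightarrow> bool" where
  "is_refl \<gamma> g \<longleftrightarrow> g \<in> carrier G \<and> (\<forall>v \<in> V. act g v = (\<lambda>r. v r - 2 * bform \<gamma> v * \<gamma> r))"

text \<open>Characterised by its action, so that no expression of \<gamma> as the image of a simple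
  root has to be chosen. Uniqueness is faithfulness of the representation.\<close>

definition root_refl :: "('a \<Rightarrow> real) \<Rightarrow> 'a" where
  "root_refl \<gamma> = (THE g. is_refl \<gamma> g)"

lemma is_refl_unique: "is_refl \<gamma> g \<Longrightarrow> is_refl \<gamma> h \<Longrightarrow> g = h"
  unfolding is_refl_def using act_faithful[of g h] simple_root_span by auto

lemma root_refl_eq: "is_refl \<gamma> g \<Longrightarrow> root_refl \<gamma> = g"
  unfolding root_refl_def using is_refl_unique by blast

lemma is_refl_conj:
  assumes w: "w \<in> carrier G" and g: "is_refl \<gamma> g" and \<gamma>: "\<gamma> \<in> V"
  shows "is_refl (act w \<gamma>) (w \<otimes> g \<otimes> inv w)"
proof -
  have gc: "g \<in> carrier G" using g by (simp add: is_refl_def)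
  have "act (w \<otimes> g \<otimes> inv w) v = (\<lambda>r. v r - 2 * bform (act w \<gamma>) v * act w \<gamma> r)" if v: "v \<in> V" for v
  proof -
    have iv: "act (inv w) v \<in> V" using w v act_V by simp
    have "bform (act w \<gamma>) v = bform \<gamma> (act (inv w) v)" using act_bform[OF w \<gamma> iv] w v by simp
    moreover have "act (w \<otimes> g \<otimes> inv w) v = act w (act g (act (inv w) v))" using w gc v iv
      by (simp add: act_mult)
    moreover have "act g (act (inv w) v) = (\<lambda>r. 1 * act (inv w) v r + (- 2 * bform \<gamma> (act (inv w) v)) * \<gamma> r)"
      using g iv by (simp add: is_refl_def)
    ultimately show ?thesis using act_lin[OF w iv \<gamma>, of 1 "- 2 * bform \<gamma> (act (inv w) v)"] w v
      by simp
  qed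
  then show ?thesis using w gc by (simp add: is_refl_def)
qed

lemma is_refl_simple: "s \<in> S \<Longrightarrow> is_refl (simple_root s) s"
  using S_carrier by (simp add: is_refl_def act_S simple_refl_def)

lemma roots_on_S: "roots_on S = roots"
  using root_V by (auto simp: roots_on_def span_on_def)

text \<open>Conjugating a simple reflection along \<open>roots_on_orbit\<close> gives existence and
  membership in the parabolic subgroup at once.\<close>

lemma root_refl_generate:
  assumes J: "J \<subseteq> S" and g: "\<gamma> \<in> roots_on J"
  shows "is_refl \<gamma> (root_refl \<gamma>)" "root_refl \<gamma> \<in> generate G J"
proof -
  obtain a j where a: "a \<in> generate G J" "j \<in> J" "\<gamma> = act a (simple_root j)"
    using roots_on_orbit[OF assms] by blast
  have ac: "a \<in> carrier G" "j \<in> S" using a J generate_subset_carrier by auto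
  have *: "is_refl \<gamma> (a \<otimes> j \<otimes> inv a)"
    using is_refl_conj[OF ac(1) is_refl_simple[OF ac(2)]] a ac simple_root_span by simp
  have "a \<otimes> j \<otimes> inv a \<in> generate G J"
    using a generate_m_inv_closed[of J a] J gens_carrier
    by (auto intro!: generate.eng intro: generate.incl)
  then show "is_refl \<gamma> (root_refl \<gamma>)" "root_refl \<gamma> \<in> generate G J" using root_refl_eq[OF *] *
    by simp_all
qed

lemma root_refl: "\<gamma> \<in> roots \<Longrightarrow> is_refl \<gamma> (root_refl \<gamma>)"
  using root_refl_generate[of S \<gamma>] roots_on_S by simp

lemma root_refl_carrier [simp]: "\<gamma> \<in> roots \<Longrightarrow> root_refl \<gamma> \<in> carrier G"
  using root_refl by (simp add: is_refl_def)

lemma root_refl_act: "\<gamma> \<in> roots \<Longrightarrow> v \<in> V \<Longrightarrow> act (root_refl \<gamma>) v = (\<lambda>r. v r - 2 * bform \<gamma> v * \<gamma> r)"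
  using root_refl by (simp add: is_refl_def)

lemma root_refl_self: "\<gamma> \<in> roots \<Longrightarrow> act (root_refl \<gamma>) \<gamma> = (\<lambda>r. - \<gamma> r)"
  by (simp add: root_refl_act root_V root_norm)

lemma root_refl_conj:
  "w \<in> carrier G \<Longrightarrow> \<gamma> \<in> roots \<Longrightarrow> w \<otimes> root_refl \<gamma> \<otimes> inv w = root_refl (act w \<gamma>)"
  using root_refl_eq[OF is_refl_conj] root_refl root_V by metis

lemma root_refl_uminus: "\<gamma> \<in> roots \<Longrightarrow> root_refl (\<lambda>r. - \<gamma> r) = root_refl \<gamma>"
  using root_refl[of \<gamma>] bform_uminus_right bform_sym root_V root_uminus
  by (intro root_refl_eq) (auto simp: is_refl_def)

lemma root_refl_sq: "\<gamma> \<in> roots \<Longrightarrow> root_refl \<gamma> \<otimes> root_refl \<gamma> = \<one>"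
proof -
  assume g: "\<gamma> \<in> roots"
  have "root_refl \<gamma> \<otimes> root_refl \<gamma> \<otimes> inv (root_refl \<gamma>) = root_refl \<gamma>"
    using root_refl_conj[of "root_refl \<gamma>" \<gamma>] g root_refl_self root_refl_uminus by simp
  then have "act (root_refl \<gamma> \<otimes> root_refl \<gamma>) (simple_root s) = simple_root s" if "s \<in> S" for s
  proof -
    let ?v = "simple_root s"
    have v: "?v \<in> V" "\<gamma> \<in> V" using that simple_root_span g root_V by auto
    have "act (root_refl \<gamma> \<otimes> root_refl \<gamma>) ?v = act (root_refl \<gamma>) (\<lambda>r. 1 * ?v r + (- 2 * bform \<gamma> ?v) * \<gamma> r)"
      using g v by (simp add: act_mult root_refl_act)
    also have "\<dots> = (\<lambda>r. 1 * act (root_refl \<gamma>) ?v r + (- 2 * bform \<gamma> ?v) * act (root_refl \<gamma>) \<gamma> r)"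
      by (rule act_lin) (use g v in auto)
    also have "\<dots> = ?v" using g v by (simp add: root_refl_self root_refl_act)
    finally show ?thesis .
  qed
  then show ?thesis using act_faithful[of "root_refl \<gamma> \<otimes> root_refl \<gamma>" \<one>] g simple_root_span by simp
qed

lemma root_refl_inv: "\<gamma> \<in> roots \<Longrightarrow> inv (root_refl \<gamma>) = root_refl \<gamma>"
  using root_refl_sq by (simp add: inv_equality)

text \<open>Equal reflections have proportional roots; norm 1 leaves the factors 1 and -1, and
  positivity excludes -1.\<close>

lemma root_refl_inj:
  assumes "\<gamma> \<in> pos_roots" "\<delta> \<in> pos_roots" "root_refl \<gamma> = root_refl \<delta>"
  shows "\<gamma> = \<delta>"
proof -
  have r: "\<gamma> \<in> roots" "\<delta> \<in> roots" "\<gamma> \<in> V" "\<delta> \<in> V" using assms pos_root root_V by auto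
  define c where "c = bform \<delta> \<gamma>"
  have "(\<lambda>r. - \<gamma> r) = (\<lambda>r. \<gamma> r - 2 * c * \<delta> r)"
    using root_refl_self[OF r(1)] root_refl_act[OF r(2,3)] assms(3) by (simp add: c_def)
  then have e: "\<gamma> r = c * \<delta> r" for r by (drule_tac fun_cong[of _ _ r]) simp
  then have ee: "\<gamma> = (\<lambda>r. c * \<delta> r)" by (rule ext)
  have "bform \<gamma> \<gamma> = c * bform \<gamma> \<delta>"
    using arg_cong[OF ee, of "bform \<gamma>"] bform_scale_right[OF r(3,4), of c] by (rule HOL.trans)
  then have "c * c = 1" using root_norm[OF r(1)] bform_sym[OF r(3,4)] by (simp add: c_def)
  moreover have "c \<ge> 0"
  proof -
    obtain r where "\<gamma> r \<noteq> 0" using root_nonzero r by blast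
    then have "\<gamma> r > 0" "\<delta> r \<ge> 0" using assms by (auto simp: pos_roots_def order_less_le)
    then show ?thesis using e[of r] by (metis mult_nonpos_nonneg not_less linear)
  qed
  ultimately have "c = 1" by (simp add: square_eq_1_iff)
  then show ?thesis using e by auto
qed

lemma root_refl_ne_one: "\<gamma> \<in> roots \<Longrightarrow> root_refl \<gamma> \<noteq> \<one>"
proof
  assume g: "\<gamma> \<in> roots" "root_refl \<gamma> = \<one>"
  then have e: "\<gamma> = (\<lambda>r. - \<gamma> r)" using root_refl_self[OF g(1)] root_V[OF g(1)] by simp
  obtain r where "\<gamma> r \<noteq> 0" using root_nonzero g by blast
  then show False using fun_cong[OF e, of r] by simp
qed

section \<open>Rank one steps\<close>

lemma act_span_map:
  assumes u: "u \<in> carrier G" and A: "A \<subseteq> S" "\<And>a. a \<in> A \<Longrightarrow> act u (simple_root a) \<in> span_on B"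
    and v: "v \<in> span_on A"
  shows "act u v \<in> span_on B"
proof -
  have "act u v \<in> V" using act_V u span_on_mono[OF A(1) v] by blast
  moreover have "act u v r = 0" if "r \<notin> B" for r
  proof -
    have "act u v r = (\<Sum>t\<in>supp v. v t * act u (simple_root t) r)"
      using v A by (intro act_expand[OF u]) (auto simp: span_on_def)
    also have "\<dots> = 0" using A(2) span_on_zero[OF _ that] v
      by (intro sum.neutral) (auto simp: span_on_def)
    finally show ?thesis .
  qed
  ultimately show ?thesis by (auto simp: span_on_def supp_def)
qed

text \<open>What remains of an arrow of C when the labelling by \<open>\<Lambda>\<close> is
  forgotten. It is also applied to index sets enlarged by one generator, which need not be the range
  of a vertex.\<close>

definition simple_map :: "'a \<Rightarrow> 'a set \<Rightarrow> bool" where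
  "simple_map u A \<longleftrightarrow> (\<forall>a \<in> A. act u (simple_root a) \<in> simple_root ` S)"

definition simple_img :: "'a \<Rightarrow> 'a set \<Rightarrow> 'a set" where
  "simple_img u A = {b \<in> S. \<exists>a \<in> A. act u (simple_root a) = simple_root b}"

lemma simple_img_S: "simple_img u A \<subseteq> S"
  by (auto simp: simple_img_def)

lemma simple_map_pos: "simple_map u A \<Longrightarrow> a \<in> A \<Longrightarrow> act u (simple_root a) \<in> pos_roots"
  using simple_root_pos by (auto simp: simple_map_def)

lemma simple_map_img: "simple_map u A \<Longrightarrow> a \<in> A \<Longrightarrow> \<exists>b \<in> simple_img u A. act u (simple_root a) = simple_root b"
  by (force simp: simple_map_def simple_img_def)

lemma simple_img_span:
  assumes "u \<in> carrier G" "A \<subseteq> S" "simple_map u A" "v \<in> span_on A"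
  shows "act u v \<in> span_on (simple_img u A)"
proof (rule act_span_map[OF assms(1,2) _ assms(4)])
  fix a assume "a \<in> A"
  then obtain b where "b \<in> simple_img u A" "act u (simple_root a) = simple_root b"
    using simple_map_img assms by blast
  then show "act u (simple_root a) \<in> span_on (simple_img u A)" using simple_root_span by simp
qed

lemma simple_img_span_inv:
  assumes u: "u \<in> carrier G" and A: "A \<subseteq> S" and v: "v \<in> span_on (simple_img u A)"
  shows "act (inv u) v \<in> span_on A"
proof (rule act_span_map[OF _ simple_img_S _ v])
  fix b assume "b \<in> simple_img u A"
  then obtain a where "a \<in> A" "simple_root b = act u (simple_root a)" by (auto simp: simple_img_def)
  then show "act (inv u) (simple_root b) \<in> span_on A" using u A simple_root_span by auto
qed (use u in simp)

definition rel_roots :: "'a set \<Rightarrow> 'a set \<Rightarrow> ('a \<Rightarrow> real) set" where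
  "rel_roots J A = {\<beta> \<in> roots_on J. \<not> supp \<beta> \<subseteq> A}"

lemma finite_rel_roots:
  assumes "finite (rel_roots J A \<inter> pos_roots)"
  shows "finite (rel_roots J A)"
proof (rule finite_subset)
  show "rel_roots J A \<subseteq> (rel_roots J A \<inter> pos_roots) \<union> (\<lambda>\<beta> r. - \<beta> r) ` (rel_roots J A \<inter> pos_roots)"
  proof
    fix \<beta> assume b: "\<beta> \<in> rel_roots J A"
    then have "\<beta> \<in> pos_roots \<or> (\<lambda>r. - \<beta> r) \<in> rel_roots J A \<inter> pos_roots"
      using root_pos_or_neg[of \<beta>] roots_on_uminus[of \<beta> J]
      by (auto simp: rel_roots_def roots_on_def supp_def)
    then show "\<beta> \<in> (rel_roots J A \<inter> pos_roots) \<union> (\<lambda>\<beta> r. - \<beta> r) ` (rel_roots J A \<inter> pos_roots)"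
      using b by (force intro: image_eqI[of _ _ "\<lambda>r. - \<beta> r"])
  qed
qed (use assms in auto)

lemma act_sum_neg:
  assumes "w \<in> carrier G" "\<beta> \<in> pos_roots" "\<And>s. \<beta> s \<noteq> 0 \<Longrightarrow> act w (simple_root s) \<notin> pos_roots"
  shows "act w \<beta> \<notin> pos_roots"
proof -
  have bV: "\<beta> \<in> V" using assms pos_root_V by blast
  have "act w \<beta> r \<le> 0" for r
  proof -
    have "act w \<beta> r = (\<Sum>t\<in>supp \<beta>. \<beta> t * act w (simple_root t) r)"
      using bV by (intro act_expand[OF assms(1)]) (auto simp: span_on_def)
    also have "\<dots> \<le> 0"
    proof (intro sum_nonpos mult_nonneg_nonpos)
      fix t assume t: "t \<in> supp \<beta>"
      then have "t \<in> S" using bV by (auto simp: span_on_def)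
      then have "(\<lambda>r. - act w (simple_root t) r) \<in> pos_roots"
        using assms(3)[of t] t not_pos_iff act_root[OF assms(1) simple_root_root]
        by (auto simp: supp_def)
      then show "act w (simple_root t) r \<le> 0" by (auto simp: pos_roots_def)
      show "0 \<le> \<beta> t" using assms by (simp add: pos_roots_def)
    qed
    finally show ?thesis .
  qed
  moreover obtain r where "act w \<beta> r \<noteq> 0" using root_nonzero act_root assms pos_root by blast
  ultimately show ?thesis using neg_rootI[of "act w \<beta>" r] by (metis order_less_le)
qed

text \<open>The image of the root of t is not in the span of the image of A, so it has a negative
  coordinate r outside that image. The simple roots of A contribute nothing at r, hence every
  positive root on A and t that involves t becomes negative at r.\<close>

lemma rel_roots_inversions:
  assumes u: "u \<in> carrier G" and A: "A \<subseteq> S" "simple_map u A" and t: "t \<in> S"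
    "act u (simple_root t) \<notin> pos_roots"
  shows "rel_roots (insert t A) A \<inter> pos_roots \<subseteq> inversions u"
proof
  fix \<beta> assume b: "\<beta> \<in> rel_roots (insert t A) A \<inter> pos_roots"
  let ?B = "simple_img u A"
  have tV: "simple_root t \<in> V" using t simple_root_span by blast
  have tA: "t \<notin> A" using t simple_map_pos A by blast
  have bV: "\<beta> \<in> V" using b pos_root_V by blast
  have neg: "(\<lambda>r. - act u (simple_root t) r) \<in> pos_roots"
    using t not_pos_iff act_root[OF u simple_root_root] by blast
  have "act u (simple_root t) \<notin> span_on ?B"
  proof
    assume "act u (simple_root t) \<in> span_on ?B"
    then have "simple_root t \<in> span_on A" using simple_img_span_inv[OF u A(1)] u tV by force
    then show False using tA by (simp add: span_on_def)
  qed
  then obtain r where r: "r \<notin> ?B" "act u (simple_root t) r \<noteq> 0"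
    using act_V[OF u tV] by (auto simp: span_on_def supp_def)
  then have r': "act u (simple_root t) r < 0" using neg
    by (auto simp: pos_roots_def order_less_le dest: spec[of _ r])
  have bt: "\<beta> t > 0" using b
    by (auto simp: rel_roots_def roots_on_def supp_def pos_roots_def order_less_le)
  have "act u \<beta> r = (\<Sum>s\<in>supp \<beta>. \<beta> s * act u (simple_root s) r)"
    using bV by (intro act_expand[OF u]) (auto simp: span_on_def)
  also have "\<dots> = (\<Sum>s\<in>{t}. \<beta> s * act u (simple_root s) r)"
  proof (rule sum.mono_neutral_right)
    show "\<forall>s\<in>supp \<beta> - {t}. \<beta> s * act u (simple_root s) r = 0"
    proof
      fix s assume "s \<in> supp \<beta> - {t}"
      then have "s \<in> A" using b by (auto simp: rel_roots_def roots_on_def)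
      then obtain b where "b \<in> ?B" "act u (simple_root s) = simple_root b" using simple_map_img A
        by blast
      then show "\<beta> s * act u (simple_root s) r = 0" using r by (auto simp: simple_root_def)
    qed
  qed (use bV bt in \<open>auto simp: span_on_def supp_def\<close>)
  also have "\<dots> < 0" using bt r' by (simp add: mult_pos_neg)
  finally show "\<beta> \<in> inversions u" using b neg_rootI by (auto simp: inversions_def)
qed

text \<open>The right hand side depends on A and t only; with \<open>inversions_inj\<close> this
  pins down u.\<close>

lemma inversions_rank_one:
  assumes A: "A \<subseteq> S" "t \<in> S" and u: "u \<in> generate G (insert t A)" "simple_map u A" "u \<noteq> \<one>"
  shows "inversions u = rel_roots (insert t A) A \<inter> pos_roots"
proof
  have J: "insert t A \<subseteq> S" using A by auto
  have uc: "u \<in> carrier G" using generate_subset_carrier[OF J u(1)] .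
  have "act u (simple_root t) \<notin> pos_roots"
    using generate_pos_one[OF J u(1)] u(3) simple_map_pos[OF u(2)] by blast
  then show "rel_roots (insert t A) A \<inter> pos_roots \<subseteq> inversions u"
    by (rule rel_roots_inversions[OF uc A(1) u(2) A(2)])
  show "inversions u \<subseteq> rel_roots (insert t A) A \<inter> pos_roots"
  proof
    fix \<beta> assume b: "\<beta> \<in> inversions u"
    then have "\<not> supp \<beta> \<subseteq> A" using act_pos[OF uc, of \<beta>] simple_map_pos[OF u(2)]
      by (auto simp: inversions_def supp_def)
    then show "\<beta> \<in> rel_roots (insert t A) A \<inter> pos_roots"
      using inversions_generate[OF J u(1)] b by (auto simp: rel_roots_def inversions_def)
  qed
qed

text \<open>An element of maximal length turns all simple roots of K, hence all positive roots on K,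
  negative. This determines it, which makes the definite description in \<open>longest\<close>
  meaningful.\<close>

lemma longest_props:
  assumes K: "K \<subseteq> S" "finite_type K"
  shows longest_generate: "longest K \<in> generate G K"
    and inversions_longest: "inversions (longest K) = roots_on K \<inter> pos_roots"
proof -
  have fin: "finite (generate G K)" using K by (simp add: finite_type_def)
  have ne: "generate G K \<noteq> {}" using generate.one by blast
  let ?P = "\<lambda>w. w \<in> generate G K \<and> (\<forall>v \<in> generate G K. len v \<le> len w)"
  have inv: "inversions w = roots_on K \<inter> pos_roots" if w: "?P w" for w
  proof
    have wc: "w \<in> carrier G" using w generate_subset_carrier K by blast
    have "act w (simple_root j) \<notin> pos_roots" if "j \<in> K" for j
    proof
      assume "act w (simple_root j) \<in> pos_roots"
      then have "len w < len (w \<otimes> j)" using len_less wc that K by blast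
      moreover have "w \<otimes> j \<in> generate G K" using w that by (auto intro: generate.intros)
      ultimately show False using w by (meson not_less)
    qed
    then show "roots_on K \<inter> pos_roots \<subseteq> inversions w"
      using act_sum_neg[OF wc] by (auto simp: inversions_def roots_on_def supp_def)
    show "inversions w \<subseteq> roots_on K \<inter> pos_roots"
      using inversions_generate[OF K(1)] w by (auto simp: inversions_def)
  qed
  have "Max (len ` generate G K) \<in> len ` generate G K" using fin ne by simp
  then obtain w where w: "w \<in> generate G K" "len w = Max (len ` generate G K)" by force
  then have Pw: "?P w" using fin by simp
  have "v = w" if "?P v" for v
    using inversions_inj[of v w] inv[OF that] inv[OF Pw] that Pw generate_subset_carrier[OF K(1)]
    by blast
  then have "longest K = w" unfolding longest_def using Pw by (intro the_equality) blast+
  then show "longest K \<in> generate G K" "inversions (longest K) = roots_on K \<inter> pos_roots"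
    using Pw inv by auto
qed

text \<open>The inverse of the longest element also makes the simple roots of K negative, so
  \<open>simple_preimage_sign\<close> with e = -1 applies to it.\<close>

lemma longest_simple:
  assumes K: "K \<subseteq> S" "finite_type K" and i: "i \<in> K"
  shows "\<exists>j \<in> K. act (longest K) (simple_root i) = (\<lambda>r. - simple_root j r)"
proof -
  let ?w = "longest K"
  have w: "?w \<in> generate G K" "?w \<in> carrier G" using longest_generate generate_subset_carrier K
    by blast+
  have iw: "inv ?w \<in> generate G K" "inv ?w \<in> carrier G" using w K(1)
    by (auto intro: generate_m_inv_closed dest: subset_trans[OF _ gens_carrier])
  define \<beta> where "\<beta> = (\<lambda>r. - act ?w (simple_root i) r)"
  have iK: "i \<in> S" "simple_root i \<in> V" "simple_root i \<in> roots_on K"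
    "simple_root i \<in> roots_on K \<inter> pos_roots"
    using i K simple_root_span simple_root_root simple_root_pos by (auto simp: roots_on_def)
  have b: "\<beta> \<in> pos_roots" "\<beta> \<in> roots_on K"
    using iK inversions_longest[OF K] inversions_neg[OF w(2)] roots_on_uminus[OF roots_on_act[OF K(1) w(1)]]
    by (auto simp: \<beta>_def)
  have neg: "(\<lambda>r. - act (inv ?w) (simple_root j) r) \<in> pos_roots" if j: "j \<in> K" for j
  proof -
    have jK: "j \<in> S" "simple_root j \<in> V" "simple_root j \<in> roots_on K" "simple_root j \<in> pos_roots"
      "simple_root j \<in> roots"
      using j K simple_root_span simple_root_root simple_root_pos by (auto simp: roots_on_def)
    have "act (inv ?w) (simple_root j) \<notin> pos_roots"
    proof
      assume "act (inv ?w) (simple_root j) \<in> pos_roots"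
      then have "act (inv ?w) (simple_root j) \<in> inversions ?w"
        using inversions_longest[OF K] roots_on_act[OF K(1) iw(1) jK(3)] by blast
      then show False using jK w by (simp add: inversions_def)
    qed
    then show ?thesis using not_pos_iff act_root iw jK by blast
  qed
  have "act (inv ?w) \<beta> = (\<lambda>r. - simple_root i r)"
    using act_uminus[OF iw(2) act_V[OF w(2) iK(2)]] w iK by (simp add: \<beta>_def)
  then obtain j where "j \<in> K" "\<beta> = simple_root j"
    using simple_preimage_sign[OF iw(2) b(1) _ iK(1), of K "-1"] b neg K
    by (auto simp: roots_on_def)
  then have "act (longest K) (simple_root i) r = - simple_root j r" for r
    using fun_cong[of \<beta> "simple_root j" r] unfolding \<beta>_def by linarith
  then show ?thesis using \<open>j \<in> K\<close> by blast
qed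

section \<open>Components of the Coxeter graph and the steps\<close>

lemma gram_nonadjacent:
  assumes "s \<in> S" "t \<in> S" "s \<noteq> t" "\<not> adjacent s t"
  shows "gram s t = 0"
proof -
  have "ord (s \<otimes> t) \<noteq> 0" "ord (s \<otimes> t) < 3" using assms by (auto simp: adjacent_def)
  then have "ord (s \<otimes> t) = 2" using ord_ge_2[of s t] assms by simp
  then show ?thesis by (simp add: gram_def)
qed

lemma gram_adjacent: "adjacent s t \<Longrightarrow> gram s t \<noteq> 0"
proof (cases "ord (s \<otimes> t) = 0")
  case False
  assume "adjacent s t"
  then have m: "ord (s \<otimes> t) \<ge> 3" using False by (simp add: adjacent_def)
  then have "pi / real (ord (s \<otimes> t)) < pi / 2" "pi / real (ord (s \<otimes> t)) > 0"
    by (simp_all add: field_simps)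
  then have "cos (pi / real (ord (s \<otimes> t))) > 0" by (intro cos_gt_zero)
  then show ?thesis using False by (simp add: gram_def)
qed (simp add: gram_def)

lemma adjacent_sym: "adjacent s t \<Longrightarrow> adjacent t s"
  using ord_inv_eq[of s t] by (auto simp: adjacent_def)

lemma comps_meeting_subset: "comps_meeting A T \<subseteq> A \<union> T"
proof
  fix a assume "a \<in> comps_meeting A T"
  then obtain k where k: "k \<in> T" "(\<lambda>b c. b \<in> A \<union> T \<and> c \<in> A \<union> T \<and> adjacent b c)\<^sup>*\<^sup>* k a"
    by (auto simp: comps_meeting_def)
  from k(2) show "a \<in> A \<union> T" by (cases rule: rtranclp.cases) (use k in auto)
qed

lemma comps_meeting_self: "T \<subseteq> comps_meeting A T"
  by (auto simp: comps_meeting_def)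

lemma comps_meeting_step:
  "b \<in> comps_meeting A T \<Longrightarrow> c \<in> A \<union> T \<Longrightarrow> adjacent b c \<Longrightarrow> c \<in> comps_meeting A T"
  using comps_meeting_subset[of A T] unfolding comps_meeting_def
  by (auto intro: rtranclp.rtrancl_into_rtrancl)

text \<open>An index of A outside the components is adjacent to no index in them, so its simple root
  is orthogonal to theirs.\<close>

lemma comps_meeting_fix:
  assumes A: "A \<subseteq> S" "T \<subseteq> S" and w: "w \<in> generate G (comps_meeting A T)" and a: "a \<in> A"
    "a \<notin> comps_meeting A T"
  shows "act w (simple_root a) = simple_root a"
proof -
  have K: "comps_meeting A T \<subseteq> S" using comps_meeting_subset[of A T] A by blast
  have aV: "simple_root a \<in> V" "a \<in> S" using A a simple_root_span by auto
  from w K show ?thesis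
  proof (induction rule: generate_induct)
    case (mult s w)
    have s: "s \<in> S" "s \<in> carrier G" "w \<in> carrier G" using mult K S_carrier generate_subset_carrier
      by auto
    have "\<not> adjacent s a" using comps_meeting_step[OF mult(1), of a] a by auto
    then have "gram s a = 0" using gram_nonadjacent[of s a] s aV mult a by auto
    then show ?case using mult s aV by (simp add: act_mult act_S simple_refl_def bform_simple)
  qed (use aV in simp)
qed

text \<open>\<open>step\<close> depends on the range of the vertex only; as a function of a set it
  is available for enlarged index sets too.\<close>

definition rstep :: "'a set \<Rightarrow> 'a \<Rightarrow> 'a" where
  "rstep A r = longest (comps_meeting A {r}) \<otimes> longest (comps_meeting A {r} - {r})"

lemma generate_mono: "H \<subseteq> K \<Longrightarrow> w \<in> generate G H \<Longrightarrow> w \<in> generate G K"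
  using mono_generate by blast

text \<open>On indices of A in the component both longest elements change the sign, and the signs
  cancel; the other indices of A are fixed. The factor applied first keeps the root of r positive
  because it does not involve r, and the other one inverts the result, so the product is not
  trivial.\<close>

lemma rstep_props:
  assumes A: "A \<subseteq> S" and r: "r \<in> S" "r \<notin> A" and fin: "finite_type (comps_meeting A {r})"
  shows rstep_generate: "rstep A r \<in> generate G (insert r A)"
    and rstep_simple_map: "simple_map (rstep A r) A"
    and rstep_ne_one: "rstep A r \<noteq> \<one>"
proof -
  let ?K = "comps_meeting A {r}" and ?L = "comps_meeting A {r} - {r}"
  have K: "?K \<subseteq> S" "?L \<subseteq> S" "?K \<subseteq> insert r A" "r \<in> ?K"
    using comps_meeting_subset[of A "{r}"] comps_meeting_self[of "{r}" A] A r by auto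
  have finL: "finite_type ?L" using fin mono_generate[of ?L ?K] finite_subset
    by (auto simp: finite_type_def)
  have k: "longest ?K \<in> generate G ?K" "longest ?L \<in> generate G ?L" "longest ?L \<in> generate G ?K"
    using longest_generate fin finL K generate_mono[of ?L ?K] by auto
  then have c: "longest ?K \<in> carrier G" "longest ?L \<in> carrier G" using generate_subset_carrier K
    by blast+
  show "rstep A r \<in> generate G (insert r A)" unfolding rstep_def
    using k generate_mono[OF K(3)] by (auto intro: generate.eng)
  have "act (rstep A r) (simple_root a) \<in> simple_root ` S" if a: "a \<in> A" for a
  proof (cases "a \<in> ?K")
    case True
    then have "a \<in> ?L" using a r by auto
    then obtain b where b: "b \<in> ?L" "act (longest ?L) (simple_root a) = (\<lambda>r. - simple_root b r)"
      using longest_simple[OF K(2) finL] by blast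
    then obtain d where d: "d \<in> ?K" "act (longest ?K) (simple_root b) = (\<lambda>r. - simple_root d r)"
      using longest_simple[OF K(1) fin] by blast
    have "simple_root a \<in> V" "simple_root b \<in> V" using a A b K simple_root_span by auto
    then have "act (rstep A r) (simple_root a) = simple_root d"
      using b d c by (simp add: rstep_def act_mult act_uminus)
    then show ?thesis using d K by auto
  next
    case False
    have "simple_root a \<in> V" using a A simple_root_span by auto
    then show ?thesis using comps_meeting_fix[of A "{r}" _ a] A r k a False c
      by (auto simp: rstep_def act_mult)
  qed
  then show "simple_map (rstep A r) A" by (simp add: simple_map_def)
  have rV: "simple_root r \<in> V" "simple_root r \<in> pos_roots" "simple_root r \<in> roots_on ?K"
    using r simple_root_span simple_root_pos simple_root_root K by (auto simp: roots_on_def)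
  have "act (longest ?L) (simple_root r) \<in> pos_roots" using generate_pos_outside[OF K(2) k(2) rV(2)]
    by simp
  moreover have "act (longest ?L) (simple_root r) \<in> roots_on ?K"
    using roots_on_act[OF K(1) k(3) rV(3)] .
  ultimately have "act (longest ?L) (simple_root r) \<in> inversions (longest ?K)"
    using inversions_longest[OF K(1) fin] by blast
  then have "act (rstep A r) (simple_root r) \<notin> pos_roots" using c rV
    by (simp add: rstep_def act_mult inversions_def)
  then show "rstep A r \<noteq> \<one>" using rV by auto
qed

text \<open>The parabolic subgroup of \<open>K - T\<close> permutes the finitely many roots supported on \<open>K\<close> that involve
  \<open>T\<close>.  It acts faithfully on them, because their span contains the simple roots of \<open>T\<close> and, moving
  along the edges of the Coxeter graph, those of all of \<open>K\<close>.\<close>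

lemma finite_type_comps:
  assumes A: "A \<subseteq> S" "T \<subseteq> S" "A \<inter> T = {}" and fin: "finite (rel_roots (A \<union> T) A)"
  shows "finite_type (comps_meeting A T)"
proof -
  define K where "K = comps_meeting A T"
  define B where "B = K - T"
  define M where "M = rel_roots K B"
  have K: "K \<subseteq> S" "B \<subseteq> S" "B \<subseteq> K" "B \<subseteq> A" "T \<subseteq> K" "K \<subseteq> A \<union> T"
    using comps_meeting_subset[of A T] comps_meeting_self[of T A] A by (auto simp: K_def B_def)
  have MT: "\<beta> \<in> M \<longleftrightarrow> \<beta> \<in> roots_on K \<and> (\<exists>t \<in> T. \<beta> t \<noteq> 0)" for \<beta>
    using K by (auto simp: M_def rel_roots_def roots_on_def B_def supp_def)
  have "\<not> supp \<beta> \<subseteq> A" if "t \<in> T" "\<beta> t \<noteq> 0" for \<beta> t using that A(3) by (auto simp: supp_def)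
  then have "M \<subseteq> rel_roots (A \<union> T) A" using K(6) by (fastforce simp: MT rel_roots_def roots_on_def)
  then have finM: "finite M" using fin finite_subset by blast
  have stab: "act w \<beta> \<in> M" if w: "w \<in> generate G B" and b: "\<beta> \<in> M" for w \<beta>
  proof -
    have "act w \<beta> \<in> roots_on K" using roots_on_act[OF K(1) generate_mono[OF K(3) w]] b
      by (simp add: MT)
    moreover obtain t where "t \<in> T" "\<beta> t \<noteq> 0" using b MT by blast
    moreover have "act w \<beta> t = \<beta> t" if "t \<in> T"
      using act_generate_outside[OF K(2) w, of \<beta> t] b root_V that
      by (auto simp: MT roots_on_def B_def)
    ultimately show ?thesis unfolding MT by metis
  qed
  have fixes_all: "\<forall>w \<in> generate G B. (\<forall>\<beta> \<in> M. act w \<beta> = \<beta>) \<longrightarrow> act w (simple_root k) = simple_root k"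
    if kK: "k \<in> K" for k
  proof -
    obtain k0 where k0: "k0 \<in> T" "(\<lambda>b c. b \<in> A \<union> T \<and> c \<in> A \<union> T \<and> adjacent b c)\<^sup>*\<^sup>* k0 k"
      using kK unfolding K_def comps_meeting_def by blast
    from k0(2) show ?thesis
    proof (induction rule: rtranclp_induct)
      case base
      have "k0 \<in> K" "k0 \<in> S" using k0 K by auto
      then have "simple_root k0 \<in> M" using k0 simple_root_root unfolding MT
        by (auto simp: roots_on_def intro!: bexI[of _ k0]) (simp add: simple_root_def)
      then show ?case by blast
    next
      case (step b c)
      have bc: "b \<in> S" "c \<in> S" "adjacent b c" "c \<in> carrier G" using step A S_carrier by auto
      have V: "simple_root b \<in> V" "simple_root c \<in> V" using bc simple_root_span by auto
      have cK: "c \<in> K"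
        using k0 step unfolding K_def comps_meeting_def
        by (blast intro: rtranclp.rtrancl_into_rtrancl)
      show ?case
      proof (cases "c \<in> T")
        case True
        then have "simple_root c \<in> M" using cK bc simple_root_root unfolding MT
          by (auto simp: roots_on_def intro!: bexI[of _ c]) (simp add: simple_root_def)
        then show ?thesis by blast
      next
        case False
        then have cB: "c \<in> generate G B" using cK by (auto simp: B_def intro: generate.incl)
        show ?thesis
        proof (intro ballI impI)
          fix w assume w: "w \<in> generate G B" "\<forall>\<beta>\<in>M. act w \<beta> = \<beta>"
          have wc: "w \<in> carrier G" using w generate_subset_carrier K by blast
          \<comment> \<open>The induction hypothesis for b is used for the conjugate c w c, which
            fixes M pointwise because c permutes M. So w fixes the image of the root of b under c,
            in which the root of c has a nonzero coefficient.\<close>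
          have "act (c \<otimes> w \<otimes> c) \<beta> = \<beta>" if "\<beta> \<in> M" for \<beta>
          proof -
            have "act w (act c \<beta>) = act c \<beta>" "\<beta> \<in> V" using w stab[OF cB that] that root_V
              by (auto simp: MT roots_on_def)
            moreover from this have "act (c \<otimes> w \<otimes> c) \<beta> = act c (act c \<beta>)" using bc wc
              by (simp add: act_mult act_V)
            ultimately show ?thesis using act_inv_act[OF bc(4), of \<beta>] S_inv[OF bc(2)] by simp
          qed
          moreover have "c \<otimes> w \<otimes> c \<in> generate G B" using cB w by (auto intro: generate.eng)
          ultimately have "act (c \<otimes> w \<otimes> c) (simple_root b) = simple_root b" using step.IH by blast
          then have "act c (act w (act c (simple_root b))) = act c (act c (simple_root b))"
            using bc wc V act_inv_act[OF bc(4), of "simple_root b"] S_inv[OF bc(2)]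
            by (simp add: act_mult act_V)
          then have "act w (act c (simple_root b)) = act c (simple_root b)"
            using act_inj[OF bc(4), of "act w (act c (simple_root b))"
            "act c (simple_root b)"] act_V wc bc V by simp
          moreover have cb: "act c (simple_root b) = (\<lambda>r. 1 * simple_root b r + (- 2 * gram c b) * simple_root c r)"
            using bc V by (simp add: act_S simple_refl_def bform_simple)
          ultimately have e: "(\<lambda>r. 1 * act w (simple_root b) r + (- 2 * gram c b) * act w (simple_root c) r)
              = (\<lambda>r. 1 * simple_root b r + (- 2 * gram c b) * simple_root c r)"
            using act_lin[OF wc V, of 1 "- 2 * gram c b"] by simp
          have "act w (simple_root b) = simple_root b" using step.IH w by blast
          moreover have "gram c b \<noteq> 0" using gram_adjacent adjacent_sym bc by blast
          ultimately show "act w (simple_root c) = simple_root c" using e by (auto simp: fun_eq_iff)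
        qed
      qed
    qed
  qed
  have kernel: "w = \<one>" if w: "w \<in> generate G B" "\<forall>\<beta> \<in> M. act w \<beta> = \<beta>" for w
    by (rule generate_pos_one[OF K(1) generate_mono[OF K(3) w(1)]]) (use fixes_all w K(1) simple_root_pos in \<open>metis subsetD\<close>)
  have "inj_on (\<lambda>w. restrict (act w) M) (generate G B)"
  proof (rule inj_onI)
    fix u w assume uw: "u \<in> generate G B" "w \<in> generate G B"
      "restrict (act u) M = restrict (act w) M"
    have c: "u \<in> carrier G" "w \<in> carrier G" using uw generate_subset_carrier K by blast+
    have "act (inv w \<otimes> u) \<beta> = \<beta>" if "\<beta> \<in> M" for \<beta>
    proof -
      have "act u \<beta> = act w \<beta>" using fun_cong[OF uw(3), of \<beta>] that by simp
      then show ?thesis using c that root_V by (simp add: act_mult MT roots_on_def)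
    qed
    moreover have "inv w \<otimes> u \<in> generate G B"
      using uw K(2) generate_m_inv_closed[of B w] gens_carrier by (auto intro: generate.eng)
    ultimately have "inv w \<otimes> u = \<one>" using kernel by blast
    then show "u = w" using c by (metis inv_closed inv_equality inv_inv inv_comm)
  qed
  moreover have "(\<lambda>w. restrict (act w) M) ` generate G B \<subseteq> M \<rightarrow>\<^sub>E M" using stab by auto
  moreover have "finite (M \<rightarrow>\<^sub>E M)" using finM by (intro finite_PiE) auto
  ultimately have finB: "finite (generate G B)" by (meson finite_imageD finite_subset)
  \<comment> \<open>The indices in B are themselves elements of the finite group, so
    \<open>roots_on_orbit\<close> leaves finitely many roots.\<close>
  have "roots_on B \<subseteq> (\<lambda>(a, j). act a (simple_root j)) ` (generate G B \<times> generate G B)"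
    using roots_on_orbit[OF K(2)] by (force intro: generate.incl)
  then have "finite (roots_on B)" using finB finite_subset by fast
  moreover have "roots_on K \<subseteq> roots_on B \<union> M" by (auto simp: M_def rel_roots_def roots_on_def)
  ultimately have finK: "finite (roots_on K)" using finM finite_subset by blast
  have "inj_on inversions (generate G K)" using inversions_inj generate_subset_carrier[OF K(1)]
    by (meson inj_onI)
  moreover have "inversions ` generate G K \<subseteq> Pow (roots_on K)" using inversions_generate[OF K(1)]
    by auto
  ultimately have "finite (generate G K)" using finK
    by (meson finite_Pow_iff finite_imageD finite_subset)
  then show ?thesis by (simp add: finite_type_def K_def)
qed

text \<open>The inversion set of u is finite, so the existence of u alone forces finite type. Then
  the step exists as well and has the same inversions as u.\<close>

lemma rank_one_unique:
  assumes A: "A \<subseteq> S" and r: "r \<in> S" "r \<notin> A" and u: "u \<in> generate G (insert r A)" "simple_map u A"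
    "u \<noteq> \<one>"
  shows "finite_type (comps_meeting A {r})" "u = rstep A r"
proof -
  have J: "insert r A \<subseteq> S" using A r by auto
  have uc: "u \<in> carrier G" using generate_subset_carrier[OF J u(1)] .
  have i: "inversions u = rel_roots (insert r A) A \<inter> pos_roots"
    using inversions_rank_one[OF A r(1) u] .
  then have "finite (rel_roots (A \<union> {r}) A)" using finite_inversions[OF uc] finite_rel_roots by simp
  then show f: "finite_type (comps_meeting A {r})" using finite_type_comps[of A "{r}"] A r by auto
  have v: "rstep A r \<in> generate G (insert r A)" "simple_map (rstep A r) A" "rstep A r \<noteq> \<one>"
    using rstep_props[OF A r f] by auto
  show "u = rstep A r"
    using inversions_inj[OF uc generate_subset_carrier[OF J v(1)]] i inversions_rank_one[OF A r(1) v] by simp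
qed

section \<open>Reflections among the rank one elements\<close>

lemma len_inv:
  assumes "w \<in> carrier G"
  shows "len (inv w) \<le> len w"
proof -
  obtain ws where ws: "ws \<in> lists S" "length ws = len w" "word_prod G ws = w"
    using len_witness assms by blast
  have "inv (word_prod G ws) = word_prod G (rev ws)" using ws(1)
  proof (induction ws)
    case (Cons a ws)
    then have "a \<in> S" "a \<in> carrier G" "set ws \<subseteq> carrier G" "set (rev ws) \<subseteq> carrier G"
      using S_carrier lists_S_carrier by auto
    then show ?case using Cons word_prod_append[of "rev ws" "[a]"]
      by (simp add: inv_mult_group S_inv)
  qed simp
  moreover have "rev ws \<in> lists S" using ws(1) by auto
  ultimately show ?thesis using len_le[of "rev ws"] ws by simp
qed

text \<open>Conjugation by a right descent shortens an involution, unless the descent is the desired root.\<close>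

lemma involution_root:
  assumes "L \<in> carrier G" "L \<otimes> L = \<one>" "L \<noteq> \<one>"
  shows "\<exists>\<rho> \<in> pos_roots. act L \<rho> = (\<lambda>r. - \<rho> r)"
proof -
  have "\<exists>\<rho> \<in> roots. act L \<rho> = (\<lambda>r. - \<rho> r)" using assms
  proof (induction "len L" arbitrary: L rule: less_induct)
    case less
    note L = less.prems
    have iL: "inv L = L" using L by (simp add: inv_equality)
    obtain t where t: "t \<in> S" "len L = Suc (len (L \<otimes> t))" using len_descent L by blast
    have tc: "t \<in> carrier G" "simple_root t \<in> V" "simple_root t \<in> roots"
      using t S_carrier simple_root_span simple_root_root by auto
    have "act L (simple_root t) \<notin> pos_roots" using len_less[OF L(1) t(1)] t by auto
    then have neg: "(\<lambda>r. - act L (simple_root t) r) \<in> pos_roots" using not_pos_iff act_root L tc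
      by blast
    show ?case
    proof (cases "(\<lambda>r. - act L (simple_root t) r) = simple_root t")
      case True
        have "act L (simple_root t) r = - simple_root t r" for r using fun_cong[OF True, of r]
          by linarith
        then have "act L (simple_root t) = (\<lambda>r. - simple_root t r)" by (rule ext)
      then show ?thesis using tc by blast
    next
      case False
      define M where "M = t \<otimes> L \<otimes> t"
      have M: "M \<in> carrier G" using tc L by (simp add: M_def)
      have "act t (\<lambda>r. - act L (simple_root t) r) \<in> pos_roots"
        using simple_refl_permutes[OF t(1) neg False] .
      then have "act M (simple_root t) \<in> pos_roots"
        using tc L t
        by (simp add: M_def act_mult act_S[of t "simple_root t"] simple_refl_self act_uminus act_V)
      then have "len M < len (M \<otimes> t)" using len_less[OF M t(1)] by blast
      also have "M \<otimes> t = inv (L \<otimes> t)" using tc L iL S_inv[OF t(1)] mult_S_S[of "t \<otimes> L" t] t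
        by (simp add: M_def inv_mult_group)
      also have "len (inv (L \<otimes> t)) \<le> len (L \<otimes> t)" using len_inv L tc by simp
      finally have lt: "len M < len L" using t by simp
      have MM: "M \<otimes> M = \<one>"
      proof -
        have "M \<otimes> M = t \<otimes> L \<otimes> (t \<otimes> t) \<otimes> L \<otimes> t" using tc L by (simp add: M_def m_assoc)
        also have "\<dots> = t \<otimes> (L \<otimes> L) \<otimes> t" using tc L S_sq[OF t(1)] by (simp add: m_assoc)
        finally show ?thesis using tc L S_sq[OF t(1)] by simp
      qed
      have L_M: "L = t \<otimes> M \<otimes> t"
      proof -
        have "t \<otimes> M \<otimes> t = (t \<otimes> t) \<otimes> L \<otimes> (t \<otimes> t)" using tc L by (simp add: M_def m_assoc)
        then show ?thesis using S_sq[OF t(1)] L by simp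
      qed
      have "M \<noteq> \<one>"
      proof
        assume "M = \<one>"
        then have "L = \<one>" using L_M tc S_sq[OF t(1)] by simp
        then show False using L by simp
      qed
      then obtain \<rho> where r: "\<rho> \<in> roots" "act M \<rho> = (\<lambda>r. - \<rho> r)" using less.hyps[OF lt M MM]
        by blast
      have rV: "\<rho> \<in> V" using r root_V by blast
      have "act L (act t \<rho>) = act (t \<otimes> M \<otimes> t \<otimes> t) \<rho>" using rV tc M
        by (subst L_M) (simp add: act_mult act_V)
      also have "\<dots> = act t (act M \<rho>)" using mult_S_S[of "t \<otimes> M" t] tc M t rV by (simp add: act_mult)
      also have "\<dots> = (\<lambda>r. - act t \<rho> r)" using r tc rV by (simp add: act_uminus)
      finally show ?thesis using act_root[OF tc(1) r(1)] by blast
    qed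
  qed
  then obtain \<rho> where r: "\<rho> \<in> roots" "act L \<rho> = (\<lambda>r. - \<rho> r)" by blast
  from root_pos_or_neg[OF r(1)] show ?thesis
  proof
    assume p: "(\<lambda>s. - \<rho> s) \<in> pos_roots"
    have "act L (\<lambda>s. - \<rho> s) = (\<lambda>s. - (- \<rho> s))" using act_uminus[OF assms(1) root_V[OF r(1)]] r(2)
      by simp
    then show ?thesis by (rule bexI[OF _ p])
  qed (use r in blast)
qed

definition orth :: "'a set \<Rightarrow> ('a \<Rightarrow> real) \<Rightarrow> bool" where
  "orth A v \<longleftrightarrow> (\<forall>a \<in> A. bform v (simple_root a) = 0)"

lemma orth_uminus:
  assumes "A \<subseteq> S" "v \<in> V" "orth A v"
  shows "orth A (\<lambda>r. - v r)"
  unfolding orth_def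
proof
  fix a assume a: "a \<in> A"
  then have aV: "simple_root a \<in> V" using assms simple_root_span by auto
  show "bform (\<lambda>r. - v r) (simple_root a) = 0"
    using bform_uminus_right[OF aV assms(2)] bform_sym[OF aV assms(2)] bform_sym[OF aV span_on_uminus[OF assms(2)]] assms(3) a
    by (simp add: orth_def)
qed

lemma root_refl_orth_fix: "\<gamma> \<in> roots \<Longrightarrow> orth A \<gamma> \<Longrightarrow> A \<subseteq> S \<Longrightarrow> a \<in> A \<Longrightarrow> act (root_refl \<gamma>) (simple_root a) = simple_root a"
  using simple_root_span by (auto simp: root_refl_act orth_def)

text \<open>The reflection fixes the simple roots of A by orthogonality and is not trivial, so
  \<open>rank_one_unique\<close> applies.\<close>

lemma root_refl_rank_one:
  assumes A: "A \<subseteq> S" and r: "r \<in> S" "r \<notin> A" and g: "\<gamma> \<in> roots_on (insert r A)" "orth A \<gamma>"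
  shows "finite_type (comps_meeting A {r})" "root_refl \<gamma> = rstep A r"
proof -
  have J: "insert r A \<subseteq> S" using A r by auto
  have gr: "\<gamma> \<in> roots" using g by (simp add: roots_on_def)
  have "simple_map (root_refl \<gamma>) A" using root_refl_orth_fix[OF gr g(2) A] A
    by (auto simp: simple_map_def)
  then show "finite_type (comps_meeting A {r})" "root_refl \<gamma> = rstep A r"
    using rank_one_unique[OF A r root_refl_generate(2)[OF J g(1)]] root_refl_ne_one[OF gr] by auto
qed

text \<open>The inverse of L is a rank one element too, so L is an involution by uniqueness. A
  positive root negated by L is an inversion of L, hence supported on A and r, and it is orthogonal
  to A because L preserves the form and fixes A.\<close>

lemma rank_one_loop:
  assumes A: "A \<subseteq> S" and r: "r \<in> S" "r \<notin> A"
    and L: "L \<in> generate G (insert r A)" "L \<noteq> \<one>" "\<And>a. a \<in> A \<Longrightarrow> act L (simple_root a) = simple_root a"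
  shows "\<exists>\<gamma> \<in> pos_roots. \<gamma> \<in> roots_on (insert r A) \<and> orth A \<gamma> \<and> L = root_refl \<gamma>"
proof -
  have J: "insert r A \<subseteq> S" using A r by auto
  have Lc: "L \<in> carrier G" using generate_subset_carrier[OF J L(1)] .
  have sm: "simple_map L A" using L A by (auto simp: simple_map_def)
  have fix_inv: "act (inv L) (simple_root a) = simple_root a" if "a \<in> A" for a
    using L(3)[OF that] act_inv_act[OF Lc, of "simple_root a"] that A simple_root_span by auto
  then have smi: "simple_map (inv L) A" using A by (auto simp: simple_map_def)
  have iL: "inv L \<in> generate G (insert r A)"
    using generate_m_inv_closed[of "insert r A" L] L J gens_carrier by auto
  have "inv L \<noteq> \<one>" using L Lc by (metis inv_inv inv_one)
  then have "inv L = L"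
    using rank_one_unique(2)[OF A r L(1) sm L(2)] rank_one_unique(2)[OF A r iL smi]
    by (metis (no_types))
  then have "L \<otimes> L = \<one>" using Lc by (metis r_inv)
  then obtain \<rho> where rho: "\<rho> \<in> pos_roots" "act L \<rho> = (\<lambda>r. - \<rho> r)" using involution_root Lc L
    by blast
  have rr: "\<rho> \<in> roots" "\<rho> \<in> V" using rho pos_root pos_root_V by auto
  have "\<rho> \<in> inversions L" using rho pos_not_neg by (simp add: inversions_def)
  then have on: "\<rho> \<in> roots_on (insert r A)" using inversions_generate[OF J L(1)] by blast
  have "orth A \<rho>" unfolding orth_def
  proof
    fix a assume a: "a \<in> A"
    then have aV: "simple_root a \<in> V" using A simple_root_span by auto
    have "bform \<rho> (simple_root a) = bform (\<lambda>r. - \<rho> r) (simple_root a)"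
      using act_bform[OF Lc rr(2) aV] rho L(3)[OF a] by simp
    also have "\<dots> = - bform \<rho> (simple_root a)"
      using bform_uminus_right[OF aV rr(2)] bform_sym[OF aV] rr span_on_uminus by simp
    finally show "bform \<rho> (simple_root a) = 0" by simp
  qed
  then show ?thesis
    using root_refl_rank_one(2)[OF A r on] rank_one_unique(2)[OF A r L(1) sm L(2)] rho on by auto
qed

lemma orth_root_unique:
  assumes A: "A \<subseteq> S" and r: "r \<in> S" "r \<notin> A"
    and g: "\<gamma> \<in> pos_roots" "\<gamma> \<in> roots_on (insert r A)" "orth A \<gamma>"
    and d: "\<delta> \<in> pos_roots" "\<delta> \<in> roots_on (insert r A)" "orth A \<delta>"
  shows "\<gamma> = \<delta>"
  using root_refl_rank_one(2)[OF A r] g d root_refl_inj by metis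

end

section \<open>Paths of arrows\<close>

lemma arrow_path_append:
  "arrow_path E z (p @ q) y \<longleftrightarrow> (\<exists>m. arrow_path E z p m \<and> arrow_path E m q y)"
  by (induction p arbitrary: z) auto

lemma arrow_path_set: "arrow_path E z p y \<Longrightarrow> set p \<subseteq> E"
  by (induction p arbitrary: z) auto

lemma arrow_path_mono: "arrow_path E z p y \<Longrightarrow> set p \<subseteq> F \<Longrightarrow> arrow_path F z p y"
  by (induction p arbitrary: z) auto

lemma arrow_eqI: "tgt e = tgt f \<Longrightarrow> elt e = elt f \<Longrightarrow> src e = src f \<Longrightarrow> e = f"
  by (simp add: tgt_def elt_def src_def prod_eq_iff)

lemma arrow_sel [simp]: "tgt (z, w, y) = z" "elt (z, w, y) = w" "src (z, w, y) = y"
  by (simp_all add: tgt_def elt_def src_def)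

context coxeter_system begin

text \<open>A codimension count: u preserves the span of A and s and carries the span of A onto that
  of its image, so one index is missing there. As A may be infinite, coordinates at s are compared
  instead of dimensions.\<close>

lemma simple_img_swap:
  assumes A: "A \<subseteq> S" and s: "s \<in> S" "s \<notin> A" and u: "u \<in> generate G (insert s A)" "simple_map u A"
  shows "\<exists>t. t \<notin> simple_img u A \<and> insert s A = insert t (simple_img u A)"
proof -
  let ?J = "insert s A" and ?B = "simple_img u A"
  have J: "?J \<subseteq> S" using A s by auto
  have uc: "u \<in> carrier G" using generate_subset_carrier[OF J u(1)] .
  have iu: "inv u \<in> generate G ?J" "inv u \<in> carrier G"
    using generate_m_inv_closed[of ?J u] u J gens_carrier uc by auto
  have BJ: "?B \<subseteq> ?J"
  proof
    fix b assume "b \<in> ?B"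
    then obtain a where "a \<in> A" "act u (simple_root a) = simple_root b"
      by (auto simp: simple_img_def)
    then have "simple_root b \<in> span_on ?J"
      using act_span[OF J u(1), of "simple_root a"] simple_root_span by auto
    then show "b \<in> ?J" by (simp add: span_on_def)
  qed
  have pull: "v \<in> span_on ?B" if "v \<in> V" "act (inv u) v \<in> span_on A" for v
    using simple_img_span[OF uc A u(2) that(2)] uc that by simp
  have sJ: "simple_root s \<in> span_on ?J" "simple_root s \<in> V" using s simple_root_span by auto
  have "?B \<noteq> ?J"
  proof
    assume "?B = ?J"
    then have "act u (simple_root s) \<in> span_on ?B" using act_span[OF J u(1) sJ(1)] by simp
    then have "simple_root s \<in> span_on A" using simple_img_span_inv[OF uc A] uc sJ by force
    then show False using s by (simp add: span_on_def)
  qed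
  then obtain t where t: "t \<in> ?J" "t \<notin> ?B" using BJ by blast
  have inA: "v \<in> span_on A" if "v \<in> span_on ?J" "v s = 0" for v
    using that by (auto simp: span_on_def supp_def)
  have root_not: "simple_root r \<notin> span_on ?B" if "r \<notin> ?B" for r using that
    by (simp add: span_on_def)
  have uniq: "r = t" if r: "r \<in> ?J" "r \<notin> ?B" for r
  proof (rule ccontr)
    assume rt: "r \<noteq> t"
    define x1 x2 where "x1 = act (inv u) (simple_root r)" and "x2 = act (inv u) (simple_root t)"
    have xJ: "x1 \<in> span_on ?J" "x2 \<in> span_on ?J" using act_span[OF J iu(1)] r t simple_root_span
      by (auto simp: x1_def x2_def)
    have rtV: "simple_root r \<in> V" "simple_root t \<in> V" using r t J simple_root_span by auto
    \<comment> \<open>The coefficients cancel the coordinate at s of the preimage. So the preimage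
      lies in the span of A and v in that of the image, which forces the coefficient
      \<open>x2 s\<close> of r to vanish.\<close>
    define v where "v = (\<lambda>q. x2 s * simple_root r q + (- x1 s) * simple_root t q)"
    have vV: "v \<in> V" unfolding v_def by (rule span_on_lin[OF rtV])
    have iv: "act (inv u) v = (\<lambda>q. x2 s * x1 q + (- x1 s) * x2 q)"
      unfolding v_def x1_def x2_def by (rule act_lin[OF iu(2) rtV])
    have "act (inv u) v \<in> span_on A" unfolding iv by (rule inA[OF span_on_lin[OF xJ]]) simp
    then have "v \<in> span_on ?B" using pull vV by blast
    then have "v r = 0" using span_on_zero r by blast
    then have "x2 s = 0" using rt by (simp add: v_def simple_root_def)
    then have "simple_root t \<in> span_on ?B" using pull[OF rtV(2)] inA[OF xJ(2)] by (simp add: x2_def)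
    then show False using root_not t by blast
  qed
  have "?J \<subseteq> insert t ?B"
  proof
    fix r assume "r \<in> ?J"
    then show "r \<in> insert t ?B" using uniq[of r] by (cases "r \<in> ?B") simp_all
  qed
  moreover have "insert t ?B \<subseteq> ?J" using t(1) BJ by (simp only: insert_subset)
  ultimately have "?J = insert t ?B" by (rule subset_antisym)
  then show ?thesis using t by blast
qed

end

context coxeter_groupoid begin

section \<open>The groupoid\<close>

abbreviation supp_of :: "('l \<Rightarrow> 'a) \<Rightarrow> 'a set" where "supp_of x \<equiv> x ` \<Lambda>"

lemma vertices_S: "x \<in> vertices \<Longrightarrow> l \<in> \<Lambda> \<Longrightarrow> x l \<in> S"
  by (auto simp: vertices_def injections_def)

lemma supp_of_S: "x \<in> vertices \<Longrightarrow> supp_of x \<subseteq> S"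
  using vertices_S by blast

lemma vertices_V: "x \<in> vertices \<Longrightarrow> l \<in> \<Lambda> \<Longrightarrow> simple_root (x l) \<in> V"
  using vertices_S simple_root_span by blast

lemma C_hom_carrier: "w \<in> C_hom x y \<Longrightarrow> w \<in> carrier G"
  by (simp add: C_hom_def)

lemma C_hom_act: "w \<in> C_hom x y \<Longrightarrow> l \<in> \<Lambda> \<Longrightarrow> act w (simple_root (y l)) = simple_root (x l)"
  by (simp add: C_hom_def)

lemma C_hom_one: "x \<in> vertices \<Longrightarrow> \<one> \<in> C_hom x x"
  by (simp add: C_hom_def vertices_V)

lemma C_hom_mult: "v \<in> C_hom x y \<Longrightarrow> w \<in> C_hom y z \<Longrightarrow> z \<in> vertices \<Longrightarrow> v \<otimes> w \<in> C_hom x z"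
  by (simp add: C_hom_def act_mult vertices_V)

lemma C_hom_inv: "w \<in> C_hom x y \<Longrightarrow> y \<in> vertices \<Longrightarrow> inv w \<in> C_hom y x"
  by (simp add: C_hom_def vertices_V)

lemma xI_vertex: "xI \<in> vertices"
proof -
  have i: "xI \<in> injections" using xI_extensional xI_bij I_subset
    by (auto simp: injections_def PiE_def bij_betw_def)
  then have "\<one> \<in> C_hom xI xI" using simple_root_span[of _ S]
    by (auto simp: C_hom_def injections_def PiE_def Pi_def)
  then show ?thesis using i by (auto simp: vertices_def)
qed

lemma vertices_connected:
  assumes "x \<in> vertices" "y \<in> vertices"
  shows "\<exists>w. w \<in> C_hom x y"
proof -
  obtain v w where "v \<in> C_hom x xI" "w \<in> C_hom y xI" using assms by (auto simp: vertices_def)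
  then have "v \<otimes> inv w \<in> C_hom x y" using C_hom_mult C_hom_inv xI_vertex assms by blast
  then show ?thesis by blast
qed

text \<open>The labels of x are carried along by u; composing with an arrow from \<open>xI\<close>
  to x shows that the new labelling is a vertex.\<close>

lemma vertex_image:
  assumes x: "x \<in> vertices" and u: "u \<in> carrier G" "simple_map u (supp_of x)"
  shows "\<exists>y \<in> vertices. u \<in> C_hom y x"
proof -
  have "\<forall>l \<in> \<Lambda>. \<exists>b \<in> S. act u (simple_root (x l)) = simple_root b" using u
    by (auto simp: simple_map_def)
  then obtain f where f: "\<And>l. l \<in> \<Lambda> \<Longrightarrow> f l \<in> S \<and> act u (simple_root (x l)) = simple_root (f l)"
    by metis
  define y where "y = restrict f \<Lambda>"
  have uC: "u \<in> C_hom y x" using f u by (auto simp: C_hom_def y_def)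
  have "inj_on y \<Lambda>"
  proof (rule inj_onI)
    fix l m assume lm: "l \<in> \<Lambda>" "m \<in> \<Lambda>" "y l = y m"
    then have "act u (simple_root (x l)) = act u (simple_root (x m))" using f by (simp add: y_def)
    then have "simple_root (x l) = simple_root (x m)" using act_inj u x lm vertices_V by blast
    then have "x l = x m" by (simp add: simple_root_inj)
    then show "l = m" using x lm by (auto simp: vertices_def injections_def dest: inj_onD)
  qed
  then have "y \<in> injections" using f by (auto simp: injections_def y_def)
  moreover obtain v where "v \<in> C_hom x xI" using x by (auto simp: vertices_def)
  ultimately have "y \<in> vertices" using C_hom_mult[OF uC _ xI_vertex] by (auto simp: vertices_def)
  then show ?thesis using uC by blast
qed

lemma C_hom_simple_map:
  assumes "u \<in> C_hom y x" "y \<in> vertices"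
  shows "simple_map u (supp_of x)" "simple_img u (supp_of x) = supp_of y"
  using assms C_hom_act vertices_S by (auto simp: simple_map_def simple_img_def simple_root_inj)

lemma C_hom_tgt_unique:
  assumes "u \<in> C_hom y x" "u \<in> C_hom z x" "y \<in> vertices" "z \<in> vertices"
  shows "y = z"
proof (rule PiE_ext)
  show "y \<in> \<Lambda> \<rightarrow>\<^sub>E S" "z \<in> \<Lambda> \<rightarrow>\<^sub>E S" using assms by (auto simp: vertices_def injections_def)
  show "y l = z l" if "l \<in> \<Lambda>" for l
  proof -
    have "simple_root (y l) = simple_root (z l)"
      using C_hom_act[OF assms(1) that] C_hom_act[OF assms(2) that] by simp
    then show ?thesis by (simp add: simple_root_inj)
  qed
qed

lemma C_hom_orth:
  assumes w: "w \<in> C_hom x y" and y: "y \<in> vertices" and g: "\<gamma> \<in> V" "orth (supp_of y) \<gamma>"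
  shows "orth (supp_of x) (act w \<gamma>)"
  unfolding orth_def
proof
  fix a assume "a \<in> supp_of x"
  then obtain l where l: "l \<in> \<Lambda>" "a = x l" by blast
  then have "bform (act w \<gamma>) (simple_root a) = bform (act w \<gamma>) (act w (simple_root (y l)))"
    using C_hom_act[OF w] by simp
  also have "\<dots> = bform \<gamma> (simple_root (y l))" using act_bform C_hom_carrier[OF w] g y l vertices_V
    by simp
  finally show "bform (act w \<gamma>) (simple_root a) = 0" using g l by (auto simp: orth_def)
qed

lemma Y_hom_iff:
  "w \<in> Y_hom x y \<longleftrightarrow> w \<in> C_hom x y \<and> (\<forall>\<gamma> \<in> pos_roots. orth (supp_of y) \<gamma> \<longrightarrow> act w \<gamma> \<in> pos_roots)"
  using pos_root by (auto simp: Y_hom_def orth_roots_def orth_def)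

lemma Y_hom_C: "w \<in> Y_hom x y \<Longrightarrow> w \<in> C_hom x y"
  by (simp add: Y_hom_def)

lemma Y_hom_carrier: "w \<in> Y_hom x y \<Longrightarrow> w \<in> carrier G"
  using Y_hom_C C_hom_carrier by blast

lemma Y_hom_pos: "w \<in> Y_hom x y \<Longrightarrow> \<gamma> \<in> pos_roots \<Longrightarrow> orth (supp_of y) \<gamma> \<Longrightarrow> act w \<gamma> \<in> pos_roots"
  by (simp add: Y_hom_iff)

lemma Y_hom_orth: "w \<in> Y_hom x y \<Longrightarrow> y \<in> vertices \<Longrightarrow> \<gamma> \<in> V \<Longrightarrow> orth (supp_of y) \<gamma> \<Longrightarrow> orth (supp_of x) (act w \<gamma>)"
  using C_hom_orth Y_hom_C by blast

lemma Y_hom_one: "x \<in> vertices \<Longrightarrow> \<one> \<in> Y_hom x x"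
  by (simp add: Y_hom_iff C_hom_one pos_root_V)

lemma Y_hom_mult:
  assumes "v \<in> Y_hom x y" "w \<in> Y_hom y z" "y \<in> vertices" "z \<in> vertices"
  shows "v \<otimes> w \<in> Y_hom x z"
  unfolding Y_hom_iff
proof (intro conjI ballI impI)
  show "v \<otimes> w \<in> C_hom x z" using C_hom_mult Y_hom_C assms by blast
  fix \<gamma> assume g: "\<gamma> \<in> pos_roots" "orth (supp_of z) \<gamma>"
  have "act v (act w \<gamma>) \<in> pos_roots"
    using Y_hom_pos[OF assms(1) Y_hom_pos[OF assms(2) g] Y_hom_orth[OF assms(2,4) pos_root_V[OF g(1)] g(2)]] .
  then show "act (v \<otimes> w) \<gamma> \<in> pos_roots" using assms Y_hom_carrier g pos_root_V
    by (simp add: act_mult)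
qed

text \<open>If the inverse made an orthogonal positive root negative, the negative of its image
  would be an orthogonal positive root at y that w turns negative.\<close>

lemma Y_hom_inv:
  assumes w: "w \<in> Y_hom x y" and xy: "x \<in> vertices" "y \<in> vertices"
  shows "inv w \<in> Y_hom y x"
  unfolding Y_hom_iff
proof (intro conjI ballI impI)
  show iC: "inv w \<in> C_hom y x" using C_hom_inv Y_hom_C w xy by blast
  fix \<gamma> assume g: "\<gamma> \<in> pos_roots" "orth (supp_of x) \<gamma>"
  have wc: "w \<in> carrier G" "inv w \<in> carrier G" using w Y_hom_carrier by auto
  have gV: "\<gamma> \<in> V" "\<gamma> \<in> roots" using g pos_root_V pos_root by auto
  show "act (inv w) \<gamma> \<in> pos_roots"
  proof (rule ccontr)
    let ?d = "\<lambda>r. - act (inv w) \<gamma> r"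
    assume "act (inv w) \<gamma> \<notin> pos_roots"
    then have p: "?d \<in> pos_roots" using not_pos_iff act_root wc gV by blast
    have "orth (supp_of y) (act (inv w) \<gamma>)" using C_hom_orth[OF iC xy(1) gV(1) g(2)] .
    then have "orth (supp_of y) ?d"
      using orth_uminus[OF supp_of_S[OF xy(2)] act_V[OF wc(2) gV(1)]] by blast
    then have "act w ?d \<in> pos_roots" using Y_hom_pos w p by blast
    then have "(\<lambda>r. - \<gamma> r) \<in> pos_roots" using act_uminus[OF wc(1) act_V[OF wc(2) gV(1)]] wc gV
      by simp
    then show False using pos_not_neg g by blast
  qed
qed

section \<open>Edges\<close>

lemma step_rstep: "step x s = rstep (supp_of x) s"
  by (simp add: step_def rstep_def)

lemma edgeE:
  assumes "e \<in> edges_within J"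
  obtains s where "src e \<in> vertices" "tgt e \<in> vertices" "elt e \<in> C_hom (tgt e) (src e)"
    "s \<in> S" "s \<notin> supp_of (src e)" "insert s (supp_of (src e)) \<subseteq> J"
    "elt e = rstep (supp_of (src e)) s" "elt e \<in> generate G (insert s (supp_of (src e)))"
      "elt e \<noteq> \<one>"
proof -
  obtain y x s where e: "e = (y, step x s, x)" "x \<in> vertices" "y \<in> vertices" "step_ok x s"
    "step x s \<in> C_hom y x"
    "supp_of x \<union> {s} \<subseteq> J" using assms by (auto simp: edges_within_def)
  have s: "s \<in> S" "s \<notin> supp_of x" "finite_type (comps_meeting (supp_of x) {s})" using e
    by (auto simp: step_ok_def)
  show thesis
    using that[of s] e s rstep_props[OF supp_of_S[OF e(2)] s] by (simp add: step_rstep)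
qed

text \<open>Finite type and the formula for the step follow from the existence of u by
  \<open>rank_one_unique\<close>.\<close>

lemma edgeI:
  assumes "x \<in> vertices" "y \<in> vertices" "s \<in> S" "s \<notin> supp_of x" "u \<in> C_hom y x"
    "u \<in> generate G (insert s (supp_of x))" "u \<noteq> \<one>" "insert s (supp_of x) \<subseteq> J"
  shows "(y, u, x) \<in> edges_within J"
  using rank_one_unique[OF supp_of_S[OF assms(1)] assms(3,4,6) C_hom_simple_map(1)[OF assms(5,2)] assms(7)] assms
  by (auto simp: edges_within_def step_ok_def step_rstep)

lemma edge_facts:
  assumes "e \<in> edges_within J"
  shows edge_src: "src e \<in> vertices" and edge_tgt: "tgt e \<in> vertices"
    and edge_C: "elt e \<in> C_hom (tgt e) (src e)" and edge_carrier: "elt e \<in> carrier G"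
    and edge_generate: "elt e \<in> generate G J"
  using assms by (auto elim!: edgeE dest: C_hom_carrier intro: generate_mono)

lemma edges_within_edges: "edges_within J \<subseteq> edges"
proof
  fix e assume "e \<in> edges_within J"
  then show "e \<in> edges"
  proof (rule edgeE)
    fix s assume "src e \<in> vertices" "tgt e \<in> vertices" "elt e \<in> C_hom (tgt e) (src e)"
      "s \<in> S" "s \<notin> supp_of (src e)" "elt e \<in> generate G (insert s (supp_of (src e)))" "elt e \<noteq> \<one>"
    then have "(tgt e, elt e, src e) \<in> edges" using supp_of_S by (intro edgeI) auto
    then show "e \<in> edges" by (simp add: tgt_def elt_def src_def)
  qed
qed

text \<open>Applies \<open>simple_img_swap\<close> to the edge; it keeps an edge and its reverse
  within the same J.\<close>

lemma edge_swap:
  assumes e: "e \<in> edges_within J" and s: "s \<in> S" "s \<notin> supp_of (src e)"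
    "elt e \<in> generate G (insert s (supp_of (src e)))"
  obtains t where "t \<in> S" "t \<notin> supp_of (tgt e)"
    "insert s (supp_of (src e)) = insert t (supp_of (tgt e))"
proof -
  have C: "elt e \<in> C_hom (tgt e) (src e)" "src e \<in> vertices" "tgt e \<in> vertices"
    using edge_facts[OF e] by auto
  obtain t where t: "t \<notin> supp_of (tgt e)" "insert s (supp_of (src e)) = insert t (supp_of (tgt e))"
    using simple_img_swap[OF supp_of_S[OF C(2)] s C_hom_simple_map(1)[OF C(1,3)]] C_hom_simple_map(2)[OF C(1,3)] by auto
  moreover have "t \<in> insert s (supp_of (src e))" unfolding t(2) by simp
  then have "t \<in> S" using s(1) supp_of_S[OF C(2)] by auto
  ultimately show thesis using that by blast
qed

lemma flip_sel [simp]: "src (flip e) = tgt e" "tgt (flip e) = src e" "elt (flip e) = inv (elt e)"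
  by (simp_all add: flip_def)

lemma flip_edge:
  assumes "e \<in> edges_within J"
  shows "flip e \<in> edges_within J"
  using assms
proof (rule edgeE)
  fix s assume a: "src e \<in> vertices" "tgt e \<in> vertices" "elt e \<in> C_hom (tgt e) (src e)"
    "s \<in> S" "s \<notin> supp_of (src e)" "insert s (supp_of (src e)) \<subseteq> J"
    "elt e \<in> generate G (insert s (supp_of (src e)))" "elt e \<noteq> \<one>"
  then obtain t where t: "t \<in> S" "t \<notin> supp_of (tgt e)"
    "insert s (supp_of (src e)) = insert t (supp_of (tgt e))"
    using edge_swap[OF assms] by metis
  have "insert s (supp_of (src e)) \<subseteq> carrier G" using a supp_of_S gens_carrier by blast
  then have "inv (elt e) \<in> generate G (insert t (supp_of (tgt e)))" using generate_m_inv_closed a t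
    by metis
  moreover have "inv (elt e) \<noteq> \<one>" using a C_hom_carrier by (metis inv_inv inv_one)
  ultimately have "(src e, inv (elt e), tgt e) \<in> edges_within J" using a t C_hom_inv
    by (intro edgeI) auto
  then show "flip e \<in> edges_within J" by (simp add: flip_def)
qed

lemma flip_flip: "e \<in> edges_within J \<Longrightarrow> flip (flip e) = e"
  using edge_carrier[of e J] by (intro arrow_eqI) auto

lemma loop_root:
  assumes e: "e \<in> edges_within J" "tgt e = src e"
  obtains s \<gamma> where "s \<in> S" "s \<notin> supp_of (src e)" "insert s (supp_of (src e)) \<subseteq> J" "\<gamma> \<in> pos_roots"
    "\<gamma> \<in> roots_on (insert s (supp_of (src e)))" "orth (supp_of (src e)) \<gamma>" "elt e = root_refl \<gamma>"
  using e(1)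
proof (rule edgeE)
  fix s assume a: "src e \<in> vertices" "elt e \<in> C_hom (tgt e) (src e)"
    "s \<in> S" "s \<notin> supp_of (src e)" "insert s (supp_of (src e)) \<subseteq> J"
    "elt e \<in> generate G (insert s (supp_of (src e)))" "elt e \<noteq> \<one>"
  then have "act (elt e) (simple_root b) = simple_root b" if "b \<in> supp_of (src e)" for b
    using C_hom_act e(2) that by force
  then obtain \<gamma> where "\<gamma> \<in> pos_roots" "\<gamma> \<in> roots_on (insert s (supp_of (src e)))"
    "orth (supp_of (src e)) \<gamma>" "elt e = root_refl \<gamma>"
    using rank_one_loop[OF supp_of_S[OF a(1)] a(3,4,6,7)] by blast
  then show thesis using that a by blast
qed

lemma loopI:
  assumes z: "z \<in> vertices" and s: "s \<in> S" "s \<notin> supp_of z" "insert s (supp_of z) \<subseteq> J"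
    and g: "\<gamma> \<in> roots_on (insert s (supp_of z))" "orth (supp_of z) \<gamma>"
  shows "(z, root_refl \<gamma>, z) \<in> edges_within J"
proof (rule edgeI[OF z z s(1,2) _ _ _ s(3)])
  have gr: "\<gamma> \<in> roots" using g by (simp add: roots_on_def)
  show "root_refl \<gamma> \<in> generate G (insert s (supp_of z))"
    using root_refl_generate(2)[OF _ g(1)] s supp_of_S[OF z] by blast
  show "root_refl \<gamma> \<noteq> \<one>" using root_refl_ne_one gr by blast
  show "root_refl \<gamma> \<in> C_hom z z"
    using root_refl_orth_fix[OF gr g(2) supp_of_S[OF z]] gr by (auto simp: C_hom_def)
qed

lemma loop_inv:
  assumes "e \<in> edges_within J" "tgt e = src e"
  shows "inv (elt e) = elt e" "flip e = e"
proof -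
  show i: "inv (elt e) = elt e" using loop_root[OF assms] root_refl_inv pos_root by metis
  show "flip e = e" by (rule arrow_eqI) (use assms i in auto)
qed

text \<open>An orthogonal positive root inverted by the step would be supported on the enlarged
  index set, so its reflection would be the step by \<open>root_refl_rank_one\<close>. Then the step
  would fix all labels and be a loop.\<close>

lemma nonloop_Y:
  assumes e: "e \<in> edges_within J" "tgt e \<noteq> src e"
  shows "elt e \<in> Y_hom (tgt e) (src e)"
  using e(1)
proof (rule edgeE)
  fix s assume a: "src e \<in> vertices" "tgt e \<in> vertices" "elt e \<in> C_hom (tgt e) (src e)"
    "s \<in> S" "s \<notin> supp_of (src e)" "elt e = rstep (supp_of (src e)) s"
    "elt e \<in> generate G (insert s (supp_of (src e)))" "elt e \<noteq> \<one>"
  have J: "insert s (supp_of (src e)) \<subseteq> S" using a supp_of_S by blast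
  have "act (elt e) \<gamma> \<in> pos_roots" if g: "\<gamma> \<in> pos_roots" "orth (supp_of (src e)) \<gamma>" for \<gamma>
  proof (rule ccontr)
    assume "act (elt e) \<gamma> \<notin> pos_roots"
    then have "\<gamma> \<in> roots_on (insert s (supp_of (src e)))"
      using inversions_generate[OF J a(7)] g by (auto simp: inversions_def)
    then have "root_refl \<gamma> = elt e"
      using root_refl_rank_one(2)[OF supp_of_S[OF a(1)] a(4,5) _ g(2)] a by simp
    then have "elt e \<in> C_hom (src e) (src e)"
      using root_refl_orth_fix[OF pos_root[OF g(1)] g(2) supp_of_S[OF a(1)]] C_hom_carrier[OF a(3)]
      by (auto simp: C_hom_def)
    then show False using C_hom_tgt_unique[OF a(3)] a e by blast
  qed
  then show ?thesis using a by (simp add: Y_hom_iff)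
qed

section \<open>Elements represented by paths\<close>

lemma path_elt_simps [simp]: "path_elt [] = \<one>" "path_elt (e # p) = elt e \<otimes> path_elt p"
  by (simp_all add: path_elt_def)

lemma path_elt_carrier: "set p \<subseteq> edges \<Longrightarrow> path_elt p \<in> carrier G"
  using edge_carrier by (induction p) auto

lemma path_elt_append: "set p \<subseteq> edges \<Longrightarrow> set q \<subseteq> edges \<Longrightarrow> path_elt (p @ q) = path_elt p \<otimes> path_elt q"
  using edge_carrier path_elt_carrier by (induction p) (auto simp: m_assoc)

lemma path_set: "arrow_path (edges_within J) z p y \<Longrightarrow> set p \<subseteq> edges"
  by (rule subset_trans[OF arrow_path_set edges_within_edges])

lemma path_C: "arrow_path (edges_within J) z p y \<Longrightarrow> y \<in> vertices \<Longrightarrow> path_elt p \<in> C_hom z y \<and> z \<in> vertices"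
proof (induction p arbitrary: z)
  case (Cons e p)
  then have e: "e \<in> edges_within J" "tgt e = z" "path_elt p \<in> C_hom (src e) y" using edge_src
    by auto
  then show ?case
    using C_hom_mult[of "elt e" z "src e"] edge_C[OF e(1)] edge_tgt[OF e(1)] Cons.prems by simp
qed (simp add: C_hom_one)

lemma path_Y:
  "arrow_path (edges_within J) z p y \<Longrightarrow> y \<in> vertices \<Longrightarrow> \<forall>e \<in> set p. tgt e \<noteq> src e \<Longrightarrow> path_elt p \<in> Y_hom z y"
proof (induction p arbitrary: z)
  case (Cons e p)
  then show ?case using nonloop_Y[of e J] edge_src[of e J] Y_hom_mult[of "elt e" z "src e"] by auto
qed (simp add: Y_hom_one)

lemma inv_path_simps [simp]: "inv_path [] = []" "inv_path (e # p) = inv_path p @ [flip e]"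
  by (simp_all add: inv_path_def)

lemma arrow_path_inv:
  assumes "\<And>e. e \<in> E \<Longrightarrow> flip e \<in> E"
  shows "arrow_path E z p y \<Longrightarrow> arrow_path E y (inv_path p) z"
  using assms by (induction p arbitrary: z) (auto simp: arrow_path_append)

lemma path_elt_inv: "set p \<subseteq> edges \<Longrightarrow> path_elt (inv_path p) = inv (path_elt p)"
proof (induction p)
  case (Cons e p)
  have "set (inv_path p) \<subseteq> edges" "flip e \<in> edges" using Cons flip_edge by (auto simp: inv_path_def)
  then show ?case using Cons path_elt_append[of "inv_path p"
    "[flip e]"] edge_carrier[of e S] path_elt_carrier[of p]
    by (simp add: inv_mult_group)
qed simp

text \<open>The analogue of reduced words: each edge, from right to left, adds inversions and
  removes none. Strictness excludes backtracking; monotonicity compares a final segment with the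
  whole path.\<close>

fun reduced :: "('l \<Rightarrow> 'a, 'a) arrow list \<Rightarrow> bool" where
  "reduced [] \<longleftrightarrow> True"
| "reduced (e # p) \<longleftrightarrow> inversions (path_elt p) \<subset> inversions (path_elt (e # p)) \<and> reduced p"

lemma reduced_append: "reduced (p @ q) \<Longrightarrow> reduced q \<and> inversions (path_elt q) \<subseteq> inversions (path_elt (p @ q))"
  by (induction p) auto

text \<open>Brink and Howlett's generation of the groupoid by the steps, within a parabolic subgroup: peel
  off steps at the target while some simple root there is inverted by the inverse.\<close>

lemma reduced_path_exists:
  assumes "y \<in> vertices" "z \<in> vertices" "supp_of y \<subseteq> J" "J \<subseteq> S" "u \<in> C_hom y z" "u \<in> generate G J"
  shows "\<exists>p. arrow_path (edges_within J) y p z \<and> path_elt p = u \<and> reduced p"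
  using assms
proof (induction "card (inversions u)" arbitrary: u y rule: less_induct)
  case less
  note y = less.prems(1) and z = less.prems(2) and yJ = less.prems(3) and J = less.prems(4)
    and u = less.prems(5,6)
  have uc: "u \<in> carrier G" using u C_hom_carrier by blast
  show ?case
  proof (cases "u = \<one>")
    case True
    then have "z = y" using C_hom_tgt_unique[OF u(1) _ y z] C_hom_one[OF z] by simp
    then show ?thesis using True by (intro exI[of _ "[]"]) auto
  next
    case False
    \<comment> \<open>Edges are peeled off at the target y, so the simple roots to be tested are
      those at y, which are moved by the inverse of u.\<close>
    define w where "w = inv u"
    have w: "w \<in> carrier G" "w \<in> C_hom z y" "w \<in> generate G J" "w \<noteq> \<one>" "inv w = u"
      using uc u z C_hom_inv False generate_m_inv_closed[of J u] J gens_carrier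
      by (auto simp: w_def)
    have smw: "simple_map w (supp_of y)" using C_hom_simple_map(1)[OF w(2) z] .
    obtain t where t: "t \<in> J" "act w (simple_root t) \<notin> pos_roots"
      using generate_pos_one[OF J w(3)] w(4) by blast
    have tS: "t \<in> S" "t \<notin> supp_of y" using t J simple_map_pos[OF smw] by auto
    have sub: "rel_roots (insert t (supp_of y)) (supp_of y) \<inter> pos_roots \<subseteq> inversions w"
      using rel_roots_inversions[OF w(1) supp_of_S[OF y] smw tS(1) t(2)] .
    then have "finite (rel_roots (supp_of y \<union> {t}) (supp_of y))"
      using finite_rel_roots finite_subset[OF sub finite_inversions[OF w(1)]] by simp
    then have ft: "finite_type (comps_meeting (supp_of y) {t})"
      using finite_type_comps[of "supp_of y" "{t}"] supp_of_S[OF y] tS by auto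
    define e where "e = rstep (supp_of y) t"
    have e: "e \<in> generate G (insert t (supp_of y))" "simple_map e (supp_of y)" "e \<noteq> \<one>"
      using rstep_props[OF supp_of_S[OF y] tS ft] by (auto simp: e_def)
    have Jt: "insert t (supp_of y) \<subseteq> S" "insert t (supp_of y) \<subseteq> J" using tS supp_of_S[OF y] t yJ
      by auto
    have ec: "e \<in> carrier G" using generate_subset_carrier[OF Jt(1) e(1)] .
    obtain y' where y': "y' \<in> vertices" "e \<in> C_hom y' y" using vertex_image[OF y ec e(2)] by blast
    have edge: "(y', e, y) \<in> edges_within J" using edgeI[OF y y'(1) tS y'(2) e(1,3) Jt(2)] .
    have ie: "inversions e \<subseteq> inversions w" using inversions_rank_one[OF supp_of_S[OF y] tS(1) e] sub
      by simp
    have eJ: "e \<in> generate G J" using generate_mono[OF Jt(2) e(1)] .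
    define v where "v = e \<otimes> u"
    have v: "v \<in> C_hom y' z" "v \<in> generate G J" "v \<in> carrier G"
      using C_hom_mult[OF y'(2) u(1) z] eJ u ec uc by (auto simp: v_def intro: generate.eng)
    have vu: "inversions v \<subset> inversions u"
    proof
      show "inversions v \<subseteq> inversions u"
      proof
        fix \<beta> assume b: "\<beta> \<in> inversions v"
        then have bp: "\<beta> \<in> pos_roots" "\<beta> \<in> V" using inversions_pos pos_root_V by auto
        show "\<beta> \<in> inversions u"
        proof (rule ccontr)
          assume "\<beta> \<notin> inversions u"
          then have "act u \<beta> \<in> pos_roots" using bp by (simp add: inversions_def)
          moreover have "act e (act u \<beta>) \<notin> pos_roots" using b ec uc bp
            by (simp add: inversions_def v_def act_mult)
          ultimately have "act u \<beta> \<in> inversions w" using ie by (auto simp: inversions_def)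
          then show False using bp uc by (simp add: inversions_def w_def)
        qed
      qed
      have "inversions e \<noteq> {}" using inversions_empty ec e(3) by blast
      then obtain \<gamma> where g: "\<gamma> \<in> inversions e" by blast
      have gV: "\<gamma> \<in> V" "\<gamma> \<in> pos_roots" using g inversions_pos pos_root_V by auto
      \<comment> \<open>This root is inverted by u but not by v: u sends it to the negative of
        \<gamma>, and e makes that positive.\<close>
      define \<beta> where "\<beta> = (\<lambda>r. - act w \<gamma> r)"
      have wg: "act w \<gamma> \<in> V" using act_V w gV by blast
      have bp: "\<beta> \<in> pos_roots" using inversions_neg[OF w(1)] g ie by (auto simp: \<beta>_def)
      have ub: "act u \<beta> = (\<lambda>r. - \<gamma> r)" using act_uminus[OF uc wg] w(5) gV act_inv_act[OF w(1)]
        by (simp add: \<beta>_def)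
      have "\<beta> \<in> inversions u" using bp ub pos_not_neg[OF gV(2)] by (simp add: inversions_def)
      moreover have "act v \<beta> \<in> pos_roots"
        using ub inversions_neg[OF ec g] act_uminus[OF ec gV(1)] bp pos_root_V ec uc
        by (simp add: v_def act_mult)
      ultimately show "inversions v \<noteq> inversions u" by (auto simp: inversions_def)
    qed
    then have "card (inversions v) < card (inversions u)"
      using psubset_card_mono finite_inversions[OF uc] by blast
    moreover have "supp_of y' \<subseteq> J"
      using edge_swap[OF edge, of t] tS e(1) Jt(2) by (metis arrow_sel insert_subset)
    ultimately obtain p where p: "arrow_path (edges_within J) y' p z" "path_elt p = v" "reduced p"
      using less.hyps[of v y'] y'(1) z J v by blast
    have "inv e \<otimes> v = u" using ec uc by (simp add: v_def m_assoc[symmetric])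
    then show ?thesis using p flip_edge[OF edge] vu
      by (intro exI[of _ "flip (y', e, y) # p"]) simp
  qed
qed

text \<open>A loop is the reflection in an orthogonal root. Pulled back to z, this root is inverted
  just after the loop if it is positive, and otherwise its negative is inverted just before the
  loop. Inversions persist along a reduced path, so the whole element would invert a positive root
  orthogonal to the labels of z.\<close>

lemma reduced_Y_nonloop:
  assumes p: "arrow_path (edges_within J) y p z" "reduced p" and z: "z \<in> vertices"
    and Y: "path_elt p \<in> Y_hom y z"
  shows "\<forall>e \<in> set p. tgt e \<noteq> src e"
proof (intro ballI notI)
  fix e assume e: "e \<in> set p" "tgt e = src e"
  then obtain p1 p2 where p12: "p = p1 @ e # p2" by (metis split_list)
  then have pp: "e \<in> edges_within J" "arrow_path (edges_within J) (src e) p2 z" using p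
    by (auto simp: arrow_path_append)
  obtain \<gamma> where g: "\<gamma> \<in> pos_roots" "orth (supp_of (src e)) \<gamma>" "elt e = root_refl \<gamma>"
    using loop_root[OF pp(1) e(2)] by metis
  define q where "q = path_elt p2"
  have q: "q \<in> C_hom (src e) z" "src e \<in> vertices" "q \<in> carrier G"
    using path_C[OF pp(2) z] C_hom_carrier by (auto simp: q_def)
  have gr: "\<gamma> \<in> roots" "\<gamma> \<in> V" using g pos_root root_V by auto
  define \<delta> where "\<delta> = act (inv q) \<gamma>"
  have d: "\<delta> \<in> roots" "\<delta> \<in> V" "orth (supp_of z) \<delta>" "act q \<delta> = \<gamma>"
    using q gr act_root act_V C_hom_orth[OF C_hom_inv[OF q(1) z] q(2) gr(2) g(2)]
    by (auto simp: \<delta>_def)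
  have inc: "inversions (elt e \<otimes> q) \<subseteq> inversions (path_elt p)"
    "inversions q \<subseteq> inversions (path_elt p)"
    using reduced_append[of p1 "e # p2"] reduced_append[of "p1 @ [e]" p2] p p12
    by (auto simp: q_def)
  have notin: "\<beta> \<notin> inversions (path_elt p)" if "orth (supp_of z) \<beta>" for \<beta>
    using Y_hom_pos[OF Y] that by (auto simp: inversions_def)
  show False
  proof (cases "\<delta> \<in> pos_roots")
    case True
    have "act (elt e \<otimes> q) \<delta> = (\<lambda>r. - \<gamma> r)" using d q g gr root_refl_self by (simp add: act_mult)
    then have "\<delta> \<in> inversions (elt e \<otimes> q)" using True g pos_not_neg by (simp add: inversions_def)
    then show False using inc notin d by blast
  next
    case False
    then have n: "(\<lambda>r. - \<delta> r) \<in> pos_roots" using not_pos_iff d by blast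
    have "act q (\<lambda>r. - \<delta> r) = (\<lambda>r. - \<gamma> r)" using act_uminus q d by simp
    then have "(\<lambda>r. - \<delta> r) \<in> inversions q" using n g pos_not_neg by (simp add: inversions_def)
    moreover have "orth (supp_of z) (\<lambda>r. - \<delta> r)"
      using orth_uminus[OF supp_of_S[OF z] d(2,3)] .
    ultimately show False using inc notin by blast
  qed
qed

end

section \<open>Trees\<close>

lemma not_successively_split:
  "\<not> successively P xs \<Longrightarrow> \<exists>ys a b zs. xs = ys @ a # b # zs \<and> \<not> P a b"
proof (induction xs)
  case (Cons x xs)
  show ?case
  proof (cases "successively P xs")
    case True
    then obtain b zs where "xs = b # zs" "\<not> P x b" using Cons.prems by (cases xs) auto
    then show ?thesis by (intro exI[of _ "[]"]) auto
  next
    case False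
    then obtain ys a b zs where "xs = ys @ a # b # zs" "\<not> P a b" using Cons.IH by blast
    then show ?thesis by (intro exI[of _ "x # ys"]) auto
  qed
qed simp

lemma arrow_path_vertices: "arrow_path E y q z \<Longrightarrow> y # map src q = map tgt q @ [z]"
  by (induction q arbitrary: y) auto

lemma arrow_path_exit: "arrow_path E z p y \<Longrightarrow> y \<in> A \<Longrightarrow> z \<notin> A \<Longrightarrow> \<exists>e \<in> E. src e \<in> A \<and> tgt e \<notin> A"
  by (induction p arbitrary: z) auto

lemma arrow_path_closed:
  assumes "\<And>e. e \<in> E \<Longrightarrow> src e \<in> A \<Longrightarrow> tgt e \<in> A"
  shows "arrow_path E z p y \<Longrightarrow> y \<in> A \<Longrightarrow> z \<in> A"
  using assms by (induction p arbitrary: z) auto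

lemma arrow_path_filter:
  "arrow_path E z p y \<Longrightarrow> arrow_path {e \<in> E. tgt e \<noteq> src e} z (filter (\<lambda>e. tgt e \<noteq> src e) p) y"
  by (induction p arbitrary: z) auto

context coxeter_groupoid begin

lemma nonloop_edges_edges: "nonloop_edges \<subseteq> edges"
  by (auto simp: nonloop_edges_def)

lemma flip_nonloop: "e \<in> nonloop_edges \<Longrightarrow> flip e \<in> nonloop_edges"
  using flip_edge by (auto simp: nonloop_edges_def)

lemma nonbacktracking_inv:
  "set p \<subseteq> edges \<Longrightarrow> nonbacktracking p \<Longrightarrow> nonbacktracking (inv_path p)"
proof (induction p)
  case (Cons e p)
  then have IH: "nonbacktracking (inv_path p)" by (cases p) (auto simp: nonbacktracking_def)
  have "last (inv_path p) \<noteq> flip (flip e)" if "p \<noteq> []"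
  proof -
    obtain f q where p: "p = f # q" using \<open>p \<noteq> []\<close> by (cases p) auto
    then have "e \<noteq> flip f" "flip (flip e) = e" using Cons.prems flip_flip[of e S]
      by (auto simp: nonbacktracking_def)
    then show ?thesis using p by simp
  qed
  then show ?case using IH by (auto simp: nonbacktracking_def successively_append_iff inv_path_def)
qed (simp add: nonbacktracking_def)

lemma nonbacktracking_exists:
  assumes "E \<subseteq> edges" "arrow_path E z p y"
  shows "\<exists>q. arrow_path E z q y \<and> nonbacktracking q"
  using assms(2)
proof (induction "length p" arbitrary: p rule: less_induct)
  case less
  show ?case
  proof (cases "nonbacktracking p")
    case False
    then obtain p1 e f p2 where p: "p = p1 @ e # f # p2" "e = flip f"
      using not_successively_split unfolding nonbacktracking_def by blast
    then have "arrow_path E z (p1 @ p2) y" using less.prems by (auto simp: arrow_path_append)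
    then show ?thesis using less.hyps[of "p1 @ p2"] p by simp
  qed (use less in blast)
qed

text \<open>Common edges at the target end are stripped. Where the paths first differ, the inverse
  of one joined to the other does not backtrack and would be a circuit.\<close>

lemma subtree_path_unique:
  assumes T: "subtree TV TE"
  shows "arrow_path TE z p y \<Longrightarrow> arrow_path TE z q y \<Longrightarrow> nonbacktracking p \<Longrightarrow> nonbacktracking q \<Longrightarrow> p = q"
proof (induction p arbitrary: z q)
  have TE: "TE \<subseteq> edges" "\<And>e. e \<in> TE \<Longrightarrow> flip e \<in> TE" using T nonloop_edges_edges
    by (auto simp: subtree_def)
  have nocirc: "r = []" if "arrow_path TE v r v" "nonbacktracking r" for v r using T that
    unfolding subtree_def by blast
  {
    case Nil
    then show ?case using nocirc[of y q] by auto
  next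
    case (Cons e p)
    show ?case
    proof (cases q)
      case Nil
      then show ?thesis using Cons.prems nocirc[of y "e # p"] by auto
    next
      case q: (Cons f q')
      show ?thesis
      proof (cases "e = f")
        case True
        have "nonbacktracking p" "nonbacktracking q'" using Cons.prems q
          by (auto simp: nonbacktracking_def successively_Cons)
        moreover have "arrow_path TE (src f) p y" "arrow_path TE (src f) q' y"
          using Cons.prems True q by auto
        ultimately show ?thesis using Cons.IH True q by blast
      next
        case False
        have se: "set (e # p) \<subseteq> edges" using arrow_path_set[OF Cons.prems(1)] TE by blast
        have fe: "e \<in> edges" "f \<in> edges" using se Cons.prems(2) q TE by auto
        have "flip e \<noteq> flip f" using False flip_flip[OF fe(1)] flip_flip[OF fe(2)] by metis
        then have "nonbacktracking (inv_path (e # p) @ q)"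
          using nonbacktracking_inv[OF se Cons.prems(3)] Cons.prems(4) q
          by (auto simp: nonbacktracking_def successively_append_iff)
        moreover have "arrow_path TE y (inv_path (e # p) @ q) y"
          using arrow_path_inv[OF TE(2) Cons.prems(1)] Cons.prems(2) unfolding arrow_path_append
          by blast
        ultimately have "inv_path (e # p) @ q = []" using nocirc by blast
        then show ?thesis using q by simp
      qed
    qed
  }
qed

lemma nonloop_connected:
  assumes "x \<in> vertices" "y \<in> vertices"
  shows "\<exists>p. arrow_path nonloop_edges x p y"
proof -
  obtain w where w: "w \<in> C_hom x y" using vertices_connected assms by blast
  then have "w \<in> generate G S" using C_hom_carrier gens_generate by simp
  then obtain p where "arrow_path edges x p y"
    using reduced_path_exists[OF assms supp_of_S[OF assms(1)] order_refl w] by blast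
  then show ?thesis using arrow_path_filter[of edges x p y] by (auto simp: nonloop_edges_def)
qed

text \<open>The new vertex is a leaf, with \<open>e\<close> as the only edge into it and
  \<open>flip e\<close> as the only edge out of it.\<close>

lemma subtree_extend:
  assumes T: "subtree TV TE" and e: "e \<in> nonloop_edges" "src e \<in> TV" "tgt e \<notin> TV"
  shows "subtree (insert (tgt e) TV) (TE \<union> {e, flip e})"
proof -
  let ?z = "tgt e" and ?E = "TE \<union> {e, flip e}" and ?V = "insert (tgt e) TV"
  have TE: "TE \<subseteq> edges" "\<And>e. e \<in> TE \<Longrightarrow> flip e \<in> TE" "\<And>e. e \<in> TE \<Longrightarrow> src e \<in> TV \<and> tgt e \<in> TV"
    "TE \<subseteq> nonloop_edges" "TV \<subseteq> vertices"
    using T nonloop_edges_edges by (auto simp: subtree_def)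
  have ee: "e \<in> edges" "flip (flip e) = e" using e nonloop_edges_edges flip_flip[of e S] by auto
  have nocirc: "r = []" if "arrow_path TE v r v" "nonbacktracking r" for v r using T that
    unfolding subtree_def by blast
  have E: "\<And>f. f \<in> ?E \<Longrightarrow> tgt f = ?z \<Longrightarrow> f = e" "\<And>f. f \<in> ?E \<Longrightarrow> src f = ?z \<Longrightarrow> f = flip e"
    using TE(3) e by auto
  text \<open>A nonbacktracking path through the new vertex starts or ends there.\<close>
  have inT: "set r \<subseteq> TE" if r: "arrow_path ?E a r b" "nonbacktracking r" "a \<noteq> ?z" "b \<noteq> ?z" for a b r
  proof
    fix f assume f: "f \<in> set r"
    have fE: "f \<in> ?E" using arrow_path_set[OF r(1)] f by blast
    obtain r1 r2 where r12: "r = r1 @ f # r2" using f by (metis split_list)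
    show "f \<in> TE"
    proof (rule ccontr)
      assume "f \<notin> TE"
      then consider "f = e" | "f = flip e" using fE by blast
      then show False
      proof cases
        case 1
        then have "r1 \<noteq> []" using r r12 by auto
        then obtain r0 h where h: "r1 = r0 @ [h]" by (cases r1 rule: rev_cases) auto
        have "h \<in> ?E" "src h = ?z" using r(1) unfolding r12 h 1 by (auto simp: arrow_path_append)
        then have "h = flip e" using E by blast
        then show False using r(2) r12 h 1
          by (auto simp: nonbacktracking_def successively_append_iff)
      next
        case 2
        show False
        proof (cases r2)
          case Nil
          then show False using r r12 2 by (auto simp: arrow_path_append)
        next
          case (Cons h r3)
          have "h \<in> ?E" "tgt h = ?z" using r(1) unfolding r12 Cons 2
            by (auto simp: arrow_path_append)
          then have "h = e" using E by blast
          then show False using r(2) r12 Cons 2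
            by (auto simp: nonbacktracking_def successively_append_iff)
        qed
      qed
    qed
  qed
  have circ: "r = []" if r: "arrow_path ?E a r a" "nonbacktracking r" for a r
  proof (cases "a = ?z")
    case False
    then show ?thesis using inT[OF r False False] arrow_path_mono[OF r(1)] nocirc r(2) by blast
  next
    case True
    show ?thesis
    proof (rule ccontr)
      assume "r \<noteq> []"
      \<comment> \<open>A circuit at the new vertex has \<open>e\<close> at its end and the reverse
        of \<open>e\<close> at its start. What lies between is a circuit in the old tree, hence
        empty, and then the two edges backtrack.\<close>
      then obtain f r1 where f: "r = f # r1" by (cases r) auto
      then have "f \<in> ?E" "tgt f = ?z" using r(1) True by simp_all
      then have "f = e" using E(1) by blast
      moreover have "src e \<noteq> ?z" using e by auto
      ultimately have "r1 \<noteq> []" using r(1) f True by auto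
      then obtain m h where h: "r1 = m @ [h]" by (cases r1 rule: rev_cases) auto
      then have "h \<in> ?E" "src h = ?z" using r(1) f True by (auto simp: arrow_path_append)
      then have "h = flip e" using E by blast
      then have m: "arrow_path ?E (src e) m (src e)" "nonbacktracking m"
        using r f h \<open>f = e\<close>
        by (auto simp: arrow_path_append nonbacktracking_def successively_append_iff successively_Cons)
      have "set m \<subseteq> TE" using inT[OF m] \<open>src e \<noteq> ?z\<close> by blast
      then have "m = []" using nocirc arrow_path_mono[OF m(1)] m(2) by blast
      then show False using r(2) f h \<open>f = e\<close> \<open>h = flip e\<close> ee by (simp add: nonbacktracking_def)
    qed
  qed
  have conn: "\<exists>p. arrow_path ?E b p a" if "a \<in> ?V" "b \<in> ?V" for a b
  proof -
    have "\<forall>u\<in>TV. \<forall>v\<in>TV. \<exists>p. arrow_path TE v p u" using T unfolding subtree_def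
      by (elim conjE) assumption
    then have Tc: "\<exists>p. arrow_path ?E v p u" if "u \<in> TV" "v \<in> TV" for u v
    proof -
      obtain p where p: "arrow_path TE v p u"
        using \<open>\<forall>u\<in>TV. \<forall>v\<in>TV. \<exists>p. arrow_path TE v p u\<close> \<open>u \<in> TV\<close> \<open>v \<in> TV\<close> by meson
      have "set p \<subseteq> ?E" using arrow_path_set[OF p] by (rule le_supI1)
      then show ?thesis using arrow_path_mono[OF p] by meson
    qed
    have pto: "\<exists>p. arrow_path ?E (src e) p a"
    proof (cases "a = ?z")
      case True
      then show ?thesis by (intro exI[of _ "[flip e]"]) simp
    qed (use that Tc e in blast)
    have pfrom: "\<exists>p. arrow_path ?E b p (src e)"
    proof (cases "b = ?z")
      case True
      then show ?thesis by (intro exI[of _ "[e]"]) simp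
    qed (use that Tc e in blast)
    show ?thesis using pto pfrom arrow_path_append by metis
  qed
  show ?thesis unfolding subtree_def
  proof (intro conjI)
    show "?V \<subseteq> vertices" using TE edge_tgt[OF ee(1)] by blast
    show "?E \<subseteq> nonloop_edges" using TE e flip_nonloop by blast
    show "flip ` ?E \<subseteq> ?E" using TE ee by auto
    show "\<forall>f\<in>?E. src f \<in> ?V \<and> tgt f \<in> ?V" using TE(3) e by auto
    show "\<nexists>a r. r \<noteq> [] \<and> arrow_path ?E a r a \<and> nonbacktracking r" using circ by blast
  qed (use conn in blast)+
qed

text \<open>By connectedness a nonloop edge would leave a smaller vertex set, and the tree could be
  extended by it.\<close>

lemma maximal_tree_spanning:
  assumes "maximal_tree TV TE"
  shows "TV = vertices"
proof (rule ccontr)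
  assume n: "TV \<noteq> vertices"
  have T: "subtree TV TE" using assms by (simp add: maximal_tree_def)
  then obtain a b where ab: "a \<in> TV" "b \<in> vertices" "b \<notin> TV" "a \<in> vertices" using n
    by (auto simp: subtree_def)
  obtain p where "arrow_path nonloop_edges b p a" using nonloop_connected ab by blast
  then obtain e where e: "e \<in> nonloop_edges" "src e \<in> TV" "tgt e \<notin> TV" using arrow_path_exit ab
    by meson
  have "insert (tgt e) TV = TV" using assms subtree_extend[OF T e] unfolding maximal_tree_def
    by blast
  then show False using e by blast
qed

lemma tree_path:
  assumes T: "maximal_tree TV TE" and xy: "x \<in> vertices" "y \<in> vertices"
  shows "arrow_path TE x (tree_path TE x y) y" "nonbacktracking (tree_path TE x y)"
proof -
  have S: "subtree TV TE" "TV = vertices" using T maximal_tree_spanning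
    by (auto simp: maximal_tree_def)
  then have TE: "TE \<subseteq> edges" using nonloop_edges_edges by (auto simp: subtree_def)
  obtain p where "arrow_path TE x p y" using S xy unfolding subtree_def by blast
  then have "\<exists>!q. arrow_path TE x q y \<and> nonbacktracking q"
    using nonbacktracking_exists[OF TE] subtree_path_unique[OF S(1)] by metis
  from theI'[OF this] show "arrow_path TE x (tree_path TE x y) y"
    "nonbacktracking (tree_path TE x y)"
    unfolding tree_path_def by blast+
qed

text \<open>Tree edges are not loops, so tree paths represent elements of Y; uniqueness makes the
  path in the opposite direction the inverse one.\<close>

lemma tree_elt:
  assumes T: "maximal_tree TV TE" and xy: "x \<in> vertices" "y \<in> vertices"
  shows "path_elt (tree_path TE x y) \<in> Y_hom x y" "set (tree_path TE x y) \<subseteq> edges"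
    "path_elt (tree_path TE y x) = inv (path_elt (tree_path TE x y))"
proof -
  have S: "subtree TV TE" using T by (auto simp: maximal_tree_def)
  then have TE: "TE \<subseteq> nonloop_edges" "\<And>e. e \<in> TE \<Longrightarrow> flip e \<in> TE" by (auto simp: subtree_def)
  note p = tree_path[OF T xy]
  have s: "set (tree_path TE x y) \<subseteq> nonloop_edges" using arrow_path_set[OF p(1)] TE by blast
  then show se: "set (tree_path TE x y) \<subseteq> edges" using nonloop_edges_edges by blast
  have pe: "arrow_path edges x (tree_path TE x y) y" using arrow_path_mono[OF p(1) se] .
  show "path_elt (tree_path TE x y) \<in> Y_hom x y"
    using path_Y[OF pe xy(2)] s by (auto simp: nonloop_edges_def)
  have "tree_path TE y x = inv_path (tree_path TE x y)"
    using subtree_path_unique[OF S tree_path(1)[OF T xy(2,1)] arrow_path_inv[OF TE(2) p(1)] tree_path(2)[OF T xy(2,1)]]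
      nonbacktracking_inv[OF se p(2)] by blast
  then show "path_elt (tree_path TE y x) = inv (path_elt (tree_path TE x y))"
    using path_elt_inv[OF se] by simp
qed

section \<open>Rank two components\<close>

text \<open>The finiteness condition stands in for finite type of the components meeting s and t. It
  refers to J and y only, which lets it be carried along edges.\<close>

definition rank_two :: "'a set \<Rightarrow> ('l \<Rightarrow> 'a) \<Rightarrow> bool" where
  "rank_two J y \<longleftrightarrow> J \<subseteq> S \<and> y \<in> vertices \<and> finite (rel_roots J (supp_of y)) \<and>
     (\<exists>s t. s \<noteq> t \<and> s \<notin> supp_of y \<and> t \<notin> supp_of y \<and> J = insert s (insert t (supp_of y)))"

text \<open>The edge lies in the parabolic subgroup of J and identifies the spans of the labels at
  its ends, hence also the roots on J outside these spans.\<close>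

lemma rank_two_edge:
  assumes e: "e \<in> edges_within J" and r: "rank_two J (src e)"
  shows "rank_two J (tgt e)"
proof -
  have J: "J \<subseteq> S" using r by (simp add: rank_two_def)
  note ef = edge_facts[OF e]
  obtain s where s: "s \<in> S" "s \<notin> supp_of (src e)" "insert s (supp_of (src e)) \<subseteq> J"
    "elt e \<in> generate G (insert s (supp_of (src e)))"
    using e by (elim edgeE) auto
  obtain s' where s': "s' \<in> S" "s' \<notin> supp_of (tgt e)"
    "insert s (supp_of (src e)) = insert s' (supp_of (tgt e))"
    using edge_swap[OF e s(1,2,4)] by blast
  obtain a b where ab: "a \<noteq> b" "a \<notin> supp_of (src e)" "b \<notin> supp_of (src e)"
    "J = insert a (insert b (supp_of (src e)))"
    using r by (auto simp: rank_two_def)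
  obtain t where t: "t \<noteq> s" "t \<notin> supp_of (src e)" "J = insert t (insert s (supp_of (src e)))"
  proof (cases "s = a")
    case True
    then show ?thesis using that[of b] ab by auto
  next
    case False
    then have "s = b" using s ab by auto
    then show ?thesis using that[of a] ab by auto
  qed
  have J': "J = insert t (insert s' (supp_of (tgt e)))" using t(3) s'(3) by simp
  have "t \<notin> insert s (supp_of (src e))" using t by simp
  then have t': "t \<notin> supp_of (tgt e)" "t \<noteq> s'" unfolding s'(3) by auto
  have "rel_roots J (supp_of (tgt e)) \<subseteq> act (elt e) ` rel_roots J (supp_of (src e))"
  proof
    fix \<beta> assume b: "\<beta> \<in> rel_roots J (supp_of (tgt e))"
    then have bV: "\<beta> \<in> roots_on J" "\<beta> \<in> V" "\<beta> \<in> roots" using root_V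
      by (auto simp: rel_roots_def roots_on_def)
    have i: "inv (elt e) \<in> generate G J" using generate_m_inv_closed[of J "elt e"] ef J gens_carrier
      by auto
    define \<gamma> where "\<gamma> = act (inv (elt e)) \<beta>"
    have g: "\<gamma> \<in> roots_on J" using roots_on_act[OF J i bV(1)] by (simp add: \<gamma>_def)
    have bg: "\<beta> = act (elt e) \<gamma>" using ef bV by (simp add: \<gamma>_def)
    have "\<not> supp \<gamma> \<subseteq> supp_of (src e)"
    proof
      assume "supp \<gamma> \<subseteq> supp_of (src e)"
      then have "\<gamma> \<in> span_on (supp_of (src e))" using roots_on_span[OF g] by (simp add: span_on_def)
      then have "\<beta> \<in> span_on (supp_of (tgt e))"
        using simple_img_span[OF ef(4) supp_of_S[OF ef(1)] C_hom_simple_map(1)[OF ef(3,2)]] C_hom_simple_map(2)[OF ef(3,2)] bg by simp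
      then show False using b by (simp add: rel_roots_def span_on_def)
    qed
    then show "\<beta> \<in> act (elt e) ` rel_roots J (supp_of (src e))" using g bg
      by (auto simp: rel_roots_def)
  qed
  then have "finite (rel_roots J (supp_of (tgt e)))" using r finite_subset
    by (auto simp: rank_two_def)
  then show ?thesis unfolding rank_two_def using J ef J' t' s' by blast
qed

lemma rank_two_path:
  "arrow_path (edges_within J) z p y \<Longrightarrow> rank_two J y \<Longrightarrow> rank_two J z"
  using rank_two_edge by (induction p arbitrary: z) auto

lemma rank_one_edge_exists:
  assumes y: "y \<in> vertices" and s: "s \<in> S" "s \<notin> supp_of y" "insert s (supp_of y) \<subseteq> J"
    and f: "finite (rel_roots (insert s (supp_of y)) (supp_of y))"
  shows "\<exists>z \<in> vertices. (z, rstep (supp_of y) s, y) \<in> edges_within J \<and> rstep (supp_of y) s \<in> C_hom z y"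
proof -
  have ft: "finite_type (comps_meeting (supp_of y) {s})"
    using finite_type_comps[of "supp_of y" "{s}"] supp_of_S[OF y] s f by auto
  note p = rstep_props[OF supp_of_S[OF y] s(1,2) ft]
  have "rstep (supp_of y) s \<in> carrier G" using generate_subset_carrier[OF _ p(1)] supp_of_S[OF y] s
    by auto
  then obtain z where z: "z \<in> vertices" "rstep (supp_of y) s \<in> C_hom z y"
    using vertex_image[OF y _ p(2)] by blast
  then show ?thesis using edgeI[OF y z(1) s(1,2) z(2) p(1,3) s(3)] by blast
qed

lemma rel_roots_mono: "K \<subseteq> J \<Longrightarrow> rel_roots K A \<subseteq> rel_roots J A"
  by (auto simp: rel_roots_def roots_on_def)

text \<open>There is one edge for each further index. The two differ because the root of s is an
  inversion of the first but not of the second.\<close>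

lemma rank_two_out:
  assumes r: "rank_two J y"
  shows "\<exists>a b. a \<noteq> b \<and> {e \<in> edges_within J. src e = y} = {a, b}"
proof -
  obtain s t where st: "s \<noteq> t" "s \<notin> supp_of y" "t \<notin> supp_of y" "J = insert s (insert t (supp_of y))"
    using r by (auto simp: rank_two_def)
  have J: "J \<subseteq> S" "y \<in> vertices" "finite (rel_roots J (supp_of y))" using r
    by (auto simp: rank_two_def)
  have sJ: "s \<in> S" "t \<in> S" "insert s (supp_of y) \<subseteq> J" "insert t (supp_of y) \<subseteq> J" using J st by auto
  have fin: "finite (rel_roots (insert s (supp_of y)) (supp_of y))"
    "finite (rel_roots (insert t (supp_of y)) (supp_of y))"
    using J(3) rel_roots_mono sJ finite_subset by meson+
  obtain z where z: "z \<in> vertices" "(z, rstep (supp_of y) s, y) \<in> edges_within J"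
    "rstep (supp_of y) s \<in> C_hom z y"
    using rank_one_edge_exists[OF J(2) sJ(1) st(2) sJ(3) fin(1)] by blast
  obtain w where w: "w \<in> vertices" "(w, rstep (supp_of y) t, y) \<in> edges_within J"
    "rstep (supp_of y) t \<in> C_hom w y"
    using rank_one_edge_exists[OF J(2) sJ(2) st(3) sJ(4) fin(2)] by blast
  have "rstep (supp_of y) s \<noteq> rstep (supp_of y) t"
  proof
    assume e: "rstep (supp_of y) s = rstep (supp_of y) t"
    have ft: "finite_type (comps_meeting (supp_of y) {s})"
      "finite_type (comps_meeting (supp_of y) {t})"
      using finite_type_comps[of "supp_of y" "{s}"] finite_type_comps[of "supp_of y"
      "{t}"] supp_of_S[OF J(2)] sJ st fin by auto
    note ps = rstep_props[OF supp_of_S[OF J(2)] sJ(1) st(2) ft(1)]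
      and pt = rstep_props[OF supp_of_S[OF J(2)] sJ(2) st(3) ft(2)]
    have eq: "rel_roots (insert s (supp_of y)) (supp_of y) \<inter> pos_roots = rel_roots (insert t (supp_of y)) (supp_of y) \<inter> pos_roots"
      using inversions_rank_one[OF supp_of_S[OF J(2)] sJ(1) ps] inversions_rank_one[OF supp_of_S[OF J(2)] sJ(2) pt] e by simp
    have "simple_root s \<in> rel_roots (insert s (supp_of y)) (supp_of y) \<inter> pos_roots"
      using sJ st simple_root_root simple_root_pos by (auto simp: rel_roots_def roots_on_def)
    then have "simple_root s \<in> rel_roots (insert t (supp_of y)) (supp_of y)" unfolding eq by simp
    then show False using st by (auto simp: rel_roots_def roots_on_def)
  qed
  moreover have "{e \<in> edges_within J. src e = y} = {(z, rstep (supp_of y) s, y), (w, rstep (supp_of y) t, y)}"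
  proof
    show "{e \<in> edges_within J. src e = y} \<subseteq> {(z, rstep (supp_of y) s, y), (w, rstep (supp_of y) t, y)}"
    proof
      fix e assume "e \<in> {e \<in> edges_within J. src e = y}"
      then have e: "e \<in> edges_within J" "src e = y" by auto
      from e(1) obtain r where r: "tgt e \<in> vertices" "elt e \<in> C_hom (tgt e) y" "r \<notin> supp_of y"
        "insert r (supp_of y) \<subseteq> J"
        "elt e = rstep (supp_of y) r" by (elim edgeE) (use e in auto)
      then have "r = s \<or> r = t" using st by auto
      then show "e \<in> {(z, rstep (supp_of y) s, y), (w, rstep (supp_of y) t, y)}"
      proof
        assume "r = s"
        then have "elt e \<in> C_hom z y" using r(5) z(3) by simp
        then have "tgt e = z" using C_hom_tgt_unique[OF r(2) _ r(1) z(1)] by simp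
        then have "e = (z, rstep (supp_of y) s, y)" using r(5) e(2) unfolding \<open>r = s\<close>
          by (intro arrow_eqI) simp_all
        then show ?thesis by simp
      next
        assume "r = t"
        then have "elt e \<in> C_hom w y" using r(5) w(3) by simp
        then have "tgt e = w" using C_hom_tgt_unique[OF r(2) _ r(1) w(1)] by simp
        then have "e = (w, rstep (supp_of y) t, y)" using r(5) e(2) unfolding \<open>r = t\<close>
          by (intro arrow_eqI) simp_all
        then show ?thesis by simp
      qed
    qed
  qed (use z w in auto)
  ultimately show ?thesis by blast
qed

lemma out_pair:
  assumes "rank_two J y" "a \<in> edges_within J" "b \<in> edges_within J" "src a = y" "src b = y" "a \<noteq> b"
    "e \<in> edges_within J" "src e = y"
  shows "e = a \<or> e = b"
proof -
  obtain c d where "{e \<in> edges_within J. src e = y} = {c, d}" using rank_two_out[OF assms(1)]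
    by blast
  then have "a \<in> {c, d}" "b \<in> {c, d}" "e \<in> {c, d}" using assms by blast+
  then show ?thesis using assms(6) by auto
qed

text \<open>A backtracking pair would restore an earlier element, against the strict growth of the
  inversion sets.\<close>

lemma reduced_nonbacktracking:
  "set p \<subseteq> edges \<Longrightarrow> reduced p \<Longrightarrow> nonbacktracking p"
proof (induction p)
  case (Cons e p)
  show ?case
  proof (cases p)
    case Nil
    then show ?thesis by (simp add: nonbacktracking_def)
  next
    case p: (Cons f q)
    have c: "f \<in> edges" "elt f \<in> carrier G" "path_elt q \<in> carrier G"
      using Cons.prems p edge_carrier[of f S] path_elt_carrier[of q] by auto
    have "e \<noteq> flip f"
    proof
      assume "e = flip f"
      then have "path_elt (e # p) = path_elt q" using p c by (simp flip: m_assoc)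
      then show False using Cons.prems p by auto
    qed
    then show ?thesis using Cons p by (simp add: nonbacktracking_def)
  qed
qed (simp add: nonbacktracking_def)

text \<open>A nonbacktracking walk from loop to loop runs through pairwise distinct vertices and exhausts
  their edges, because two edges issue from each vertex of a rank two component.\<close>

lemma simple_walk:
  assumes r2: "rank_two J y" and q: "arrow_path (edges_within J) y q z"
    and e1: "e1 \<in> edges_within J" "tgt e1 = y" "src e1 = y" and e2: "e2 \<in> edges_within J"
      "tgt e2 = z" "src e2 = z"
    and nb: "nonbacktracking (e1 # q @ [e2])" and nl: "\<forall>e \<in> set q. tgt e \<noteq> src e"
  shows simple_walk_distinct: "distinct (y # map src q)"
    and simple_walk_closed: "\<And>e. e \<in> edges_within J \<Longrightarrow> src e \<in> set (y # map src q) \<Longrightarrow> e \<in> set q \<union> flip ` set q \<union> {e1, e2}"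
    and simple_walk_loops: "e1 \<noteq> e2"
proof -
  \<comment> \<open>Positions count from the target y: \<open>l ! i\<close> leaves the vertex
    \<open>a i\<close>, and \<open>l ! Suc i\<close> arrives there. The two loops are included so
    that this holds at the ends as well.\<close>
  define n l a where "n = length q" and "l = e1 # q @ [e2]" and "a = (\<lambda>i. (y # map src q) ! i)"
  have f2: "flip e2 = e2" using loop_inv(2)[OF e2(1)] e2 by simp
  have srcl: "src (l ! i) = a i" if "i \<le> n" for i
    using that e1 by (cases i) (auto simp: l_def a_def n_def nth_append)
  have tgtl: "tgt (l ! Suc i) = a i" if "i \<le> n" for i
    using that e2 unfolding a_def arrow_path_vertices[OF q]
    by (auto simp: l_def n_def nth_append less_Suc_eq_le)
  have "set l \<subseteq> edges_within J" using e1 e2 arrow_path_set[OF q] by (auto simp: l_def)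
  moreover have ll: "length l = Suc (Suc n)" by (simp add: l_def n_def)
  ultimately have lE: "l ! i \<in> edges_within J" if "i \<le> Suc n" for i
    using nth_mem[of i l] that by auto
  have lq: "l ! i \<in> set q" if "0 < i" "i \<le> n" for i
    using that by (cases i) (auto simp: l_def n_def nth_append)
  have lnl: "tgt (l ! i) \<noteq> src (l ! i)" if "0 < i" "i \<le> n" for i using lq[OF that] nl by blast
  have r2a: "rank_two J (a i)" if "i \<le> n" for i using that
  proof (induction i)
    case 0
    then show ?case using r2 by (simp add: a_def)
  next
    case (Suc i)
    have "rank_two J (tgt (flip (l ! Suc i)))"
      using Suc tgtl[of i] by (intro rank_two_edge[OF flip_edge[OF lE]]) auto
    then show ?case using srcl Suc by simp
  qed
  have nbl: "l ! i \<noteq> flip (l ! Suc i)" if "i \<le> n" for i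
    using nb that ll unfolding nonbacktracking_def l_def[symmetric] successively_conv_nth by auto
  have out: "e = l ! i \<or> e = flip (l ! Suc i)" if "i \<le> n" "e \<in> edges_within J" "src e = a i" for i e
    using that srcl tgtl nbl lE flip_edge[OF lE] by (intro out_pair[OF r2a]) auto
  have dist: "\<forall>i<j. a i \<noteq> a j" if "j \<le> n" for j using that
  proof (induction j rule: less_induct)
    case (less j)
    have IH: "a i \<noteq> a k" if "i < k" "k < j" for i k using less.IH[of k] that less.prems by auto
    show ?case
    proof (intro allI impI notI)
      fix i assume i: "i < j" and eq: "a i = a j"
      have j: "0 < j" "j \<le> n" using i less.prems by auto
      have tj: "tgt (l ! j) = a (j - 1)" using tgtl[of "j - 1"] j by simp
      \<comment> \<open>At a first repetition the edge leaving \<open>a j\<close> is one of the two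
        edges leaving \<open>a i\<close>. Either case yields an earlier repetition, a backtracking
        pair or a loop inside the walk.\<close>
      have "l ! j = l ! i \<or> l ! j = flip (l ! Suc i)" using out[of i "l ! j"] i j srcl lE eq by auto
      then show False
      proof
        assume e: "l ! j = l ! i"
        show False
        proof (cases i)
          case 0
          then show False using e lnl[OF j] e1 by (simp add: l_def)
        next
          case (Suc k)
          then have t: "tgt (l ! i) = a k" using tgtl[of k] i j by simp
          have "k < j - 1" "j - 1 < j" using Suc i by linarith+
          then show False using e tj t IH[of k "j - 1"] by metis
        qed
      next
        assume e: "l ! j = flip (l ! Suc i)"
        then have t: "a (j - 1) = a (Suc i)" using tj srcl[of "Suc i"] i j by simp
        consider "Suc i < j - 1" | "Suc i = j - 1" | "Suc i = j" using i by linarith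
        then show False
        proof cases
          case 1
          then show False using t IH[of "Suc i" "j - 1"] j by simp
        next
          case 2
          then have "flip (l ! j) = l ! (j - 1)" using e flip_flip[OF lE, of "j - 1"] j by simp
          moreover have "Suc (j - 1) = j" "j - 1 \<le> n" using j by auto
          ultimately show False using nbl[of "j - 1"] by metis
        next
          case 3
          then have "l ! j = flip (l ! j)" using e by simp
          then have "tgt (l ! j) = src (l ! j)" by (metis flip_sel(1))
          then show False using lnl[OF j] by simp
        qed
      qed
    qed
  qed
  have len: "length (y # map src q) = Suc n" by (simp add: n_def)
  show d: "distinct (y # map src q)" unfolding distinct_conv_nth len
  proof (intro allI impI)
    fix i j assume ij: "i < Suc n" "j < Suc n" "i \<noteq> j"
    then show "(y # map src q) ! i \<noteq> (y # map src q) ! j"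
      using dist[of i] dist[of j] unfolding a_def by (cases i j rule: linorder_cases) auto
  qed
  show "e \<in> set q \<union> flip ` set q \<union> {e1, e2}" if eE: "e \<in> edges_within J"
    and sE: "src e \<in> set (y # map src q)" for e
  proof -
    obtain i where i: "i < Suc n" "src e = a i" using sE len unfolding a_def in_set_conv_nth
      by metis
    then consider "e = l ! i" | "e = flip (l ! Suc i)" using out[of i e] eE by auto
    then show ?thesis
    proof cases
      case 1
      then show ?thesis using lq[of i] i by (cases i) (auto simp: l_def)
    next
      case 2
      show ?thesis
      proof (cases "i = n")
        case True
        then have "l ! Suc i = e2" by (simp add: l_def n_def)
        then show ?thesis using 2 f2 by simp
      qed (use lq[of "Suc i"] i 2 in auto)
    qed
  qed
  show "e1 \<noteq> e2"
  proof
    assume "e1 = e2"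
    then have "a 0 = a n" using srcl[of 0] srcl[of n] tgtl[of n] e1 e2 ll
      by (auto simp: l_def n_def a_def)
    then have "n = 0" using dist[of n] by (cases n) auto
    then show False using nbl[of 0] f2 \<open>e1 = e2\<close> by (simp add: l_def n_def)
  qed
qed

text \<open>The step sends the simple roots of A to simple roots, so \<gamma> goes to a positive
  root on the image of A. This image consists of the labels of a vertex z and one further index, and
  orthogonality to the labels is preserved: the image of \<gamma> defines a loop at z.\<close>

lemma enlarged_step:
  assumes y: "y \<in> vertices" and s: "s \<in> S" "s \<notin> supp_of y" and A: "A = insert s (supp_of y)"
    and t: "t \<in> S" "t \<notin> A" and fin: "finite (rel_roots (insert t A) A)"
    and g: "\<gamma> \<in> pos_roots" "\<gamma> \<in> roots_on A" "orth (supp_of y) \<gamma>"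
  obtains e z where "e \<in> generate G (insert t A)" "e \<noteq> \<one>"
    "inversions e = rel_roots (insert t A) A \<inter> pos_roots"
    "z \<in> vertices" "e \<in> C_hom z y" "act e \<gamma> \<in> pos_roots"
      "(z, root_refl (act e \<gamma>), z) \<in> edges_within (insert t A)"
proof -
  let ?J = "insert t A"
  have AS: "A \<subseteq> S" "?J \<subseteq> S" using s t supp_of_S[OF y] by (auto simp: A)
  have "finite_type (comps_meeting A {t})" using finite_type_comps[of A "{t}"] AS t fin by auto
  note p = rstep_props[OF AS(1) t this]
  define e where "e = rstep A t"
  note p = p[folded e_def]
  have ec: "e \<in> carrier G" using generate_subset_carrier[OF AS(2) p(1)] .
  have "simple_map e (supp_of y)" using p(2) by (auto simp: simple_map_def A)
  then obtain z where z: "z \<in> vertices" "e \<in> C_hom z y" using vertex_image[OF y ec] by blast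
  have gV: "\<gamma> \<in> V" using g pos_root_V by blast
  have dp: "act e \<gamma> \<in> pos_roots"
    using g simple_map_pos[OF p(2)]
    by (intro act_pos[OF ec g(1)]) (auto simp: roots_on_def supp_def)
  have dorth: "orth (supp_of z) (act e \<gamma>)" using C_hom_orth[OF z(2) y gV g(3)] .
  have sub: "simple_img e A \<subseteq> ?J"
  proof
    fix b assume "b \<in> simple_img e A"
    then obtain a where "a \<in> A" "act e (simple_root a) = simple_root b"
      by (auto simp: simple_img_def)
    then have "simple_root b \<in> span_on ?J" using act_span[OF AS(2) p(1) simple_root_span, of a]
      by auto
    then show "b \<in> ?J" by (simp add: span_on_def)
  qed
  obtain s1 where s1: "s1 \<in> S" "act e (simple_root s) = simple_root s1" using p(2)
    by (auto simp: simple_map_def A)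
  have imgA: "simple_img e A = insert s1 (supp_of z)"
    using C_hom_simple_map(2)[OF z(2,1)] s1 by (auto simp: simple_img_def A simple_root_inj)
  have s1z: "s1 \<notin> supp_of z"
  proof
    assume "s1 \<in> supp_of z"
    then obtain l where "l \<in> \<Lambda>" "act e (simple_root (y l)) = act e (simple_root s)"
      using C_hom_act[OF z(2)] s1 by auto
    then have "y l = s" using act_inj[OF ec] vertices_V[OF y] s simple_root_span simple_root_inj
      by metis
    then show False using s \<open>l \<in> \<Lambda>\<close> by blast
  qed
  have "act e \<gamma> \<in> span_on (insert s1 (supp_of z))"
    using simple_img_span[OF ec AS(1) p(2) roots_on_span[OF g(2)]] imgA by simp
  then have "act e \<gamma> \<in> roots_on (insert s1 (supp_of z))" using roots_onI pos_root dp by blast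
  then have "(z, root_refl (act e \<gamma>), z) \<in> edges_within ?J"
    using loopI[OF z(1) s1(1) s1z _ _ dorth] sub imgA by simp
  then show thesis using that[OF p(1,3) inversions_rank_one[OF AS(1) t(1) p] z dp] by blast
qed

text \<open>The step for the index set enlarged by the coordinate of the loop leads to a loop at the other
  end of the component, along a reduced path.\<close>

lemma loop_walk_exists:
  assumes r2: "rank_two J y" and e1: "e1 \<in> edges_within J" "tgt e1 = y" "src e1 = y"
  shows "\<exists>q z e2. arrow_path (edges_within J) y q z \<and> e2 \<in> edges_within J \<and> tgt e2 = z \<and> src e2 = z \<and>
    nonbacktracking (e1 # q @ [e2])"
proof -
  have J: "J \<subseteq> S" and y: "y \<in> vertices" and finJ: "finite (rel_roots J (supp_of y))" using r2
    by (auto simp: rank_two_def)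
  obtain s \<gamma> where s: "s \<in> S" "s \<notin> supp_of y" "insert s (supp_of y) \<subseteq> J" "\<gamma> \<in> pos_roots"
    "\<gamma> \<in> roots_on (insert s (supp_of y))" "orth (supp_of y) \<gamma>" "elt e1 = root_refl \<gamma>"
    using loop_root[OF e1(1)] e1(2,3) by metis
  obtain a b where ab: "a \<noteq> b" "a \<notin> supp_of y" "b \<notin> supp_of y" "J = insert a (insert b (supp_of y))"
    using r2 by (auto simp: rank_two_def)
  define A where "A = insert s (supp_of y)"
  obtain t where t: "t \<notin> A" "J = insert t A"
  proof (cases "s = a")
    case True
    then show ?thesis using that[of b] ab by (auto simp: A_def)
  next
    case False
    then have "s = b" using s ab by auto
    then show ?thesis using that[of a] ab by (auto simp: A_def)
  qed
  have tS: "t \<in> S" using t J by auto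
  have gV: "\<gamma> \<in> V" "\<gamma> \<in> roots" using s pos_root_V pos_root by auto
  have "rel_roots J A \<subseteq> rel_roots J (supp_of y)" by (auto simp: rel_roots_def A_def)
  then have "finite (rel_roots (insert t A) A)" using finJ finite_subset t by metis
  then obtain e z where eg: "e \<in> generate G J" "e \<noteq> \<one>" and z: "z \<in> vertices" "e \<in> C_hom z y"
    and dp: "act e \<gamma> \<in> pos_roots" and lp: "(z, root_refl (act e \<gamma>), z) \<in> edges_within J"
    using enlarged_step[OF y s(1,2) A_def tS t(1) _ s(4) _ s(6)] s(5) t(2) unfolding A_def by metis
  have ec: "e \<in> carrier G" using generate_subset_carrier[OF J eg(1)] .
  define \<delta> where "\<delta> = act e \<gamma>"
  have dp: "\<delta> \<in> pos_roots" "\<delta> \<in> V" "\<delta> \<in> roots" using dp pos_root_V pos_root by (auto simp: \<delta>_def)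
  have dV: "\<delta> \<in> V" "\<delta> \<in> roots" using dp by auto
  define e2 where "e2 = (z, root_refl \<delta>, z)"
  have e2: "e2 \<in> edges_within J" using lp by (simp add: e2_def \<delta>_def)
  define u where "u = inv e"
  have u: "u \<in> C_hom y z" "u \<in> generate G J" "u \<in> carrier G" "u \<noteq> \<one>"
    using C_hom_inv[OF z(2) y] generate_m_inv_closed[of J e] eg J gens_carrier ec
    by (auto simp: u_def)
  have ud: "act u \<delta> = \<gamma>" using ec gV by (simp add: u_def \<delta>_def)
  have yJ: "supp_of y \<subseteq> J" using s by simp
  obtain q where q: "arrow_path (edges_within J) y q z" "path_elt q = u" "reduced q"
    using reduced_path_exists[OF y z(1) yJ J u(1,2)] by blast
  have qe: "set q \<subseteq> edges" using path_set q by blast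
  have nbq: "nonbacktracking q" using reduced_nonbacktracking qe q by blast
  have qne: "q \<noteq> []" using q u by auto
  have notu: "\<delta> \<notin> inversions u" using ud s by (simp add: inversions_def)
  have f1: "flip e1 = e1" and f2: "flip e2 = e2" using loop_inv(2) e1 e2 by (auto simp: e2_def)
  \<comment> \<open>The element of q sends \<delta> to the positive root \<gamma>. If q ended with
    e1, the part before it would invert \<delta>; if q began with e2, that loop would. Since q is
    reduced, it would then invert \<delta> itself.\<close>
  have "hd q \<noteq> e1"
  proof
    assume "hd q = e1"
    then obtain p3 where p3: "q = e1 # p3" using qne by (cases q) auto
    have c: "path_elt p3 \<in> carrier G" using path_elt_carrier qe p3 by simp
    have "root_refl \<gamma> \<otimes> u = root_refl \<gamma> \<otimes> root_refl \<gamma> \<otimes> path_elt p3" using q(2) p3 s c gV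
      by (simp add: m_assoc)
    then have "path_elt p3 = root_refl \<gamma> \<otimes> u" using root_refl_sq gV c by simp
    then have "act (path_elt p3) \<delta> = (\<lambda>r. - \<gamma> r)" using u dV gV ud root_refl_self
      by (simp add: act_mult)
    then have "\<delta> \<in> inversions (path_elt p3)" using dp(1) pos_not_neg[OF s(4)]
      by (simp add: inversions_def)
    then show False using q p3 notu by auto
  qed
  moreover have "last q \<noteq> e2"
  proof
    assume "last q = e2"
    then have p3: "q = butlast q @ [e2]" using qne by (metis append_butlast_last_id)
    have "inversions (path_elt [e2]) \<subseteq> inversions u" using reduced_append[of "butlast q"
      "[e2]"] p3 q by simp
    moreover have "\<delta> \<in> inversions (path_elt [e2])"
      using dV root_refl_self dp(1) pos_not_neg[OF dp(1)] by (simp add: e2_def inversions_def)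
    ultimately show False using notu by blast
  qed
  ultimately have "nonbacktracking (e1 # q @ [e2])"
    using nbq qne f1 f2 flip_flip[OF subsetD[OF qe hd_in_set[OF qne]]]
    by (auto simp: nonbacktracking_def successively_Cons successively_append_iff)
  then show ?thesis using q(1) e2 by (intro exI[of _ q] exI[of _ z] exI[of _ e2]) (simp add: e2_def)
qed

text \<open>In a shortest walk no loop occurs inside: read from e1, the walk could stop
  there.\<close>

lemma two_loops:
  assumes r2: "rank_two J y" and e1: "e1 \<in> edges_within J" "tgt e1 = y" "src e1 = y"
  shows "\<exists>q z e2. arrow_path (edges_within J) y q z \<and> e2 \<in> edges_within J \<and> tgt e2 = z \<and> src e2 = z \<and>
    nonbacktracking (e1 # q @ [e2]) \<and> (\<forall>e \<in> set q. tgt e \<noteq> src e)"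
proof -
  define P where "P = (\<lambda>q. \<exists>z e2. arrow_path (edges_within J) y q z \<and> e2 \<in> edges_within J \<and> tgt e2 = z \<and> src e2 = z \<and>
    nonbacktracking (e1 # q @ [e2]))"
  obtain q0 where "P q0" using loop_walk_exists[OF assms] unfolding P_def by blast
  define q where "q = (ARG_MIN length q. P q)"
  have q: "P q" "\<And>r. P r \<Longrightarrow> length q \<le> length r"
    using arg_min_natI[of P q0 length] arg_min_nat_le[of P _ length] \<open>P q0\<close> by (auto simp: q_def)
  obtain z e2 where ze: "arrow_path (edges_within J) y q z" "e2 \<in> edges_within J" "tgt e2 = z"
    "src e2 = z"
    "nonbacktracking (e1 # q @ [e2])" using q(1) unfolding P_def by blast
  have "tgt f \<noteq> src f" if f: "f \<in> set q" for f
  proof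
    assume l: "tgt f = src f"
    obtain q1 q2 where q12: "q = q1 @ f # q2" using f by (metis split_list)
    have "arrow_path (edges_within J) y q1 (tgt f)" "f \<in> edges_within J"
      using ze(1) unfolding q12 by (auto simp: arrow_path_append)
    moreover have "e1 # q @ [e2] = (e1 # q1 @ [f]) @ q2 @ [e2]" by (simp add: q12)
    then have "nonbacktracking (e1 # q1 @ [f])"
      using ze(5) unfolding nonbacktracking_def by (metis successively_append_iff)
    ultimately have "P q1" unfolding P_def using l by metis
    then show False using q(2)[of q1] q12 by simp
  qed
  then show ?thesis using ze by blast
qed

text \<open>A walk without loops moves back and forth along the simple path q. Steps back cancel, so
  its element depends only on the position reached.\<close>

lemma walk_potential:
  assumes d: "distinct (y # map src q)" and q: "arrow_path (edges_within J) y q z"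
    and closed: "\<And>e. e \<in> edges_within J \<Longrightarrow> src e \<in> set (y # map src q) \<Longrightarrow> e \<in> set q \<union> flip ` set q \<union> {e1, e2}"
    and loops: "tgt e1 = src e1" "tgt e2 = src e2"
  shows "arrow_path (edges_within J) w p z \<Longrightarrow> \<forall>e \<in> set p. tgt e \<noteq> src e \<Longrightarrow>
    \<exists>i \<le> length q. w = (y # map src q) ! i \<and> path_elt p = path_elt (drop i q)"
proof (induction p arbitrary: w)
  case Nil
  have "(y # map src q) ! length q = z" using arrow_path_vertices[OF q]
    by (metis length_map nth_append_length)
  then show ?case using Nil by (intro exI[of _ "length q"]) auto
next
  case (Cons e p)
  have qe: "set q \<subseteq> edges" using path_set q by blast
  let ?a = "\<lambda>i. (y # map src q) ! i"
  obtain i where i: "i \<le> length q" "src e = ?a i" "path_elt p = path_elt (drop i q)" using Cons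
    by auto
  have e: "e \<in> edges_within J" "tgt e = w" "tgt e \<noteq> src e" using Cons.prems by auto
  have "src e \<in> set (y # map src q)" unfolding i(2) by (rule nth_mem) (use i in simp)
  then have "e \<in> set q \<union> flip ` set q" using closed[OF e(1)] loops e(3) by auto
  then obtain k where k: "k < length q" "e = q ! k \<or> e = flip (q ! k)"
    by (auto simp: in_set_conv_nth)
  have tk: "tgt (q ! k) = ?a k" using arrow_path_vertices[OF q] k by (simp add: nth_append)
  have sk: "src (q ! k) = ?a (Suc k)" using k by simp
  have dr: "drop k q = q ! k # drop (Suc k) q" using k by (simp add: Cons_nth_drop_Suc)
  have c: "elt (q ! k) \<in> carrier G" "path_elt (drop (Suc k) q) \<in> carrier G"
    using edge_carrier[of "q ! k" S] path_elt_carrier[of "drop (Suc k) q"] qe k nth_mem set_drop_subset[of "Suc k" q] by auto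
  have inj: "m = m'" if "?a m = ?a m'" "m \<le> length q" "m' \<le> length q" for m m'
    using nth_eq_iff_index_eq[OF d, of m m'] that by simp
  from k(2) show ?case
  proof
    assume ek: "e = q ! k"
    have "?a i = ?a (Suc k)" using i(2)[symmetric] sk unfolding ek by (rule HOL.trans)
    then have ik: "i = Suc k" by (rule inj) (use i k in auto)
    show ?thesis
    proof (intro exI conjI)
      show "k \<le> length q" using k by simp
      show "w = ?a k" using tk e(2) unfolding ek by (rule subst[rotated])
      show "path_elt (e # p) = path_elt (drop k q)" using i(3) unfolding ek ik dr by simp
    qed
  next
    assume ek: "e = flip (q ! k)"
    have "?a i = tgt (q ! k)" using i(2) unfolding ek flip_sel by (rule HOL.sym)
    then have "?a i = ?a k" using tk by (rule HOL.trans)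
    then have ik: "i = k" by (rule inj) (use i k in auto)
    show ?thesis
    proof (intro exI conjI)
      show "Suc k \<le> length q" using k by simp
      show "w = ?a (Suc k)" using sk e(2) unfolding ek flip_sel by (rule subst[rotated])
      show "path_elt (e # p) = path_elt (drop (Suc k) q)" using i(3) c unfolding ek ik dr
        by (simp flip: m_assoc)
    qed
  qed
qed

lemma count_list_distinct: "distinct xs \<Longrightarrow> count_list xs v = (if v \<in> set xs then 1 else 0)"
  by (induction xs) auto

text \<open>The given loops are shown to be the two loops of the component, and p to represent the
  same element as the simple path between them. \<open>ne\<close> excludes that p merely returns to
  the loop e1.\<close>

lemma tour_exists:
  assumes r2: "rank_two J y" and J: "J = supp_of y \<union> {s, t}" "s \<noteq> t" "s \<notin> supp_of y" "t \<notin> supp_of y"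
    and e1: "e1 \<in> edges_within J" "tgt e1 = y" "src e1 = y" and e2: "e2 \<in> edges_within J"
      "tgt e2 = z" "src e2 = z"
    and p: "arrow_path (edges_within J) y p z" "\<forall>e \<in> set p. tgt e \<noteq> src e"
      and ne: "e1 = e2 \<Longrightarrow> path_elt p \<noteq> \<one>"
  shows "\<exists>q. path_elt q = path_elt p \<and> arrow_path (comp_edges y s t) y q z \<and>
    shuttling_tour y s t (e1 # q @ e2 # inv_path q)"
proof -
  obtain q z' e' where q: "arrow_path (edges_within J) y q z'" and e': "e' \<in> edges_within J"
    "tgt e' = z'" "src e' = z'"
    and nb: "nonbacktracking (e1 # q @ [e'])" and nl: "\<forall>e \<in> set q. tgt e \<noteq> src e"
    using two_loops[OF r2 e1] by metis
  note sw = simple_walk[OF r2 q e1 e' nb nl]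
  have JS: "J \<subseteq> S" "y \<in> vertices" using r2 by (auto simp: rank_two_def)
  let ?V = "set (y # map src q)" and ?E = "set q \<union> flip ` set q \<union> {e1, e'}"
  have V2: "?V = set (map tgt q @ [z'])" using arrow_path_vertices[OF q] by simp
  have qJ: "set q \<subseteq> edges_within J" using arrow_path_set[OF q] .
  have EJ: "?E \<subseteq> edges_within J" using qJ e1 e' flip_edge by blast
  have zV: "z' \<in> ?V" unfolding V2 by simp
  have tq: "tgt ` set q \<subseteq> ?V" unfolding V2 by auto
  have EV: "src e \<in> ?V \<and> tgt e \<in> ?V" if e: "e \<in> ?E" for e
  proof -
    consider "e \<in> set q" | "e \<in> flip ` set q" | "e = e1" | "e = e'" using e by blast
    then show ?thesis
    proof cases
      case 2
      then obtain f where "f \<in> set q" "e = flip f" by blast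
      then show ?thesis using tq by auto
    qed (use tq zV e1 e' in auto)
  qed
  have cJ: "y ` \<Lambda> \<union> {s, t} = J" using J by simp
  have reach: "v \<in> ?V" if "arrow_path (edges_within J) v r y" for v r
  proof (rule arrow_path_closed[OF _ that])
    show "tgt e \<in> ?V" if "e \<in> edges_within J" "src e \<in> ?V" for e using sw(2)[OF that] EV by blast
  qed simp
  have compV: "comp_vertices y s t = ?V"
  proof
    show "comp_vertices y s t \<subseteq> ?V" unfolding comp_vertices_def cJ using reach by blast
    show "?V \<subseteq> comp_vertices y s t"
    proof
      fix v assume "v \<in> ?V"
      then consider "v = y" | e where "e \<in> set q" "v = src e" by auto
      then show "v \<in> comp_vertices y s t"
      proof cases
        case 1
        then show ?thesis unfolding comp_vertices_def by (auto intro!: exI[of _ "[]"])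
      next
        case 2
        obtain q1 q2 where "q = q1 @ e # q2" using 2 by (metis split_list)
        then have "arrow_path (edges_within J) y (q1 @ [e]) v" using q 2
          by (auto simp: arrow_path_append)
        then have "arrow_path (edges_within J) v (inv_path (q1 @ [e])) y"
          by (rule arrow_path_inv[rotated]) (rule flip_edge)
        then show ?thesis unfolding comp_vertices_def cJ by blast
      qed
    qed
  qed
  have compE: "comp_edges y s t = ?E"
    unfolding comp_edges_def compV cJ using sw(2) EV EJ by blast
  have e2V: "src e2 \<in> ?V"
  proof -
    have "arrow_path (edges_within J) z (inv_path p) y"
      by (rule arrow_path_inv[OF _ p(1)]) (rule flip_edge)
    then show ?thesis using reach e2 by simp
  qed
  have "e2 \<in> ?E" using sw(2)[OF e2(1) e2V] .
  moreover have "e2 \<notin> set q \<union> flip ` set q"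
  proof
    assume "e2 \<in> set q \<union> flip ` set q"
    then obtain f where "f \<in> set q" "e2 = f \<or> e2 = flip f" by blast
    then show False using nl e2 by auto
  qed
  ultimately have e2c: "e2 = e1 \<or> e2 = e'" by blast
  have path_in: "arrow_path (edges_within J) y p z'" if "z = z'" using p that by simp
  have l1: "tgt e1 = src e1" "tgt e' = src e'" using e1 e' by auto
  have pot: "\<exists>i\<le>length q. w = (y # map src q) ! i \<and> path_elt r = path_elt (drop i q)"
    if "arrow_path (edges_within J) w r z'" "\<forall>e\<in>set r. tgt e \<noteq> src e" for w r
    by (rule walk_potential[OF sw(1) q _ l1 that]) (rule sw(2))
  have lastv: "(y # map src q) ! length q = z'" using arrow_path_vertices[OF q]
    by (metis length_map nth_append_length)
  have e2': "e2 = e' \<and> z = z'"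
  proof (rule ccontr)
    assume "\<not> (e2 = e' \<and> z = z')"
    then have "e2 = e1" using e2c e2 e' by auto
    then have zy: "z = y" using e1 e2 by simp
    have cq: "path_elt q \<in> carrier G" "path_elt p \<in> carrier G"
      using path_elt_carrier path_set q p by blast+
    \<comment> \<open>If p came back to y, then q followed by p would be a walk ending at y, so it
      would represent the element of q and p would represent 1.\<close>
    have "arrow_path (edges_within J) y (p @ q) z'" using p q zy by (auto simp: arrow_path_append)
    then obtain i where i: "i \<le> length q" "y = (y # map src q) ! i"
      "path_elt (p @ q) = path_elt (drop i q)"
      using pot[of y "p @ q"] p nl by auto
    have "i = 0" using nth_eq_iff_index_eq[OF sw(1), of i 0] i by simp
    then have "path_elt p \<otimes> path_elt q = path_elt q"
      using i path_elt_append[OF path_set[OF p(1)] path_set[OF q]] by simp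
    then have "path_elt p = \<one>" using cq by (metis l_cancel_one' r_cancel_one')
    then show False using ne \<open>e2 = e1\<close> by blast
  qed
  then have z: "z = z'" and e2e: "e2 = e'" by auto
  obtain i where i: "i \<le> length q" "y = (y # map src q) ! i" "path_elt p = path_elt (drop i q)"
    using pot[OF path_in[OF z] p(2)] by blast
  have "i = 0" using nth_eq_iff_index_eq[OF sw(1), of i 0] i by simp
  then have elt: "path_elt q = path_elt p" using i by simp
  have qc: "arrow_path (comp_edges y s t) y q z"
    using arrow_path_mono[OF q, of "comp_edges y s t"] compE z by auto
  have flipc: "flip e \<in> comp_edges y s t" if "e \<in> comp_edges y s t" for e
  proof -
    have e: "e \<in> ?E" using that compE by simp
    then have "flip e \<in> edges_within J" using EJ flip_edge[of e J] by blast
    moreover have "src (flip e) \<in> ?V" using EV[OF e] by simp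
    ultimately show ?thesis unfolding comp_edges_def compV cJ by blast
  qed
  have inv_c: "arrow_path (comp_edges y s t) z (inv_path q) y" by (rule arrow_path_inv[OF flipc qc])
  have tour_path: "arrow_path (comp_edges y s t) y (e1 # q @ e2 # inv_path q) y"
    using qc inv_c e1 e2 compE e2e z by (auto simp: arrow_path_append)
  have msrc: "map src (inv_path q) = rev (map tgt q)" by (simp add: inv_path_def rev_map)
  have "count_list (map src (e1 # q @ e2 # inv_path q)) v = 2" if v: "v \<in> comp_vertices y s t" for v
  proof -
    \<comment> \<open>The sources along the tour are the vertices of q in one order and then in the
      opposite order, so each occurs twice.\<close>
    have "map src (e1 # q @ e2 # inv_path q) = (y # map src q) @ (z # rev (map tgt q))"
      using e1 e2 msrc by simp
    also have "z # rev (map tgt q) = rev (y # map src q)" unfolding arrow_path_vertices[OF q]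
      using z by simp
    finally have "count_list (map src (e1 # q @ e2 # inv_path q)) v
        = count_list (y # map src q) v + count_list (rev (y # map src q)) v" by simp
    moreover have "distinct (rev (y # map src q))" using sw(1) by (simp only: distinct_rev)
    ultimately show ?thesis
      using count_list_distinct[OF sw(1), of v] count_list_distinct[of "rev (y # map src q)" v] v compV
      by (simp only: set_rev) simp
  qed
  moreover have cl: "count_list (e1 # q @ e2 # inv_path q) e1 = 1"
    "count_list (e1 # q @ e2 # inv_path q) e' = 1"
  proof -
    have "f \<notin> set q \<and> f \<notin> set (inv_path q)" if "tgt f = src f" for f
      using nl that by (auto simp: inv_path_def)
    then have "e1 \<notin> set q" "e1 \<notin> set (inv_path q)" "e' \<notin> set q" "e' \<notin> set (inv_path q)" using l1
      by auto
    then show "count_list (e1 # q @ e2 # inv_path q) e1 = 1"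
      "count_list (e1 # q @ e2 # inv_path q) e' = 1"
      using sw(3) e2e by (auto simp: count_notin)
  qed
  moreover have "path_with_loops (comp_vertices y s t) (comp_edges y s t) e1 e'"
    unfolding path_with_loops_def
    by (intro conjI exI[of _ y] exI[of _ z'] exI[of _ q] sw(1,3) qc[unfolded z] e1(2,3) e'(2,3) compV compE)
  moreover have "finite_type (comps_meeting (y ` \<Lambda>) {s, t})"
  proof (rule finite_type_comps)
    show "y ` \<Lambda> \<subseteq> S" using supp_of_S JS by blast
    show "{s, t} \<subseteq> S" using J JS by auto
    show "y ` \<Lambda> \<inter> {s, t} = {}" using J by auto
    show "finite (rel_roots (y ` \<Lambda> \<union> {s, t}) (y ` \<Lambda>))" using r2 cJ by (simp add: rank_two_def)
  qed
  ultimately have "shuttling_tour y s t (e1 # q @ e2 # inv_path q)"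
    unfolding shuttling_tour_def using tour_path JS J by blast
  then show ?thesis using elt qc by blast
qed

end

context coxeter_system begin

section \<open>Linear functionals\<close>

text \<open>With f an arbitrary function on the generators these are all linear functionals on V,
  also when S is infinite or the form degenerate.\<close>

definition pairing :: "('a \<Rightarrow> real) \<Rightarrow> ('a \<Rightarrow> real) \<Rightarrow> real" where
  "pairing f v = (\<Sum>s\<in>supp v. v s * f s)"

lemma pairing_on: "finite A \<Longrightarrow> supp v \<subseteq> A \<Longrightarrow> pairing f v = (\<Sum>s\<in>A. v s * f s)"
  unfolding pairing_def by (rule sum.mono_neutral_left) (auto simp: supp_def)

lemma pairing_lin:
  assumes "u \<in> V" "v \<in> V"
  shows "pairing f (\<lambda>r. a * u r + b * v r) = a * pairing f u + b * pairing f v"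
proof -
  let ?A = "supp u \<union> supp v"
  have A: "finite ?A" using assms by (auto simp: span_on_def)
  have "pairing f (\<lambda>r. a * u r + b * v r) = (\<Sum>s\<in>?A. (a * u s + b * v s) * f s)"
    by (rule pairing_on[OF A supp_lin])
  moreover have "pairing f u = (\<Sum>s\<in>?A. u s * f s)" "pairing f v = (\<Sum>s\<in>?A. v s * f s)"
    by (rule pairing_on[OF A], simp)+
  ultimately show ?thesis by (simp add: sum_distrib_left algebra_simps sum.distrib)
qed

lemma pairing_simple [simp]: "pairing f (simple_root s) = f s"
  by (simp add: pairing_def) (simp add: simple_root_def)

text \<open>One vector is treated at a time. If f kills v, raising f at an index of v outside A
  makes the value nonzero; finitely many increments, collected in \<open>Bad\<close>, would spoil an
  earlier vector.\<close>

lemma generic_functional: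
  assumes "finite M" "M \<subseteq> V"
  shows "\<exists>f. (\<forall>s \<in> A. f s = 0) \<and> (\<forall>s. s \<notin> A \<longrightarrow> f s > 0) \<and> (\<forall>v \<in> M. \<not> supp v \<subseteq> A \<longrightarrow> pairing f v \<noteq> 0)"
  using assms
proof (induction M rule: finite_induct)
  case empty
  show ?case by (intro exI[of _ "\<lambda>s. if s \<in> A then 0 else 1"]) auto
next
  case (insert v M)
  then obtain f where f: "\<forall>s \<in> A. f s = 0" "\<forall>s. s \<notin> A \<longrightarrow> f s > 0"
    "\<forall>v \<in> M. \<not> supp v \<subseteq> A \<longrightarrow> pairing f v \<noteq> 0" by blast
  show ?case
  proof (cases "supp v \<subseteq> A \<or> pairing f v \<noteq> 0")
    case True
    then show ?thesis using f by (intro exI[of _ f]) auto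
  next
    case False
    then obtain i where i: "i \<in> supp v" "i \<notin> A" by blast
    define Bad where "Bad = (\<lambda>u. - pairing f u / u i) ` M"
    have "infinite ({0<..} - Bad :: real set)" using insert.hyps(1) infinite_Ioi[of "0::real"]
      by (simp add: Bad_def Diff_infinite_finite)
    then obtain e where e: "e \<in> {0<..} - Bad" by (metis finite.emptyI ex_in_conv)
    then have e0: "e > 0" "e \<notin> Bad" by auto
    define g where "g = f(i := f i + e)"
    have pg: "pairing g u = pairing f u + e * u i" if "u \<in> V" for u
    proof -
      have A: "finite (insert i (supp u))" using that by (simp add: span_on_def)
      have "pairing g u = (\<Sum>s\<in>insert i (supp u). u s * f s + (if s = i then e * u i else 0))"
        unfolding pairing_on[OF A subset_insertI]
        by (intro sum.cong) (auto simp: g_def algebra_simps)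
      also have "\<dots> = pairing f u + e * u i" using A pairing_on[OF A subset_insertI, of f]
        by (simp add: sum.distrib)
      finally show ?thesis .
    qed
    have "pairing g u \<noteq> 0" if u: "u \<in> insert v M" "\<not> supp u \<subseteq> A" for u
    proof (cases "u = v")
      case True
      then show ?thesis using pg[of v] insert.prems False i e0 by (simp add: supp_def)
    next
      case neq: False
      then have uM: "u \<in> M" "u \<in> V" using u insert.prems by auto
      show ?thesis
      proof (cases "u i = 0")
        case True
        then show ?thesis using pg[OF uM(2)] f(3) uM u by simp
      next
        case False
        have "e \<noteq> - pairing f u / u i" using e0(2) uM by (auto simp: Bad_def)
        then show ?thesis using pg[OF uM(2)] False by (auto simp: field_simps eq_neg_iff_add_eq_0)
      qed
    qed
    moreover have "\<forall>s\<in>A. g s = 0" using f i by (auto simp: g_def)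
    moreover have "\<forall>s. s \<notin> A \<longrightarrow> g s > 0" using f(2) e0 by (simp add: g_def add_pos_pos)
    ultimately show ?thesis by blast
  qed
qed

lemma sum_act_V:
  assumes "finite F" "F \<subseteq> carrier G" "v \<in> V"
  shows "(\<lambda>r. \<Sum>g\<in>F. act g v r) \<in> V"
  using assms(1,2)
proof (induction F)
  case empty
  then show ?case by (simp add: span_on_def supp_def)
next
  case (insert h F)
  then show ?case using span_on_lin[of "act h v" S "\<lambda>r. \<Sum>g\<in>F. act g v r" 1 1] act_V[of h v] assms(3)
    by simp
qed

lemma pairing_sum_act:
  assumes "finite F" "F \<subseteq> carrier G" "v \<in> V"
  shows "pairing f (\<lambda>r. \<Sum>g\<in>F. act g v r) = (\<Sum>g\<in>F. pairing f (act g v))"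
  using assms(1,2)
proof (induction F)
  case empty
  then show ?case by (simp add: pairing_def)
next
  case (insert h F)
  then show ?case
    using pairing_lin[of "act h v"
    "\<lambda>r. \<Sum>g\<in>F. act g v r" f 1 1] act_V[of h v] sum_act_V[of F v] assms(3) by simp
qed

text \<open>The norm of \<gamma> would be a combination of its products with the simple roots of A,
  hence 0 instead of 1.\<close>

lemma root_orth_span:
  assumes "A \<subseteq> S" "\<gamma> \<in> roots" "orth A \<gamma>" "\<gamma> \<in> span_on A"
  shows False
proof -
  have "bform \<gamma> \<gamma> = (\<Sum>t\<in>supp \<gamma>. \<gamma> t * bform \<gamma> (simple_root t))"
    using assms root_V by (intro bform_sum_right) (auto simp: span_on_def)
  also have "\<dots> = 0" using assms by (intro sum.neutral) (auto simp: orth_def span_on_def)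
  finally show False using root_norm assms by simp
qed

end

context coxeter_groupoid begin

text \<open>The functional \<open>\<sigma>\<close> obtained by averaging a generic functional \<open>f\<close>, which is dominant and
  vanishes on \<open>[z]\<close>, over a finite group \<open>F\<close> is negative on finitely many positive roots only.  Applying
  as many steps as possible that decrease the set of these roots makes \<open>\<sigma>\<close> dominant; by
  genericity the roots on which it vanishes then span the fixed facet of \<open>F\<close>.\<close>

lemma fixed_facet:
  assumes z: "z \<in> vertices" "supp_of z \<subseteq> J" and J: "J \<subseteq> S"
    and F: "finite F" "\<one> \<in> F" "F \<subseteq> generate G J"
    and Fix: "\<And>g a. g \<in> F \<Longrightarrow> a \<in> supp_of z \<Longrightarrow> act g (simple_root a) = simple_root a"
    and b: "b1 \<in> pos_roots" "b1 \<in> roots_on J" "orth (supp_of z) b1" "b2 \<in> pos_roots"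
      "b2 \<in> roots_on J" "orth (supp_of z) b2"
    and span: "\<And>g v. g \<in> F \<Longrightarrow> v \<in> V \<Longrightarrow> \<exists>c d. act g v = (\<lambda>r. v r + c * b1 r + d * b2 r)"
    and avg: "\<And>r. (\<Sum>g\<in>F. act g b1 r) = 0" "\<And>r. (\<Sum>g\<in>F. act g b2 r) = 0"
    and dom: "\<And>\<rho>. \<rho> \<in> pos_roots \<Longrightarrow> orth (supp_of z) \<rho> \<Longrightarrow>
      (\<forall>g \<in> F. act g \<rho> \<in> pos_roots) \<or> (\<forall>r. (\<Sum>g\<in>F. act g \<rho> r) = 0)"
  shows "\<exists>a w K. a \<in> vertices \<and> w \<in> Y_hom a z \<and> w \<in> generate G J \<and> K \<subseteq> J \<and> supp_of a \<subseteq> K \<and>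
    act w b1 \<in> roots_on K \<and> act w b2 \<in> roots_on K \<and>
    (\<forall>r \<in> K. \<exists>c d. \<exists>v \<in> span_on (supp_of a). simple_root r = (\<lambda>q. c * act w b1 q + d * act w b2 q + v q)) \<and>
    finite (rel_roots K (supp_of a))"
proof -
  let ?Z = "supp_of z"
  have Fc: "F \<subseteq> carrier G" using F J generate_subset_carrier by blast
  have zS: "?Z \<subseteq> S" using supp_of_S z by blast
  \<comment> \<open>Off this finite set all of F keeps a positive root positive, so \<sigma> can be
    negative on N only.\<close>
  define N where "N = (\<Union>g\<in>F. inversions g)"
  have finN: "finite N" using F(1) Fc finite_inversions by (auto simp: N_def)
  define T where "T = (\<lambda>v r. \<Sum>g\<in>F. act g v r)"
  have TV: "T v \<in> V" if "v \<in> V" for v using sum_act_V[OF F(1) Fc that] by (simp add: T_def)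
  have TN: "T ` N \<subseteq> V" using TV pos_root_V inversions_pos unfolding N_def by blast
  \<comment> \<open>Genericity is required on the sums T \<rho> with \<rho> in N, since \<sigma>
    \<rho> is the value of f at T \<rho>.\<close>
  obtain f where f': "\<forall>s \<in> ?Z. f s = 0" "\<forall>s. s \<notin> ?Z \<longrightarrow> f s > 0"
    "\<forall>v \<in> T ` N. \<not> supp v \<subseteq> ?Z \<longrightarrow> pairing f v \<noteq> 0"
    using generic_functional[OF finite_imageI[OF finN] TN, of ?Z] by (elim exE conjE)
  have f: "\<And>s. s \<in> ?Z \<Longrightarrow> f s = 0" "\<And>s. s \<notin> ?Z \<Longrightarrow> f s > 0"
    "\<And>v. v \<in> T ` N \<Longrightarrow> \<not> supp v \<subseteq> ?Z \<Longrightarrow> pairing f v \<noteq> 0"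
    using f' by blast+
  have fnn: "f s \<ge> 0" for s using f(1,2)[of s] by (cases "s \<in> ?Z") auto
  define \<sigma> where "\<sigma> = (\<lambda>v. \<Sum>g\<in>F. pairing f (act g v))"
  have \<sigma>T: "\<sigma> v = pairing f (T v)" if "v \<in> V" for v
    using pairing_sum_act[OF F(1) Fc that] by (simp add: \<sigma>_def T_def)
  have \<sigma>lin: "\<sigma> (\<lambda>r. a * u r + b * v r) = a * \<sigma> u + b * \<sigma> v" if "u \<in> V" "v \<in> V" for a b u v
  proof -
    have "\<sigma> (\<lambda>r. a * u r + b * v r) = (\<Sum>g\<in>F. a * pairing f (act g u) + b * pairing f (act g v))"
      unfolding \<sigma>_def
    proof (rule sum.cong)
      fix g assume "g \<in> F"
      then have "g \<in> carrier G" using Fc by blast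
      then show "pairing f (act g (\<lambda>r. a * u r + b * v r)) = a * pairing f (act g u) + b * pairing f (act g v)"
        using act_lin[of g u v a b] that pairing_lin act_V by simp
    qed simp
    then show ?thesis by (simp add: \<sigma>_def sum.distrib sum_distrib_left)
  qed
  have \<sigma>neg: "\<sigma> (\<lambda>r. - v r) = - \<sigma> v" if "v \<in> V" for v using \<sigma>lin[OF that that, of "-1" 0] by simp
  have ppos: "pairing f \<rho> \<ge> 0" if "\<rho> \<in> pos_roots" for \<rho>
    unfolding pairing_def using that fnn
    by (intro sum_nonneg mult_nonneg_nonneg) (auto simp: pos_roots_def)
  have pzero: "supp \<rho> \<subseteq> ?Z" if r: "\<rho> \<in> pos_roots" "pairing f \<rho> = 0" for \<rho>
  proof (rule ccontr)
    assume "\<not> supp \<rho> \<subseteq> ?Z"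
    then obtain s where s: "s \<in> supp \<rho>" "s \<notin> ?Z" by blast
    have "finite (supp \<rho>)" using pos_root_V[OF r(1)] by (simp add: span_on_def)
    moreover have "0 \<le> \<rho> t * f t" for t using r(1) fnn by (simp add: pos_roots_def)
    moreover have "0 < \<rho> s * f s" using s f(2) r(1)
      by (auto simp: supp_def pos_roots_def order_less_le)
    ultimately have "0 < pairing f \<rho>" unfolding pairing_def using s by (intro sum_pos2) auto
    then show False using r by simp
  qed
  have \<sigma>pos: "\<sigma> \<rho> \<ge> 0" if "\<And>g. g \<in> F \<Longrightarrow> act g \<rho> \<in> pos_roots" for \<rho>
    unfolding \<sigma>_def using ppos that by (intro sum_nonneg) auto
  define D where "D = {\<rho> \<in> pos_roots. \<sigma> \<rho> < 0}"
  have DN: "D \<subseteq> N"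
  proof
    fix \<rho> assume r: "\<rho> \<in> D"
    show "\<rho> \<in> N"
    proof (rule ccontr)
      assume "\<rho> \<notin> N"
      then have "\<sigma> \<rho> \<ge> 0" using r by (intro \<sigma>pos) (auto simp: N_def D_def inversions_def)
      then show False using r by (simp add: D_def)
    qed
  qed
  have finD: "finite D" using DN finN finite_subset by blast
  \<comment> \<open>A maximal w of this kind brings \<sigma> into the dominant chamber on J. It
    exists because D is finite.\<close>
  define P where "P = (\<lambda>w. w \<in> generate G J \<and> (\<exists>a \<in> vertices. w \<in> C_hom a z) \<and> inversions w \<subseteq> D)"
  have "P \<one>" using z C_hom_one[OF z(1)] by (auto simp: P_def generate.one inversions_def pos_root_V)
  moreover have "\<forall>w. P w \<longrightarrow> card (inversions w) < Suc (card D)"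
    using finD by (auto simp: P_def less_Suc_eq_le intro: card_mono)
  ultimately obtain w where Pw: "P w" and max: "\<And>v. P v \<Longrightarrow> card (inversions v) \<le> card (inversions w)"
    using ex_has_greatest_nat[of P \<one> "\<lambda>w. card (inversions w)"] by blast
  obtain a where w: "w \<in> generate G J" "a \<in> vertices" "w \<in> C_hom a z" "inversions w \<subseteq> D" using Pw
    by (auto simp: P_def)
  have wc: "w \<in> carrier G" "inv w \<in> carrier G" "inv w \<in> generate G J"
    using w C_hom_carrier generate_m_inv_closed[of J w] J gens_carrier by auto
  define \<phi> where "\<phi> = (\<lambda>v. \<sigma> (act (inv w) v))"
  have \<phi>_exp: "\<phi> v = (\<Sum>t\<in>supp v. v t * \<phi> (simple_root t))" if "v \<in> V" for v
    unfolding \<phi>_def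
    by (rule linear_expand) (use that \<sigma>lin act_lin[OF wc(2)] act_V[OF wc(2)] in \<open>auto simp: span_on_def\<close>)
  have \<phi>w: "\<phi> (act w v) = \<sigma> v" if "v \<in> V" for v using wc that by (simp add: \<phi>_def)
  have aJ: "supp_of a \<subseteq> J"
  proof
    fix s assume "s \<in> supp_of a"
    then obtain l where l: "l \<in> \<Lambda>" "s = a l" by blast
    then have "simple_root s = act w (simple_root (z l))" using C_hom_act[OF w(3)] by simp
    moreover have "simple_root (z l) \<in> span_on J" using z l simple_root_span by blast
    ultimately have "simple_root s \<in> span_on J" using act_span[OF J w(1)] by simp
    then show "s \<in> J" by (simp add: span_on_def)
  qed
  have \<phi>a: "\<phi> (simple_root s) = 0" if s: "s \<in> supp_of a" for s
  proof -
    obtain l where l: "l \<in> \<Lambda>" "s = a l" using s by blast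
    have lV: "simple_root (z l) \<in> V" using vertices_V z l by blast
    have "\<phi> (simple_root s) = \<sigma> (simple_root (z l))" using C_hom_act[OF w(3) l(1)] l \<phi>w[OF lV]
      by simp
    also have "\<dots> = (\<Sum>g\<in>F. pairing f (simple_root (z l)))" unfolding \<sigma>_def using Fix l
      by (intro sum.cong) auto
    finally show ?thesis using f(1) l by simp
  qed
  have dominant: "\<phi> (simple_root r) \<ge> 0" if r: "r \<in> J" for r
  proof (rule ccontr)
    assume "\<not> 0 \<le> \<phi> (simple_root r)"
    then have neg: "\<phi> (simple_root r) < 0" by simp
    then have ra: "r \<notin> supp_of a" using \<phi>a by force
    have rS: "r \<in> S" "simple_root r \<in> V" "simple_root r \<in> roots"
      using r J simple_root_span simple_root_root by auto
    let ?R = "rel_roots (insert r (supp_of a)) (supp_of a) \<inter> pos_roots"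
    have Rneg: "\<phi> \<beta> < 0" if b: "\<beta> \<in> ?R" for \<beta>
    proof -
      have bV: "\<beta> \<in> V" using b pos_root_V by blast
      have rs: "r \<in> supp \<beta>" "supp \<beta> \<subseteq> insert r (supp_of a)" using b
        by (auto simp: rel_roots_def roots_on_def)
      have "\<phi> \<beta> = (\<Sum>t\<in>supp \<beta>. \<beta> t * \<phi> (simple_root t))" using \<phi>_exp bV .
      also have "\<dots> = (\<Sum>t\<in>{r}. \<beta> t * \<phi> (simple_root t))"
        by (rule sum.mono_neutral_right) (use bV rs \<phi>a in \<open>auto simp: span_on_def\<close>)
      also have "\<dots> < 0"
      proof -
        have "\<beta> r > 0" using b rs(1) by (auto simp: supp_def pos_roots_def order_less_le)
        then show ?thesis using mult_pos_neg neg by simp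
      qed
      finally show ?thesis .
    qed
    \<comment> \<open>\<phi> is negative on these roots, so each one pulls back into D or is
      inverted by the inverse of w. Hence they are finitely many, and the step at r is
      defined.\<close>
    have "?R \<subseteq> act w ` D \<union> inversions (inv w)"
    proof
      fix \<beta> assume b: "\<beta> \<in> ?R"
      then have bV: "\<beta> \<in> V" "\<beta> \<in> pos_roots" using pos_root_V by auto
      show "\<beta> \<in> act w ` D \<union> inversions (inv w)"
      proof (cases "act (inv w) \<beta> \<in> pos_roots")
        case True
        then have "act (inv w) \<beta> \<in> D" using Rneg[OF b] by (simp add: D_def \<phi>_def)
        moreover have "\<beta> = act w (act (inv w) \<beta>)" using wc bV by simp
        ultimately show ?thesis by blast
      qed (use bV in \<open>simp add: inversions_def\<close>)
    qed
    then have "finite ?R" by (rule finite_subset) (use finD finite_inversions[OF wc(2)] in simp)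
    then have fin: "finite (rel_roots (insert r (supp_of a)) (supp_of a))"
      by (rule finite_rel_roots)
    have rJ: "insert r (supp_of a) \<subseteq> J" using r aJ by simp
    obtain a' where a': "a' \<in> vertices" "(a', rstep (supp_of a) r, a) \<in> edges_within J"
      "rstep (supp_of a) r \<in> C_hom a' a"
      using rank_one_edge_exists[OF w(2) rS(1) ra rJ fin] by blast
    have ft: "finite_type (comps_meeting (supp_of a) {r})"
      using finite_type_comps[of "supp_of a" "{r}"] supp_of_S[OF w(2)] rS ra fin by auto
    define e where "e = rstep (supp_of a) r"
    note p = rstep_props[OF supp_of_S[OF w(2)] rS(1) ra ft, folded e_def]
    have ie: "inversions e = ?R" using inversions_rank_one[OF supp_of_S[OF w(2)] rS(1) p] .
    have e: "e \<in> generate G J" "e \<in> carrier G" "e \<in> C_hom a' a"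
      using generate_mono[OF rJ p(1)] a' C_hom_carrier by (auto simp: e_def)
    \<comment> \<open>Composing with the step adds only inversions on which \<sigma> is negative
      and, as shown next, loses none; this contradicts the choice of w.\<close>
    have sub: "inversions (e \<otimes> w) \<subseteq> D"
    proof
      fix \<rho> assume r: "\<rho> \<in> inversions (e \<otimes> w)"
      then have rp: "\<rho> \<in> pos_roots" "\<rho> \<in> V" using inversions_pos pos_root_V by auto
      show "\<rho> \<in> D"
      proof (cases "act w \<rho> \<in> pos_roots")
        case True
        then have "act w \<rho> \<in> inversions e" using r wc e rp by (simp add: inversions_def act_mult)
        then have "\<phi> (act w \<rho>) < 0" unfolding ie by (rule Rneg)
        then show ?thesis using \<phi>w rp by (simp add: D_def)
      next
        case False
        then show ?thesis using rp w(4) by (auto simp: inversions_def)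
      qed
    qed
    have ne: "\<sigma> (\<lambda>r. - act (inv w) \<gamma> r) > 0" if "\<gamma> \<in> ?R" for \<gamma>
      using Rneg[OF that] \<sigma>neg[OF act_V[OF wc(2)]] that pos_root_V by (simp add: \<phi>_def)
    have sub2: "inversions w \<subseteq> inversions (e \<otimes> w)"
    proof
      fix \<rho> assume r: "\<rho> \<in> inversions w"
      then have rp: "\<rho> \<in> pos_roots" "\<rho> \<in> V" "\<sigma> \<rho> < 0" using inversions_pos pos_root_V w(4)
        by (auto simp: D_def)
      have n: "(\<lambda>q. - act w \<rho> q) \<in> pos_roots" using inversions_neg[OF wc(1) r] .
      show "\<rho> \<in> inversions (e \<otimes> w)"
      proof (rule ccontr)
        assume "\<rho> \<notin> inversions (e \<otimes> w)"
        then have "act e (act w \<rho>) \<in> pos_roots" using rp e wc by (simp add: inversions_def act_mult)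
        then have "act e (\<lambda>q. - act w \<rho> q) \<notin> pos_roots"
          using act_uminus[OF e(2) act_V[OF wc(1) rp(2)]] pos_not_neg by simp
        then have "(\<lambda>q. - act w \<rho> q) \<in> ?R" using n ie by (auto simp: inversions_def)
        then have "\<phi> (\<lambda>q. - act w \<rho> q) < 0" by (rule Rneg)
        moreover have "\<phi> (\<lambda>q. - act w \<rho> q) = - \<sigma> \<rho>"
          using act_uminus[OF wc(2) act_V[OF wc(1) rp(2)]] wc rp \<sigma>neg by (simp add: \<phi>_def)
        ultimately show False using rp by simp
      qed
    qed
    define \<rho> where "\<rho> = act (inv w) (simple_root r)"
    have rR: "simple_root r \<in> ?R" using ra rS simple_root_pos
      by (auto simp: rel_roots_def roots_on_def)
    have rho: "\<rho> \<in> roots" "\<rho> \<in> V" using act_root[OF wc(2) rS(3)] root_V by (auto simp: \<rho>_def)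
    have wrho: "act w \<rho> = simple_root r" using wc rS by (simp add: \<rho>_def)
    have "\<rho> \<in> pos_roots"
    proof (rule ccontr)
      assume "\<rho> \<notin> pos_roots"
      then have n: "(\<lambda>q. - \<rho> q) \<in> pos_roots" using not_pos_iff rho by blast
      have "act w (\<lambda>q. - \<rho> q) \<notin> pos_roots"
        using act_uminus[OF wc(1) rho(2)] wrho pos_not_neg[OF simple_root_pos[OF rS(1)]] by simp
      then have "(\<lambda>q. - \<rho> q) \<in> D" using n w(4) by (auto simp: inversions_def)
      then show False using ne[OF rR] by (simp add: D_def \<rho>_def)
    qed
    moreover have "act (e \<otimes> w) \<rho> \<notin> pos_roots"
    proof -
      have "simple_root r \<in> inversions e" unfolding ie by (rule rR)
      then show ?thesis using wrho e wc rho by (simp add: act_mult inversions_def)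
    qed
    ultimately have "\<rho> \<in> inversions (e \<otimes> w)" "\<rho> \<notin> inversions w"
      using wrho rR by (auto simp: inversions_def)
    then have "inversions w \<subset> inversions (e \<otimes> w)" using sub2 by blast
    then have "card (inversions w) < card (inversions (e \<otimes> w))"
      using finite_inversions[of "e \<otimes> w"] e wc by (intro psubset_card_mono) auto
    moreover have "P (e \<otimes> w)" using sub e w C_hom_mult[OF e(3) w(3) z(1)] a'
      by (auto simp: P_def intro: generate.eng)
    ultimately show False using max by (meson not_less)
  qed
  have wY: "w \<in> Y_hom a z"
    unfolding Y_hom_iff
  proof (intro conjI ballI impI)
    fix \<rho> assume r: "\<rho> \<in> pos_roots" "orth ?Z \<rho>"
    show "act w \<rho> \<in> pos_roots"
    proof (rule ccontr)
      assume "act w \<rho> \<notin> pos_roots"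
      then have "\<sigma> \<rho> < 0" using r w(4) by (auto simp: inversions_def D_def)
      \<comment> \<open>This is the use of \<open>dom\<close>: an orthogonal positive root stays
        positive under F or sums to 0, so w inverts none of them.\<close>
      moreover have "\<sigma> \<rho> \<ge> 0" using dom[OF r]
      proof
        assume "\<forall>r. (\<Sum>g\<in>F. act g \<rho> r) = 0"
        then have "T \<rho> = (\<lambda>_. 0)" by (simp add: T_def)
        then show ?thesis using \<sigma>T[of \<rho>] r pos_root_V by (simp add: pairing_def)
      qed (use \<sigma>pos in blast)
      ultimately show False by simp
    qed
  qed (rule w)
  \<comment> \<open>In N this is genericity. Off N, \<sigma> \<rho> is a sum of nonnegative terms,
    so every image of \<rho> under F is supported on the labels of z.\<close>
  have zero_pos: "supp (T \<rho>) \<subseteq> ?Z" if r: "\<rho> \<in> pos_roots" "\<sigma> \<rho> = 0" for \<rho>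
  proof (cases "\<rho> \<in> N")
    case True
    then show ?thesis using f(3)[of "T \<rho>"] \<sigma>T[OF pos_root_V[OF r(1)]] r by auto
  next
    case False
    then have all: "act g \<rho> \<in> pos_roots" if "g \<in> F" for g using that r
      by (auto simp: N_def inversions_def)
    have "\<forall>g \<in> F. pairing f (act g \<rho>) = 0"
      using r(2) unfolding \<sigma>_def
      by (subst (asm) sum_nonneg_eq_0_iff[OF F(1)]) (use ppos all in auto)
    then have "act g \<rho> s = 0" if "g \<in> F" "s \<notin> ?Z" for g s using pzero[OF all] that
      by (auto simp: supp_def)
    then have "T \<rho> s = 0" if "s \<notin> ?Z" for s using that by (simp add: T_def)
    then show ?thesis by (auto simp: supp_def)
  qed
  have zero: "supp (T \<rho>) \<subseteq> ?Z" if r: "\<rho> \<in> roots" "\<sigma> \<rho> = 0" for \<rho>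
  proof (cases "\<rho> \<in> pos_roots")
    case False
    have rV: "\<rho> \<in> V" using r root_V by blast
    have n: "(\<lambda>q. - \<rho> q) \<in> pos_roots" "\<sigma> (\<lambda>q. - \<rho> q) = 0" using False not_pos_iff r \<sigma>neg rV by auto
    have "T (\<lambda>q. - \<rho> q) = (\<lambda>q. - T \<rho> q)"
      unfolding T_def using act_uminus[OF _ rV] Fc
      by (auto simp: fun_eq_iff sum_negf[symmetric] intro!: sum.cong)
    then show ?thesis using zero_pos[OF n] by (simp add: supp_def)
  qed (use zero_pos r in blast)
  have zero_span: "\<exists>c d. \<exists>v \<in> span_on ?Z. \<rho> = (\<lambda>r. c * b1 r + d * b2 r + v r)" if r: "\<rho> \<in> roots"
    "\<sigma> \<rho> = 0" for \<rho>
  proof -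
    have rV: "\<rho> \<in> V" using r root_V by blast
    obtain C D' where CD: "\<And>g. g \<in> F \<Longrightarrow> act g \<rho> = (\<lambda>r. \<rho> r + C g * b1 r + D' g * b2 r)"
      using span[OF _ rV] by metis
    define n where "n = real (card F)"
    have n: "n > 0" using F by (auto simp: n_def card_gt_0_iff)
    \<comment> \<open>Summation over F gives n \<rho> up to a combination of b1 and b2. As T \<rho>
      is supported on the labels of z, dividing by n expresses \<rho> through these and the two
      roots.\<close>
    have T: "T \<rho> r = n * \<rho> r + sum C F * b1 r + sum D' F * b2 r" for r
    proof -
      have "T \<rho> r = (\<Sum>g\<in>F. \<rho> r + C g * b1 r + D' g * b2 r)" unfolding T_def using CD
        by (intro sum.cong) auto
      then show ?thesis by (simp add: sum.distrib sum_distrib_right n_def)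
    qed
    define v where "v = (\<lambda>r. (1 / n) * T \<rho> r)"
    have "T \<rho> \<in> span_on ?Z" using zero[OF r] TV[OF rV] by (simp add: span_on_def)
    then have v: "v \<in> span_on ?Z" unfolding v_def by (rule span_on_scale)
    have "\<rho> r = (- sum C F / n) * b1 r + (- sum D' F / n) * b2 r + v r" for r
      using T[of r] n by (simp add: v_def field_simps)
    then show ?thesis using v by blast
  qed
  \<comment> \<open>The type of the face containing the dominant functional \<phi>: \<phi> kills the
    roots on K, and a positive root on J killed by \<phi> is supported on K, since the terms of its
    expansion are nonnegative.\<close>
  define K where "K = {r \<in> J. \<phi> (simple_root r) = 0}"
  have \<phi>K: "\<phi> \<beta> = 0" if "\<beta> \<in> V" "supp \<beta> \<subseteq> K" for \<beta>
    using \<phi>_exp[OF that(1)] that(2) by (auto simp: K_def intro!: sum.neutral)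
  have bK: "act w \<beta> \<in> roots_on K" if b: "\<beta> \<in> pos_roots" "\<beta> \<in> roots_on J" "orth ?Z \<beta>"
    "\<And>r. (\<Sum>g\<in>F. act g \<beta> r) = 0" for \<beta>
  proof -
    have bV: "\<beta> \<in> V" using b pos_root_V by blast
    have wp: "act w \<beta> \<in> pos_roots" using Y_hom_pos[OF wY b(1,3)] .
    have wJ: "act w \<beta> \<in> roots_on J" using roots_on_act[OF J w(1) b(2)] .
    have wV: "act w \<beta> \<in> V" "finite (supp (act w \<beta>))" using wp pos_root_V by (auto simp: span_on_def)
    have "T \<beta> = (\<lambda>_. 0)" using b(4) by (simp add: T_def)
    then have "\<phi> (act w \<beta>) = 0" using \<phi>w[OF bV] \<sigma>T[OF bV] by (simp add: pairing_def)
    then have s0: "(\<Sum>t\<in>supp (act w \<beta>). act w \<beta> t * \<phi> (simple_root t)) = 0" using \<phi>_exp[OF wV(1)]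
      by simp
    have "\<forall>t \<in> supp (act w \<beta>). act w \<beta> t * \<phi> (simple_root t) = 0"
    proof (subst sum_nonneg_eq_0_iff[OF wV(2), symmetric])
      fix t assume "t \<in> supp (act w \<beta>)"
      then have "t \<in> J" using wJ by (auto simp: roots_on_def)
      then show "0 \<le> act w \<beta> t * \<phi> (simple_root t)" using dominant wp by (simp add: pos_roots_def)
    qed (rule s0)
    then show ?thesis using wJ by (auto simp: roots_on_def K_def supp_def)
  qed
  have "\<exists>c d. \<exists>v \<in> span_on (supp_of a). simple_root r = (\<lambda>q. c * act w b1 q + d * act w b2 q + v q)"
    if r: "r \<in> K" for r
  proof -
    have rS: "simple_root r \<in> V" "simple_root r \<in> roots" using r J simple_root_span simple_root_root
      by (auto simp: K_def)
    define \<rho> where "\<rho> = act (inv w) (simple_root r)"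
    have "\<rho> \<in> roots" "\<sigma> \<rho> = 0" using act_root[OF wc(2) rS(2)] r by (auto simp: \<rho>_def K_def \<phi>_def)
    then obtain c d v where cd: "v \<in> span_on ?Z" "\<rho> = (\<lambda>r. c * b1 r + d * b2 r + v r)"
      using zero_span by metis
    have V: "b1 \<in> V" "b2 \<in> V" "v \<in> V" "(\<lambda>r. c * b1 r + d * b2 r) \<in> V"
      using b pos_root_V span_on_mono[OF zS cd(1)] span_on_lin by auto
    have "simple_root r = act w \<rho>" using wc rS by (simp add: \<rho>_def)
    also have "\<dots> = act w (\<lambda>r. 1 * (c * b1 r + d * b2 r) + 1 * v r)" by (simp add: cd(2))
    also have "\<dots> = (\<lambda>q. 1 * act w (\<lambda>r. c * b1 r + d * b2 r) q + 1 * act w v q)"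
      by (rule act_lin[OF wc(1) V(4,3)])
    also have "\<dots> = (\<lambda>q. c * act w b1 q + d * act w b2 q + act w v q)"
      by (simp add: act_lin[OF wc(1) V(1,2)])
    finally have "simple_root r = (\<lambda>q. c * act w b1 q + d * act w b2 q + act w v q)" .
    moreover have "act w v \<in> span_on (supp_of a)"
      using simple_img_span[OF wc(1) zS C_hom_simple_map(1)[OF w(3,2)] cd(1)] C_hom_simple_map(2)[OF w(3,2)] by simp
    ultimately show ?thesis by blast
  qed
  moreover have "finite (rel_roots K (supp_of a))"
  proof (rule finite_subset)
    show "rel_roots K (supp_of a) \<subseteq> act w ` (N \<union> (\<lambda>\<beta> r. - \<beta> r) ` N)"
    proof
      fix \<beta> assume bb: "\<beta> \<in> rel_roots K (supp_of a)"
      then have bV: "\<beta> \<in> roots" "\<beta> \<in> V" using root_V by (auto simp: rel_roots_def roots_on_def)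
      define \<rho> where "\<rho> = act (inv w) \<beta>"
      have r: "\<rho> \<in> roots" "\<rho> \<in> V" "\<beta> = act w \<rho>" using act_root act_V wc bV by (auto simp: \<rho>_def)
      have "\<sigma> \<rho> = 0" using \<phi>K[OF bV(2)] bb by (simp add: \<phi>_def \<rho>_def rel_roots_def roots_on_def)
      \<comment> \<open>Off N all images under F are positive with value 0 under f, in particular
        \<tau> itself because F contains \<open>\<one>\<close>; then \<tau> would be supported on
        the labels of z.\<close>
      have inN: "\<tau> \<in> N" if t: "\<tau> \<in> pos_roots" "\<sigma> \<tau> = 0" "\<not> supp \<tau> \<subseteq> ?Z" for \<tau>
      proof (rule ccontr)
        assume "\<tau> \<notin> N"
        then have all: "act g \<tau> \<in> pos_roots" if "g \<in> F" for g using that t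
          by (auto simp: N_def inversions_def)
        have "\<forall>g \<in> F. pairing f (act g \<tau>) = 0"
          using t(2) unfolding \<sigma>_def
          by (subst (asm) sum_nonneg_eq_0_iff[OF F(1)]) (use ppos all in auto)
        then have "pairing f \<tau> = 0" using F(2) pos_root_V[OF t(1)] by force
        then show False using pzero[OF t(1)] t by blast
      qed
      have nz: "\<not> supp \<rho> \<subseteq> ?Z"
      proof
        assume "supp \<rho> \<subseteq> ?Z"
        then have "\<rho> \<in> span_on ?Z" using r by (simp add: span_on_def)
        then have "\<beta> \<in> span_on (supp_of a)"
          using simple_img_span[OF wc(1) zS C_hom_simple_map(1)[OF w(3,2)]] C_hom_simple_map(2)[OF w(3,2)] r by simp
        then show False using bb by (simp add: rel_roots_def span_on_def)
      qed
      show "\<beta> \<in> act w ` (N \<union> (\<lambda>\<beta> r. - \<beta> r) ` N)"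
      proof (cases "\<rho> \<in> pos_roots")
        case True
        then show ?thesis using inN[of \<rho>] nz \<open>\<sigma> \<rho> = 0\<close> r by blast
      next
        case False
        have "supp (\<lambda>q. - \<rho> q) = supp \<rho>" by (simp add: supp_def)
        then have "(\<lambda>q. - \<rho> q) \<in> N"
          using inN[of "\<lambda>q. - \<rho> q"] not_pos_iff[OF r(1)] False nz \<sigma>neg[OF r(2)] \<open>\<sigma> \<rho> = 0\<close> by simp
        then have "\<rho> \<in> (\<lambda>\<beta> r. - \<beta> r) ` N" by (force intro: image_eqI[of _ _ "\<lambda>q. - \<rho> q"])
        then show ?thesis using r by blast
      qed
    qed
    show "finite (act w ` (N \<union> (\<lambda>\<beta> r. - \<beta> r) ` N))" using finN by simp
  qed
  moreover have "K \<subseteq> J" "supp_of a \<subseteq> K" using \<phi>a aJ by (auto simp: K_def)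
  ultimately show ?thesis using w wY bK[OF b(1-3) avg(1)] bK[OF b(4-6) avg(2)] by blast
qed

end

lemma (in group) inv_mult_cancel: "v \<in> carrier G \<Longrightarrow> c \<in> carrier G \<Longrightarrow> inv v \<otimes> (v \<otimes> c) = c"
  by (simp flip: m_assoc)

lemma (in group) ord_conj:
  assumes v: "v \<in> carrier G" and a: "a \<in> carrier G"
  shows "ord (v \<otimes> a \<otimes> inv v) = ord a"
proof -
  have pow: "(v \<otimes> a \<otimes> inv v) [^] n = v \<otimes> a [^] n \<otimes> inv v" for n :: nat
  proof (induction n)
    case (Suc n)
    have "(v \<otimes> a \<otimes> inv v) [^] Suc n = v \<otimes> a [^] n \<otimes> (inv v \<otimes> v) \<otimes> a \<otimes> inv v"
      using v a Suc by (simp add: m_assoc inv_mult_cancel)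
    then show ?case using v a by (simp add: m_assoc)
  qed (use v in simp)
  have "v \<otimes> b \<otimes> inv v = \<one> \<longleftrightarrow> b = \<one>" if "b \<in> carrier G" for b
  proof
    assume "v \<otimes> b \<otimes> inv v = \<one>"
    then have "inv v \<otimes> (v \<otimes> b \<otimes> inv v) \<otimes> v = inv v \<otimes> v" using v by simp
    then show "b = \<one>" using v that by (simp add: m_assoc) (simp add: m_assoc[symmetric])
  qed (use v in simp)
  then have "\<forall>n. (v \<otimes> a \<otimes> inv v) [^] n = \<one> \<longleftrightarrow> ord a dvd n" using a pow pow_eq_id by simp
  then show ?thesis using ord_unique[of "v \<otimes> a \<otimes> inv v" "ord a"] v a by simp
qed

context coxeter_groupoid begin

section \<open>Reflection pairs\<close>

abbreviation tree_elt_of :: "('l \<Rightarrow> 'a, 'a) arrow set \<Rightarrow> ('l \<Rightarrow> 'a) \<Rightarrow> ('l \<Rightarrow> 'a) \<Rightarrow> 'a" where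
  "tree_elt_of TE x y \<equiv> path_elt (tree_path TE x y)"

lemma loop_genD:
  assumes "u \<in> loop_gens"
  shows "u \<in> edges" "tgt u = src u" "src u \<in> vertices" "elt u \<in> carrier G" "elt u \<otimes> elt u = \<one>"
proof -
  show u: "u \<in> edges" "tgt u = src u" using assms by (auto simp: loop_gens_def)
  then show "src u \<in> vertices" "elt u \<in> carrier G" using edge_src edge_carrier by blast+
  then show "elt u \<otimes> elt u = \<one>" using loop_inv(1)[OF u] by (metis r_inv)
qed

lemma based_elt_eq:
  assumes T: "maximal_tree TV TE" and x: "x \<in> vertices" and yz: "y \<in> vertices" "z \<in> vertices"
    and q: "set q \<subseteq> edges"
  shows "based_elt TE x z q y = tree_elt_of TE x z \<otimes> path_elt q \<otimes> inv (tree_elt_of TE x y)"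
proof -
  have s: "set (tree_path TE x z) \<subseteq> edges" "set (tree_path TE y x) \<subseteq> edges"
    using tree_elt(2)[OF T] x yz by auto
  have c: "tree_elt_of TE x z \<in> carrier G" "tree_elt_of TE y x \<in> carrier G" "path_elt q \<in> carrier G"
    using s q path_elt_carrier by auto
  show ?thesis using s q c path_elt_append tree_elt(3)[OF T x yz(1)]
    by (simp add: based_elt_def m_assoc)
qed

text \<open>The pair \<open>(w, u)\<close> is encoded by the arrow \<open>w p\<^bsub>x,z\<^esub>\<close> of \<open>Y\<close>, where \<open>z\<close> is the vertex of \<open>u\<close>.\<close>

lemma refl_of_eq:
  assumes T: "maximal_tree TV TE" and x: "x \<in> vertices" and wu: "(w, u) \<in> refl_pairs x"
    and v: "v = w \<otimes> tree_elt_of TE x (src u)"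
  shows "refl_of TE x (w, u) = v \<otimes> elt u \<otimes> inv v" "v \<in> Y_hom x (src u)"
proof -
  have w: "w \<in> Y_hom x x" "u \<in> loop_gens" using wu by (auto simp: refl_pairs_def)
  note u = loop_genD[OF w(2)]
  have P: "tree_elt_of TE x (src u) \<in> Y_hom x (src u)" using tree_elt(1)[OF T x u(3)] .
  have c: "w \<in> carrier G" "tree_elt_of TE x (src u) \<in> carrier G" using w P Y_hom_carrier by auto
  show "v \<in> Y_hom x (src u)" unfolding v using Y_hom_mult[OF w(1) P x u(3)] .
  show "refl_of TE x (w, u) = v \<otimes> elt u \<otimes> inv v"
    using based_elt_eq[OF T x u(3,3), of "[u]"] u c by (simp add: v inv_mult_group m_assoc)
qed

lemma pair_of_arrow:
  assumes T: "maximal_tree TV TE" and x: "x \<in> vertices" and u: "u \<in> loop_gens"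
    and v: "v \<in> Y_hom x (src u)"
  shows "(v \<otimes> inv (tree_elt_of TE x (src u)), u) \<in> refl_pairs x"
    "v \<otimes> inv (tree_elt_of TE x (src u)) \<otimes> tree_elt_of TE x (src u) = v"
proof -
  note ug = loop_genD[OF u]
  have P: "tree_elt_of TE x (src u) \<in> Y_hom x (src u)" using tree_elt(1)[OF T x ug(3)] .
  show "(v \<otimes> inv (tree_elt_of TE x (src u)), u) \<in> refl_pairs x"
    using Y_hom_mult[OF v Y_hom_inv[OF P x ug(3)] ug(3) x] u by (simp add: refl_pairs_def)
  show "v \<otimes> inv (tree_elt_of TE x (src u)) \<otimes> tree_elt_of TE x (src u) = v"
    using v P Y_hom_carrier by (simp add: m_assoc)
qed

text \<open>For the encoding arrows v' = v q, so the product of the reflections is the conjugate by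
  v of the element of the tour.\<close>

lemma tour_relD:
  assumes T: "maximal_tree TV TE" and x: "x \<in> vertices" and r: "tour_rel TE x k (w, u) (w', u')"
  shows "ord (refl_of TE x (w, u) \<otimes> refl_of TE x (w', u')) = k"
proof -
  have wu: "(w, u) \<in> refl_pairs x" "(w', u') \<in> refl_pairs x" using r by simp_all
  then have ug: "u \<in> loop_gens" "u' \<in> loop_gens" by (auto simp: refl_pairs_def)
  note u = loop_genD[OF ug(1)] and u' = loop_genD[OF ug(2)]
  obtain v0 s t q where q: "arrow_path (comp_edges v0 s t) (src u) q (src u')"
    "ord (path_elt (u # q @ u' # inv_path q)) = k" "w' = w \<otimes> based_elt TE x (src u) q (src u')"
    using r by auto
  have "comp_edges v0 s t \<subseteq> edges" using edges_within_edges unfolding comp_edges_def by blast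
  then have qe: "set q \<subseteq> edges" using arrow_path_set[OF q(1)] by blast
  define v v' where "v = w \<otimes> tree_elt_of TE x (src u)" and "v' = w' \<otimes> tree_elt_of TE x (src u')"
  note e = refl_of_eq[OF T x wu(1) v_def] and e' = refl_of_eq[OF T x wu(2) v'_def]
  have c: "w \<in> carrier G" "w' \<in> carrier G" "tree_elt_of TE x (src u) \<in> carrier G"
    "tree_elt_of TE x (src u') \<in> carrier G"
      "v \<in> carrier G" "path_elt q \<in> carrier G"
    using wu tree_elt(1)[OF T x] u u' e Y_hom_carrier path_elt_carrier qe
    by (auto simp: refl_pairs_def)
  have v': "v' = v \<otimes> path_elt q"
    using based_elt_eq[OF T x u'(3) u(3) qe] q(3) c by (simp add: v'_def v_def m_assoc)
  have iq: "set (inv_path q) \<subseteq> edges" using qe flip_edge by (auto simp: inv_path_def)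
  have "path_elt (u # q @ u' # inv_path q) = elt u \<otimes> (path_elt q \<otimes> (elt u' \<otimes> inv (path_elt q)))"
    using qe iq u u' path_elt_append[of q "u' # inv_path q"] path_elt_inv[OF qe] by simp
  moreover have "refl_of TE x (w, u) \<otimes> refl_of TE x (w', u') =
      v \<otimes> (elt u \<otimes> (path_elt q \<otimes> (elt u' \<otimes> inv (path_elt q)))) \<otimes> inv v"
  proof -
    have "refl_of TE x (w, u) \<otimes> refl_of TE x (w', u') =
        v \<otimes> elt u \<otimes> (inv v \<otimes> v) \<otimes> path_elt q \<otimes> elt u' \<otimes> inv (path_elt q) \<otimes> inv v"
      unfolding e(1) e'(1) v' using c u u' by (simp add: inv_mult_group m_assoc inv_mult_cancel)
    then show ?thesis using c u u' by (simp add: m_assoc)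
  qed
  ultimately show ?thesis
    using q(2) ord_conj[of v "elt u \<otimes> (path_elt q \<otimes> (elt u' \<otimes> inv (path_elt q)))"] c u u' by simp
qed

lemma refl_of_invol:
  assumes T: "maximal_tree TV TE" and x: "x \<in> vertices" and wu: "(w, u) \<in> refl_pairs x"
  shows "refl_of TE x (w, u) \<in> carrier G" "refl_of TE x (w, u) \<otimes> refl_of TE x (w, u) = \<one>"
proof -
  have "u \<in> loop_gens" using wu by (simp add: refl_pairs_def)
  note u = loop_genD[OF this]
  note e = refl_of_eq[OF T x wu HOL.refl]
  define v where "v = w \<otimes> tree_elt_of TE x (src u)"
  have v: "v \<in> carrier G" using e(2) Y_hom_carrier by (simp add: v_def)
  have r: "refl_of TE x (w, u) = v \<otimes> elt u \<otimes> inv v" using e(1) by (simp add: v_def)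
  show "refl_of TE x (w, u) \<in> carrier G" unfolding r using v u by simp
  have "v \<otimes> elt u \<otimes> inv v \<otimes> (v \<otimes> elt u \<otimes> inv v) = v \<otimes> (elt u \<otimes> (inv v \<otimes> v) \<otimes> elt u) \<otimes> inv v"
    using v u by (simp only: m_assoc m_closed inv_closed)
  then show "refl_of TE x (w, u) \<otimes> refl_of TE x (w, u) = \<one>" unfolding r using v u by simp
qed

text \<open>A tour of order 1 makes the product of two involutions trivial, so they agree.\<close>

lemma tour_equiv_refl_of:
  assumes T: "maximal_tree TV TE" and x: "x \<in> vertices" and ab: "tour_equiv TE x a b"
  shows "refl_of TE x a = refl_of TE x b"
proof -
  have one: "refl_of TE x a = refl_of TE x b" if r: "tour_rel TE x 1 a b" for a b
  proof -
    obtain w u w' u' where ab: "a = (w, u)" "b = (w', u')" by (cases a, cases b) auto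
    have p: "(w, u) \<in> refl_pairs x" "(w', u') \<in> refl_pairs x" using r ab by simp_all
    note i = refl_of_invol[OF T x p(1)] and i' = refl_of_invol[OF T x p(2)]
    have "refl_of TE x (w, u) \<otimes> refl_of TE x (w', u') = \<one>"
      using tour_relD[OF T x, of 1 w u w' u'] r ab ord_eq_1 i i' by simp
    then have "refl_of TE x (w, u) = inv (refl_of TE x (w', u'))" using i i' inv_equality[symmetric]
      by blast
    moreover have "inv (refl_of TE x (w', u')) = refl_of TE x (w', u')" using i' inv_equality
      by blast
    ultimately show ?thesis using ab by simp
  qed
  have "equivclp (tour_rel TE x 1) a b" using ab by (simp add: tour_equiv_def)
  then show ?thesis
  proof (induction rule: equivclp_induct)
    case (step y z)
    then show ?case using one[of y z] one[of z y] by metis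
  qed (rule HOL.refl)
qed

text \<open>Produces related pairs from any path without loops between two loops of a rank two
  component; \<open>tour_exists\<close> replaces the path by the simple one with the same
  element.\<close>

lemma tour_relI:
  assumes T: "maximal_tree TV TE" and x: "x \<in> vertices"
    and r2: "rank_two J y" and J: "J = supp_of y \<union> {s, t}" "s \<noteq> t" "s \<notin> supp_of y" "t \<notin> supp_of y"
    and e1: "e1 \<in> edges_within J" "tgt e1 = y" "src e1 = y" and e2: "e2 \<in> edges_within J"
      "tgt e2 = z" "src e2 = z"
    and p: "arrow_path (edges_within J) y p z" "\<forall>e \<in> set p. tgt e \<noteq> src e"
      and ne: "e1 = e2 \<Longrightarrow> path_elt p \<noteq> \<one>"
    and v: "v \<in> Y_hom x y"
    and k: "ord (elt e1 \<otimes> (path_elt p \<otimes> elt e2 \<otimes> inv (path_elt p))) = k" "k \<ge> 1"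
  shows "tour_rel TE x k (v \<otimes> inv (tree_elt_of TE x y), e1) (v \<otimes> path_elt p \<otimes> inv (tree_elt_of TE x z), e2)"
proof -
  have yv: "y \<in> vertices" "z \<in> vertices" using r2 edge_src[OF e2(1)] e2 by (auto simp: rank_two_def)
  obtain q where q: "path_elt q = path_elt p" "arrow_path (comp_edges y s t) y q z"
    "shuttling_tour y s t (e1 # q @ e2 # inv_path q)" using tour_exists[OF r2 J e1 e2 p ne] by blast
  have "comp_edges y s t \<subseteq> edges" using edges_within_edges unfolding comp_edges_def by blast
  then have qe: "set q \<subseteq> edges" using arrow_path_set[OF q(2)] by blast
  have iq: "set (inv_path q) \<subseteq> edges" using qe flip_edge by (auto simp: inv_path_def)
  have l: "e1 \<in> loop_gens" "e2 \<in> loop_gens" using e1 e2 edges_within_edges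
    by (auto simp: loop_gens_def)
  note l1 = loop_genD[OF l(1)] and l2 = loop_genD[OF l(2)]
  have qc: "path_elt q \<in> carrier G" using path_elt_carrier qe by blast
  have pY: "path_elt p \<in> Y_hom y z" using path_Y[OF p(1) yv(2) p(2)] .
  have vp: "v \<otimes> path_elt p \<in> Y_hom x z" using Y_hom_mult[OF v pY yv] .
  have pr: "(v \<otimes> inv (tree_elt_of TE x y), e1) \<in> refl_pairs x"
    "(v \<otimes> path_elt p \<otimes> inv (tree_elt_of TE x z), e2) \<in> refl_pairs x"
    using pair_of_arrow(1)[OF T x l(1), of v] pair_of_arrow(1)[OF T x l(2), of "v \<otimes> path_elt p"] e1 e2 v vp by simp_all
  have elt: "path_elt (e1 # q @ e2 # inv_path q) = elt e1 \<otimes> (path_elt p \<otimes> elt e2 \<otimes> inv (path_elt p))"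
    using qe iq l1 l2 path_elt_append[of q "e2 # inv_path q"] path_elt_inv[OF qe] q(1) qc
    by (simp add: m_assoc)
  have c: "v \<in> carrier G" "tree_elt_of TE x y \<in> carrier G" "tree_elt_of TE x z \<in> carrier G"
    using v tree_elt(1)[OF T x] yv Y_hom_carrier by blast+
  have "v \<otimes> path_elt p \<otimes> inv (tree_elt_of TE x z) = v \<otimes> inv (tree_elt_of TE x y) \<otimes> based_elt TE x y q z"
  proof -
    have "v \<otimes> inv (tree_elt_of TE x y) \<otimes> based_elt TE x y q z
      = v \<otimes> (inv (tree_elt_of TE x y) \<otimes> tree_elt_of TE x y) \<otimes> path_elt q \<otimes> inv (tree_elt_of TE x z)"
      unfolding based_elt_eq[OF T x yv(2,1) qe] using c qc
      by (simp only: m_assoc m_closed inv_closed)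
    then show ?thesis using c q(1) by simp
  qed
  then show ?thesis unfolding tour_rel.simps e1(3) e2(3) using pr k elt q(2,3) by metis
qed

section \<open>Equality of reflections\<close>

text \<open>The simple roots of the root system orthogonal to the labels of z, described without
  generators: the reflection inverts no other positive root of this system. In this form the notion
  is invariant under Y.\<close>

definition orth_simple :: "('l \<Rightarrow> 'a) \<Rightarrow> ('a \<Rightarrow> real) \<Rightarrow> bool" where
  "orth_simple z \<delta> \<longleftrightarrow> \<delta> \<in> pos_roots \<and> orth (supp_of z) \<delta> \<and>
     (\<forall>\<rho> \<in> pos_roots. orth (supp_of z) \<rho> \<longrightarrow> act (root_refl \<delta>) \<rho> \<notin> pos_roots \<longrightarrow> \<rho> = \<delta>)"

text \<open>The loop inverts only roots supported on the enlarged index set, and there only one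
  positive root is orthogonal to the labels.\<close>

lemma orth_simple_loop:
  assumes y: "y \<in> vertices" and s: "s \<in> S" "s \<notin> supp_of y"
    and g: "\<gamma> \<in> pos_roots" "\<gamma> \<in> roots_on (insert s (supp_of y))" "orth (supp_of y) \<gamma>"
  shows "orth_simple y \<gamma>"
  unfolding orth_simple_def
proof (intro conjI ballI impI)
  fix \<rho> assume r: "\<rho> \<in> pos_roots" "orth (supp_of y) \<rho>" "act (root_refl \<gamma>) \<rho> \<notin> pos_roots"
  have J: "insert s (supp_of y) \<subseteq> S" using s supp_of_S[OF y] by simp
  have "\<rho> \<in> roots_on (insert s (supp_of y))"
    using inversions_generate[OF J root_refl_generate(2)[OF J g(2)]] r
    by (auto simp: inversions_def)
  then show "\<rho> = \<gamma>" using orth_root_unique[OF supp_of_S[OF y] s r(1) _ r(2) g] by blast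
qed (use g in auto)

text \<open>An arrow of Y identifies the positive orthogonal roots at its two ends and conjugates
  the reflections accordingly.\<close>

lemma orth_simple_act:
  assumes w: "w \<in> Y_hom z y" and zy: "z \<in> vertices" "y \<in> vertices" and g: "orth_simple y \<gamma>"
  shows "orth_simple z (act w \<gamma>)"
  unfolding orth_simple_def
proof (intro conjI ballI impI)
  have gg: "\<gamma> \<in> pos_roots" "orth (supp_of y) \<gamma>" "\<gamma> \<in> roots" "\<gamma> \<in> V" using g pos_root pos_root_V
    by (auto simp: orth_simple_def)
  have wc: "w \<in> carrier G" using Y_hom_carrier[OF w] .
  show "act w \<gamma> \<in> pos_roots" "orth (supp_of z) (act w \<gamma>)"
    using Y_hom_pos[OF w] Y_hom_orth[OF w zy(2)] gg by auto
  fix \<rho> assume r: "\<rho> \<in> pos_roots" "orth (supp_of z) \<rho>" "act (root_refl (act w \<gamma>)) \<rho> \<notin> pos_roots"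
  have rV: "\<rho> \<in> V" "\<rho> \<in> roots" using r pos_root_V pos_root by auto
  define \<tau> where "\<tau> = act (inv w) \<rho>"
  note iw = Y_hom_inv[OF w zy]
  have t: "\<tau> \<in> pos_roots" "orth (supp_of y) \<tau>" "\<tau> \<in> V" "\<tau> \<in> roots"
    using Y_hom_pos[OF iw r(1,2)] Y_hom_orth[OF iw zy(1) rV(1) r(2)] pos_root_V pos_root
    by (auto simp: \<tau>_def)
  have wt: "\<rho> = act w \<tau>" using wc rV by (simp add: \<tau>_def)
  have "act (root_refl (act w \<gamma>)) \<rho> = act w (act (root_refl \<gamma>) \<tau>)"
    using root_refl_conj[OF wc gg(3), symmetric] wc gg rV by (simp add: act_mult act_V \<tau>_def)
  then have "act w (act (root_refl \<gamma>) \<tau>) \<notin> pos_roots" using r by simp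
  moreover have "act (root_refl \<gamma>) \<tau> \<in> pos_roots \<Longrightarrow> act w (act (root_refl \<gamma>) \<tau>) \<in> pos_roots"
  proof (rule Y_hom_pos[OF w])
    have "root_refl \<gamma> \<in> C_hom y y" using root_refl_orth_fix[OF gg(3,2) supp_of_S[OF zy(2)]] gg
      by (auto simp: C_hom_def)
    then show "orth (supp_of y) (act (root_refl \<gamma>) \<tau>)" using C_hom_orth zy t by blast
  qed
  ultimately have "act (root_refl \<gamma>) \<tau> \<notin> pos_roots" by blast
  then have "\<tau> = \<gamma>" using g t by (auto simp: orth_simple_def)
  then show "\<rho> = act w \<gamma>" using wt by simp
qed

lemma loop_orth_simple:
  assumes "u \<in> loop_gens"
  obtains s \<gamma> where "s \<in> S" "s \<notin> supp_of (src u)" "\<gamma> \<in> pos_roots"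
    "\<gamma> \<in> roots_on (insert s (supp_of (src u)))"
    "orth (supp_of (src u)) \<gamma>" "elt u = root_refl \<gamma>" "orth_simple (src u) \<gamma>"
  using loop_root[of u S] loop_genD[OF assms] orth_simple_loop by metis

text \<open>Neither g nor its inverse makes the simple root of the further index negative, since the
  root of the loop would be inverted with it. As that simple root is a combination of \<delta> and
  the labels, its image lies in the span of s and the labels of y; it is simple by
  indecomposability, and it is not a label because the labels of y come from those of z.\<close>

lemma loop_transport:
  assumes yz: "y \<in> vertices" "z \<in> vertices" and g: "g \<in> Y_hom y z"
    and s: "s \<in> S" "s \<notin> supp_of y" and s': "s' \<in> S" "s' \<notin> supp_of z"
    and c: "\<gamma> \<in> pos_roots" "\<gamma> \<in> roots_on (insert s (supp_of y))" "orth (supp_of y) \<gamma>"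
    and d: "\<delta> \<in> pos_roots" "\<delta> \<in> roots_on (insert s' (supp_of z))" "orth (supp_of z) \<delta>"
    and gd: "act g \<delta> = \<gamma>"
  shows "act g (simple_root s') = simple_root s"
proof -
  have up: "act h (simple_root r') \<in> pos_roots"
    if h: "h \<in> C_hom y z" "y \<in> vertices" "z \<in> vertices" and r: "r' \<in> S" and \<delta>: "\<delta> \<in> pos_roots"
      "\<delta> \<in> roots_on (insert r' (supp_of z))"
      "orth (supp_of z) \<delta>" "act h \<delta> \<in> pos_roots" for h r' \<delta> and y z :: "'l \<Rightarrow> 'a"
  proof (rule ccontr)
    assume n: "act h (simple_root r') \<notin> pos_roots"
    have "\<not> supp \<delta> \<subseteq> supp_of z"
    proof
      assume "supp \<delta> \<subseteq> supp_of z"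
      then have "\<delta> \<in> span_on (supp_of z)" using pos_root_V[OF \<delta>(1)] by (simp add: span_on_def)
      then show False using root_orth_span[OF supp_of_S[OF h(3)] pos_root[OF \<delta>(1)] \<delta>(3)] by blast
    qed
    then have "\<delta> \<in> inversions h"
      using rel_roots_inversions[OF C_hom_carrier[OF h(1)] supp_of_S[OF h(3)] C_hom_simple_map(1)[OF h(1,2)] r n] \<delta>
      by (auto simp: rel_roots_def)
    then show False using \<delta> by (simp add: inversions_def)
  qed
  have gc: "g \<in> carrier G" "inv g \<in> carrier G" using Y_hom_carrier[OF g] by auto
  have gC: "g \<in> C_hom y z" "inv g \<in> C_hom z y" using Y_hom_C g Y_hom_inv yz by blast+
  have igc: "act (inv g) \<gamma> = \<delta>" using gd gc d pos_root_V by auto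
  have sV: "simple_root s' \<in> V" "simple_root s \<in> V" using s s' simple_root_span by auto
  have p1: "act g (simple_root s') \<in> pos_roots" using up[OF gC(1) yz s'(1) d] gd c by simp
  have p2: "act (inv g) (simple_root s) \<in> pos_roots" using up[OF gC(2) yz(2,1) s(1) c] igc d by simp
  let ?A = "insert s (supp_of y)"
  have AS: "?A \<subseteq> S" using s supp_of_S[OF yz(1)] by auto
  have img: "act g (simple_root a) \<in> span_on (supp_of y)" if "a \<in> supp_of z" for a
    using that C_hom_act[OF gC(1)] simple_root_span by auto
  text \<open>The simple root at \<open>s'\<close> is a combination of \<open>\<delta>\<close> and the simple roots in \<open>[z]\<close>.\<close>
  have ds: "\<delta> s' \<noteq> 0"
  proof
    assume "\<delta> s' = 0"
    then have "\<delta> \<in> span_on (supp_of z)" using roots_on_span[OF d(2)]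
      by (auto simp: span_on_def supp_def)
    then show False using root_orth_span[OF supp_of_S[OF yz(2)] pos_root[OF d(1)] d(3)] by blast
  qed
  define v where "v = (\<lambda>r. (1 / \<delta> s') * \<delta> r + (- 1) * simple_root s' r)"
  have "v \<in> span_on (insert s' (supp_of z))" unfolding v_def
    using roots_on_span[OF d(2)] simple_root_span by (intro span_on_lin) auto
  moreover have "v s' = 0" using ds by (simp add: v_def simple_root_def)
  ultimately have vz: "v \<in> span_on (supp_of z)" by (auto simp: span_on_def supp_def)
  have gv: "act g v \<in> span_on ?A"
    using act_span_map[OF gc(1) supp_of_S[OF yz(2)] img vz] span_on_mono[of "supp_of y" ?A] by blast
  have vV: "v \<in> V" "\<delta> \<in> V" using span_on_mono[OF supp_of_S[OF yz(2)] vz] d pos_root_V by auto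
  have "simple_root s' = (\<lambda>r. (1 / \<delta> s') * \<delta> r + (- 1) * v r)" by (auto simp: v_def)
  then have "act g (simple_root s') = (\<lambda>r. (1 / \<delta> s') * \<gamma> r + (- 1) * act g v r)"
    using act_lin[OF gc(1) vV(2,1), of "1 / \<delta> s'" "-1"] gd by simp
  then have on: "act g (simple_root s') \<in> span_on ?A"
    using span_on_lin[OF roots_on_span[OF c(2)] gv, of "1 / \<delta> s'" "-1"] by simp
  have "\<exists>j \<in> ?A. act g (simple_root s') = simple_root j"
  proof (rule simple_preimage[OF gc(2) p1 _ s'(1) _ AS])
    show "supp (act g (simple_root s')) \<subseteq> ?A" using on by (simp add: span_on_def)
    show "act (inv g) (act g (simple_root s')) = simple_root s'" using gc sV by simp
    fix j assume "j \<in> ?A"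
    then consider "j = s" | l where "l \<in> \<Lambda>" "j = y l" by auto
    then show "act (inv g) (simple_root j) \<in> pos_roots"
    proof cases
      case 2
      then show ?thesis using C_hom_act[OF gC(2)] simple_root_pos vertices_S[OF yz(2)] by simp
    qed (use p2 in simp)
  qed
  then obtain j where j: "j \<in> ?A" "act g (simple_root s') = simple_root j" by blast
  moreover have "j \<notin> supp_of y"
  proof
    assume "j \<in> supp_of y"
    then obtain l where l: "l \<in> \<Lambda>" "j = y l" by blast
    then have "act g (simple_root s') = act g (simple_root (z l))" using C_hom_act[OF gC(1)] j
      by simp
    then have "s' = z l" using act_inj[OF gc(1) sV(1) vertices_V[OF yz(2) l(1)]] simple_root_inj
      by blast
    then show False using s' l by blast
  qed
  ultimately show ?thesis by auto
qed

text \<open>Induction on the number of inversions of \<open>g\<close>: as \<open>g\<close> maps \<open>[z] \<union> {s'}\<close> to \<open>[y] \<union> {s}\<close>, it begins with a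
  step \<open>h\<close> for this enlarged index set.  Since \<open>g\<close> is in \<open>Y\<close>, so is \<open>h\<close>, and \<open>h\<close> runs
  through a rank two component from loop to loop.\<close>

lemma equal_reflections_equiv:
  assumes T: "maximal_tree TV TE" and x: "x \<in> vertices"
  shows "(w, u) \<in> refl_pairs x \<Longrightarrow> (w', u') \<in> refl_pairs x \<Longrightarrow> refl_of TE x (w, u) = refl_of TE x (w', u') \<Longrightarrow>
    equivclp (tour_rel TE x 1) (w', u') (w, u)"
proof (induction "card (inversions (inv (w \<otimes> tree_elt_of TE x (src u)) \<otimes> (w' \<otimes> tree_elt_of TE x (src u'))))"
    arbitrary: w' u' rule: less_induct)
  case less
  have ug: "u \<in> loop_gens" "u' \<in> loop_gens" and wY: "w \<in> Y_hom x x" "w' \<in> Y_hom x x"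
    using less.prems by (auto simp: refl_pairs_def)
  note u = loop_genD[OF ug(1)] and u' = loop_genD[OF ug(2)]
  define v v' where "v = w \<otimes> tree_elt_of TE x (src u)" and "v' = w' \<otimes> tree_elt_of TE x (src u')"
  note e = refl_of_eq[OF T x less.prems(1) v_def] and e' = refl_of_eq[OF T x less.prems(2) v'_def]
  define g where "g = inv v \<otimes> v'"
  let ?y = "src u" and ?z = "src u'"
  have vc: "v \<in> carrier G" "v' \<in> carrier G" using e e' Y_hom_carrier by auto
  have gY: "g \<in> Y_hom ?y ?z" unfolding g_def
    using Y_hom_mult[OF Y_hom_inv[OF e(2) x u(3)] e'(2) x u'(3)] .
  have gc: "g \<in> carrier G" using gY Y_hom_carrier by blast
  obtain s \<gamma> where s: "s \<in> S" "s \<notin> supp_of ?y" and c: "\<gamma> \<in> pos_roots"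
    "\<gamma> \<in> roots_on (insert s (supp_of ?y))"
    "orth (supp_of ?y) \<gamma>" "elt u = root_refl \<gamma>" using loop_orth_simple[OF ug(1)] by metis
  obtain s' \<delta> where s': "s' \<in> S" "s' \<notin> supp_of ?z" and d: "\<delta> \<in> pos_roots"
    "\<delta> \<in> roots_on (insert s' (supp_of ?z))"
    "orth (supp_of ?z) \<delta>" "elt u' = root_refl \<delta>" using loop_orth_simple[OF ug(2)] by metis
  have dV: "\<delta> \<in> V" "\<delta> \<in> roots" using d pos_root_V pos_root by auto
  have "g \<otimes> elt u' \<otimes> inv g = elt u"
  proof -
    have "v' \<otimes> elt u' \<otimes> inv v' = v \<otimes> elt u \<otimes> inv v" using e(1) e'(1) less.prems(3) by simp
    then have "inv v \<otimes> (v' \<otimes> elt u' \<otimes> inv v') \<otimes> v = inv v \<otimes> (v \<otimes> elt u \<otimes> inv v) \<otimes> v" by simp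
    then show ?thesis using vc u u'
      by (simp add: g_def inv_mult_group m_assoc) (simp add: m_assoc[symmetric])
  qed
  then have "root_refl (act g \<delta>) = root_refl \<gamma>" using root_refl_conj[OF gc dV(2)] c d by simp
  then have gd: "act g \<delta> = \<gamma>" using root_refl_inj[OF Y_hom_pos[OF gY d(1,3)] c(1)] by blast
  have gs: "act g (simple_root s') = simple_root s"
    using loop_transport[OF u(3) u'(3) gY s s' c(1-3) d(1-3) gd] .
  show ?case
  proof (cases "g = \<one>")
    case True
    then have "v' = v" using vc unfolding g_def by (metis inv_equality inv_inv inv_closed inv_comm)
    moreover have yz: "?y = ?z"
      using C_hom_tgt_unique[OF Y_hom_C[OF gY] _ u(3) u'(3)] C_hom_one[OF u'(3)] True by simp
    ultimately have "w' = w" using vc wY tree_elt(1)[OF T x u(3)] Y_hom_carrier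
      unfolding v_def v'_def by (metis r_cancel)
    moreover have "\<gamma> = \<delta>" using gd dV True by simp
    then have "u' = u" using yz c d u u' by (intro arrow_eqI) simp_all
    ultimately show ?thesis by (simp add: equivclp_def)
  next
    case False
    define A where "A = insert s' (supp_of ?z)"
    have AS: "A \<subseteq> S" using s' supp_of_S[OF u'(3)] by (simp add: A_def)
    have smg: "simple_map g A"
      using C_hom_simple_map(1)[OF Y_hom_C[OF gY] u(3)] gs s by (auto simp: simple_map_def A_def)
    \<comment> \<open>This index starts the first step of g for the enlarged set A. It lies outside
      A, whose simple roots g keeps simple, and the inversions of g supply the finiteness.\<close>
    obtain t where t: "t \<in> S" "act g (simple_root t) \<notin> pos_roots" using simple_pos_one[OF gc] False
      by blast
    have tA: "t \<notin> A" using t simple_map_pos[OF smg] by blast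
    have ts: "s' \<noteq> t" "t \<notin> supp_of ?z" using tA by (auto simp: A_def)
    have sub: "rel_roots (insert t A) A \<inter> pos_roots \<subseteq> inversions g"
      using rel_roots_inversions[OF gc AS smg t] .
    then have fin: "finite (rel_roots (insert t A) A)"
      using finite_rel_roots finite_subset[OF sub finite_inversions[OF gc]] by blast
    define J where "J = supp_of ?z \<union> {s', t}"
    have JA: "J = insert t A" by (auto simp: J_def A_def)
    have JS: "J \<subseteq> S" using AS t JA by simp
    obtain h z1 where h: "h \<in> generate G J" "h \<noteq> \<one>" and ih: "inversions h \<subseteq> inversions g"
      and z1: "z1 \<in> vertices" "h \<in> C_hom z1 ?z" and hd: "act h \<delta> \<in> pos_roots"
        "(z1, root_refl (act h \<delta>), z1) \<in> edges_within J"
      using enlarged_step[OF u'(3) s' A_def t(1) tA fin d(1) _ d(3)] d(2) sub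
      unfolding A_def[symmetric] JA[symmetric] by metis
    have hc: "h \<in> carrier G" "inv h \<in> carrier G" "inv h \<in> generate G J"
      using generate_subset_carrier[OF JS h(1)] generate_m_inv_closed[of J h] h JS gens_carrier
      by auto
    have hY: "h \<in> Y_hom z1 ?z" unfolding Y_hom_iff
    proof (intro conjI ballI impI)
      fix \<rho> assume r: "\<rho> \<in> pos_roots" "orth (supp_of ?z) \<rho>"
      then have "act g \<rho> \<in> pos_roots" using Y_hom_pos[OF gY] by blast
      then show "act h \<rho> \<in> pos_roots" using ih r by (auto simp: inversions_def)
    qed (rule z1)
    have ihY: "inv h \<in> Y_hom ?z z1" using Y_hom_inv[OF hY z1(1) u'(3)] .
    define \<delta>1 where "\<delta>1 = act h \<delta>"
    have d1: "\<delta>1 \<in> roots" using hd pos_root by (simp add: \<delta>1_def)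
    define u1 where "u1 = (z1, root_refl \<delta>1, z1)"
    have u1: "u1 \<in> edges_within J" "tgt u1 = z1" "src u1 = z1" "elt u1 = root_refl \<delta>1"
      using hd by (simp_all add: u1_def \<delta>1_def)
    have u1l: "u1 \<in> loop_gens" using u1 edges_within_edges by (auto simp: loop_gens_def)
    obtain p where p: "arrow_path (edges_within J) ?z p z1" "path_elt p = inv h" "reduced p"
      using reduced_path_exists[OF u'(3) z1(1) _ JS Y_hom_C[OF ihY] hc(3)] by (auto simp: J_def)
    have nl: "\<forall>e \<in> set p. tgt e \<noteq> src e" using reduced_Y_nonloop[OF p(1,3) z1(1)] p(2) ihY by simp
    \<comment> \<open>A root on J outside the span of the labels either involves t, where g gives
      finiteness, or is supported on A, where up to sign it is inverted by the loop u'.\<close>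
    have "rel_roots J (supp_of ?z) \<subseteq> rel_roots (insert t A) A \<union> rel_roots A (supp_of ?z)"
      by (auto simp: rel_roots_def roots_on_def JA)
    moreover have "finite (rel_roots A (supp_of ?z))"
    proof -
      have "inversions (elt u') = rel_roots A (supp_of ?z) \<inter> pos_roots"
        unfolding A_def
      proof (rule inversions_rank_one[OF supp_of_S[OF u'(3)] s'(1)])
        show "elt u' \<in> generate G (insert s' (supp_of ?z))"
          using root_refl_generate(2)[OF _ d(2)] AS d by (simp add: A_def)
        show "simple_map (elt u') (supp_of ?z)"
          using root_refl_orth_fix[OF dV(2) d(3) supp_of_S[OF u'(3)]] d supp_of_S[OF u'(3)]
          by (auto simp: simple_map_def)
        show "elt u' \<noteq> \<one>" using root_refl_ne_one[OF dV(2)] d by simp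
      qed
      then show ?thesis using finite_inversions[OF u'(4)] finite_rel_roots by simp
    qed
    ultimately have finJ: "finite (rel_roots J (supp_of ?z))" using fin finite_subset by blast
    have r2: "rank_two J ?z" unfolding rank_two_def using JS u'(3) finJ ts s' by (auto simp: J_def)
    have u'J: "u' \<in> edges_within J"
    proof -
      have "(?z, root_refl \<delta>, ?z) \<in> edges_within J" using loopI[OF u'(3) s' _ d(2,3)]
        by (auto simp: J_def)
      moreover have "u' = (?z, root_refl \<delta>, ?z)" using d u' by (intro arrow_eqI) auto
      ultimately show ?thesis by simp
    qed
    have ne: "path_elt p \<noteq> \<one>" using p(2) h(2) hc by (metis inv_inv inv_one)
    \<comment> \<open>The loop u1 has the root h \<delta>, so moved back along h its reflection is
      that of u', and the tour multiplies it by itself.\<close>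
    have o1: "ord (elt u' \<otimes> (path_elt p \<otimes> elt u1 \<otimes> inv (path_elt p))) = 1"
    proof -
      have "path_elt p \<otimes> elt u1 \<otimes> inv (path_elt p) = root_refl (act (inv h) \<delta>1)"
        using root_refl_conj[OF hc(2) d1] p(2) u1 by simp
      also have "act (inv h) \<delta>1 = \<delta>" using hc dV by (simp add: \<delta>1_def)
      finally show ?thesis using root_refl_sq[OF dV(2)] d by simp
    qed
    define w1 where "w1 = v' \<otimes> path_elt p \<otimes> inv (tree_elt_of TE x z1)"
    have PY: "tree_elt_of TE x ?z \<in> Y_hom x ?z" using tree_elt(1)[OF T x u'(3)] .
    have w': "v' \<otimes> inv (tree_elt_of TE x ?z) = w'"
      using wY PY Y_hom_carrier by (simp add: v'_def m_assoc)
    have rel: "tour_rel TE x 1 (w', u') (w1, u1)"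
      using tour_relI[OF T x r2 J_def ts(1) s'(2) ts(2) u'J u'(2) HOL.refl u1(1,2,3) p(1) nl ne e'(2) o1] w' by (simp add: w1_def)
    have v1Y: "v' \<otimes> inv h \<in> Y_hom x (src u1)" using Y_hom_mult[OF e'(2) ihY u'(3) z1(1)] u1 by simp
    have w1P: "w1 \<otimes> tree_elt_of TE x (src u1) = v' \<otimes> inv h"
      using pair_of_arrow(2)[OF T x u1l v1Y] u1 p(2) by (simp add: w1_def)
    have w1r: "(w1, u1) \<in> refl_pairs x" using rel by simp
    have "tour_equiv TE x (w', u') (w1, u1)"
      unfolding tour_equiv_def using r_into_equivclp[of "tour_rel TE x 1", OF rel] less.prems(2) w1r
      by blast
    then have "refl_of TE x (w1, u1) = refl_of TE x (w, u)"
      using tour_equiv_refl_of[OF T x] less.prems(3) by metis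
    moreover have "card (inversions (inv (w \<otimes> tree_elt_of TE x ?y) \<otimes> (w1 \<otimes> tree_elt_of TE x (src u1)))) <
        card (inversions (inv (w \<otimes> tree_elt_of TE x ?y) \<otimes> (w' \<otimes> tree_elt_of TE x ?z)))"
    proof -
      have g1: "inv (w \<otimes> tree_elt_of TE x ?y) \<otimes> (w1 \<otimes> tree_elt_of TE x (src u1)) = g \<otimes> inv h"
        unfolding w1P v_def[symmetric] g_def using vc hc by (simp add: m_assoc)
      have g0: "inv (w \<otimes> tree_elt_of TE x ?y) \<otimes> (w' \<otimes> tree_elt_of TE x ?z) = g"
        unfolding g_def v_def v'_def ..
      \<comment> \<open>The inversions of h are among those of g, so splitting off h removes at
        least these; h is not trivial, hence the measure drops.\<close>
      have "inversions (g \<otimes> inv h) \<subseteq> act h ` (inversions g - inversions h)"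
      proof
        fix \<beta> assume b: "\<beta> \<in> inversions (g \<otimes> inv h)"
        then have bV: "\<beta> \<in> pos_roots" "\<beta> \<in> V" "\<beta> \<in> roots" using inversions_pos pos_root_V pos_root
          by auto
        define \<tau> where "\<tau> = act (inv h) \<beta>"
        have t: "\<tau> \<in> roots" "\<tau> \<in> V" "act h \<tau> = \<beta>" "act g \<tau> \<notin> pos_roots"
          using act_root act_V hc gc bV b by (auto simp: \<tau>_def inversions_def act_mult)
        have "\<tau> \<in> pos_roots"
        proof (rule ccontr)
          assume "\<tau> \<notin> pos_roots"
          then have n: "(\<lambda>r. - \<tau> r) \<in> pos_roots" using not_pos_iff t by blast
          have "act h (\<lambda>r. - \<tau> r) \<notin> pos_roots" using act_uminus[OF hc(1) t(2)] t(3) pos_not_neg bV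
            by simp
          then have "(\<lambda>r. - \<tau> r) \<in> inversions g" using n ih by (auto simp: inversions_def)
          then have "(\<lambda>r. - act g \<tau> r) \<notin> pos_roots" using act_uminus[OF gc t(2)]
            by (simp add: inversions_def)
          then show False using t not_pos_iff[OF act_root[OF gc t(1)]] by blast
        qed
        then have "\<tau> \<in> inversions g - inversions h" using t bV by (simp add: inversions_def)
        then show "\<beta> \<in> act h ` (inversions g - inversions h)" using t by blast
      qed
      then have "card (inversions (g \<otimes> inv h)) \<le> card (inversions g - inversions h)"
        using finite_inversions[OF gc]
        by (meson card_image_le card_mono finite_Diff finite_imageI le_trans)
      also have "\<dots> < card (inversions g)"
        using finite_inversions[OF gc] ih inversions_empty[OF hc(1)] h(2)
        by (intro psubset_card_mono) auto
      finally show ?thesis unfolding g0 g1 .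
    qed
    ultimately have "equivclp (tour_rel TE x 1) (w1, u1) (w, u)"
      using less.hyps[OF _ less.prems(1) w1r] by simp
    then show ?thesis using rel by (meson equivclp_trans r_into_equivclp)
  qed
qed

end

text \<open>With x = a b of finite order, the powers of x and their products with a form a finite
  set closed under right multiplication by a and b.\<close>

lemma (in group) finite_dihedral:
  assumes a: "a \<in> carrier G" "a \<otimes> a = \<one>" and b: "b \<in> carrier G" "b \<otimes> b = \<one>" and k: "ord (a \<otimes> b) \<noteq> 0"
  shows "finite (generate G {a, b})"
proof -
  define x where "x = a \<otimes> b"
  have x: "x \<in> carrier G" using a b by (simp add: x_def)
  define H where "H = range (\<lambda>i::nat. x [^] i) \<union> range (\<lambda>i::nat. x [^] i \<otimes> a)"
  have "range (\<lambda>i::nat. x [^] i) \<subseteq> (\<lambda>i. x [^] i) ` {..<ord x}"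
  proof
    fix h assume "h \<in> range (\<lambda>i::nat. x [^] i)"
    then obtain i :: nat where i: "h = x [^] i" by blast
    have "x [^] (ord x * (i div ord x)) \<otimes> x [^] (i mod ord x) = x [^] i"
      unfolding nat_pow_mult[OF x] by simp
    moreover have "x [^] (ord x * (i div ord x)) = \<one>"
      unfolding nat_pow_pow[OF x, symmetric] pow_ord_eq_1[OF x] by simp
    ultimately have "h = x [^] (i mod ord x)" using x i by simp
    then show "h \<in> (\<lambda>i. x [^] i) ` {..<ord x}" using k by (auto simp: x_def)
  qed
  then have fin: "finite (range (\<lambda>i::nat. x [^] i))" by (rule finite_subset) simp
  moreover have "range (\<lambda>i::nat. x [^] i \<otimes> a) = (\<lambda>h. h \<otimes> a) ` range (\<lambda>i::nat. x [^] i)" by auto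
  ultimately have finH: "finite H" by (simp add: H_def)
  have Ha: "h \<otimes> a \<in> H" if "h \<in> H" for h
  proof -
    consider i :: nat where "h = x [^] i" | i :: nat where "h = x [^] i \<otimes> a" using \<open>h \<in> H\<close>
      by (auto simp: H_def)
    then show ?thesis
    proof cases
      case 2
      then have "h \<otimes> a = x [^] i" using x a by (simp add: m_assoc)
      then show ?thesis by (auto simp: H_def)
    qed (auto simp: H_def)
  qed
  have Hb: "h \<otimes> b \<in> H" if "h \<in> H" for h
  proof -
    consider i :: nat where "h = x [^] i" | i :: nat where "h = x [^] i \<otimes> a" using \<open>h \<in> H\<close>
      by (auto simp: H_def)
    then show ?thesis
    proof cases
      case 1
      \<comment> \<open>Adding the order makes the exponent positive, so a factor x = a b can be
        split off and its b cancelled.\<close>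
      obtain j where j: "i + ord x = Suc j" using k
        by (metis add_eq_if add_gr_0 gr0_implies_Suc not_gr_zero x_def)
      have "h = x [^] (i + ord x)" using x 1 by (simp add: nat_pow_mult[symmetric])
      then have "h = x [^] j \<otimes> x" using j by simp
      then have "h \<otimes> b = x [^] j \<otimes> a" using x a b by (simp add: x_def m_assoc)
      then show ?thesis by (auto simp: H_def)
    next
      case 2
      then have "h \<otimes> b = x [^] Suc i" using x a b by (simp add: x_def m_assoc)
      then show ?thesis unfolding H_def by blast
    qed
  qed
  have Hc: "H \<subseteq> carrier G" using x a by (auto simp: H_def)
  have inv_ab: "inv a = a" "inv b = b" using a b by (simp_all add: inv_equality)
  have "g \<in> carrier G \<and> (\<forall>h \<in> H. h \<otimes> g \<in> H)" if "g \<in> generate G {a, b}" for g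
    using that
  proof (induction rule: generate.induct)
    case one
    then show ?case using Hc by auto
  next
    case (incl g)
    then show ?case using Ha Hb a b by auto
  next
    case (inv g)
    then show ?case using Ha Hb a b inv_ab by auto
  next
    case (eng g1 g2)
    then show ?case using Hc by (auto simp: m_assoc[symmetric] subset_iff)
  qed
  moreover have "\<one> \<in> H" using x by (auto simp: H_def intro: range_eqI[of _ _ 0])
  ultimately have "generate G {a, b} \<subseteq> H" using l_one by (metis subsetI)
  then show ?thesis using finH finite_subset by blast
qed

text \<open>The cross product of the two coordinate rows is a solution; if it is zero, the first two
  columns give one with third entry 0.\<close>

lemma real_dependence:
  fixes c1 c2 c3 d1 d2 d3 :: real
  shows "\<exists>k1 k2 k3. (k1 \<noteq> 0 \<or> k2 \<noteq> 0 \<or> k3 \<noteq> 0) \<and> k1 * c1 + k2 * c2 + k3 * c3 = 0 \<and> k1 * d1 + k2 * d2 + k3 * d3 = 0"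
proof (cases "c2 * d3 - c3 * d2 \<noteq> 0 \<or> c3 * d1 - c1 * d3 \<noteq> 0 \<or> c1 * d2 - c2 * d1 \<noteq> 0")
  case True
  then show ?thesis
    by (intro exI[of _ "c2 * d3 - c3 * d2"] exI[of _ "c3 * d1 - c1 * d3"] exI[of _ "c1 * d2 - c2 * d1"] conjI)
      (assumption | simp add: algebra_simps)+
next
  case False
  then have m: "c1 * d2 = c2 * d1" by simp
  consider "c1 \<noteq> 0 \<or> c2 \<noteq> 0" | "c1 = 0" "c2 = 0" "d1 \<noteq> 0 \<or> d2 \<noteq> 0" | "c1 = 0" "c2 = 0" "d1 = 0"
    "d2 = 0" by blast
  then show ?thesis
  proof cases
    case 1
    then show ?thesis using m by (intro exI[of _ "- c2"] exI[of _ c1] exI[of _ 0]) auto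
  next
    case 2
    then show ?thesis by (intro exI[of _ "- d2"] exI[of _ d1] exI[of _ 0]) auto
  next
    case 3
    then show ?thesis by (intro exI[of _ 1] exI[of _ 0] exI[of _ 0]) auto
  qed
qed

context coxeter_groupoid begin

section \<open>Products of finite order\<close>

lemma root_refl_span:
  assumes "\<gamma> \<in> roots" "v \<in> V"
  shows "act (root_refl \<gamma>) v = (\<lambda>r. v r + (- 2 * bform \<gamma> v) * \<gamma> r)"
  using root_refl_act[OF assms] by simp

text \<open>\<open>fixed_facet\<close> for the group of order 2, with both roots equal to \<delta>.
  Dominance holds because the reflection inverts no orthogonal positive root but \<delta>. Modulo
  the labels the simple roots of K are multiples of one vector, so K has one further index.\<close>

lemma one_reflection_facet:
  assumes z: "z \<in> vertices" "supp_of z \<subseteq> J" and J: "J \<subseteq> S" and d: "orth_simple z \<delta>" "\<delta> \<in> roots_on J"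
  shows "\<exists>a w s. a \<in> vertices \<and> w \<in> Y_hom a z \<and> w \<in> generate G J \<and> s \<in> S \<and> s \<notin> supp_of a \<and> insert s (supp_of a) \<subseteq> J \<and>
    act w \<delta> \<in> roots_on (insert s (supp_of a))"
proof -
  have dd: "\<delta> \<in> pos_roots" "orth (supp_of z) \<delta>" "\<delta> \<in> roots" "\<delta> \<in> V"
    using d pos_root pos_root_V by (auto simp: orth_simple_def)
  define g where "g = root_refl \<delta>"
  have g: "g \<in> generate G J" "g \<noteq> \<one>" using root_refl_generate(2)[OF J d(2)] root_refl_ne_one dd
    by (auto simp: g_def)
  have sumF: "(\<Sum>h\<in>{\<one>, g}. act h v r) = v r + act g v r" if "v \<in> V" for v r using that g by simp
  have avg: "(\<Sum>h\<in>{\<one>, g}. act h \<delta> r) = 0" for r using sumF[OF dd(4)] root_refl_self dd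
    by (simp add: g_def)
  have "\<exists>a w K. a \<in> vertices \<and> w \<in> Y_hom a z \<and> w \<in> generate G J \<and> K \<subseteq> J \<and> supp_of a \<subseteq> K \<and>
    act w \<delta> \<in> roots_on K \<and> act w \<delta> \<in> roots_on K \<and>
    (\<forall>r \<in> K. \<exists>c d. \<exists>v \<in> span_on (supp_of a). simple_root r = (\<lambda>q. c * act w \<delta> q + d * act w \<delta> q + v q)) \<and>
    finite (rel_roots K (supp_of a))"
  proof (rule fixed_facet[OF z J, of "{\<one>, g}"])
    show "{\<one>, g} \<subseteq> generate G J" using g generate.one by auto
    fix h assume h: "h \<in> {\<one>, g}"
    show "act h (simple_root a) = simple_root a" if a: "a \<in> supp_of z" for a
      using h a root_refl_orth_fix[OF dd(3,2) supp_of_S[OF z(1)] a] vertices_V[OF z(1)]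
      by (auto simp: g_def)
    show "\<exists>c d. act h v = (\<lambda>r. v r + c * \<delta> r + d * \<delta> r)" if v: "v \<in> V" for v
    proof (cases "h = \<one>")
      case True
      then show ?thesis using v by (intro exI[of _ 0]) simp
    next
      case False
      then show ?thesis using h root_refl_span[OF dd(3) v]
        by (intro exI[of _ "- 2 * bform \<delta> v"] exI[of _ 0]) (simp add: g_def)
    qed
  next
    fix \<rho> assume r: "\<rho> \<in> pos_roots" "orth (supp_of z) \<rho>"
    show "(\<forall>h\<in>{\<one>, g}. act h \<rho> \<in> pos_roots) \<or> (\<forall>r. (\<Sum>h\<in>{\<one>, g}. act h \<rho> r) = 0)"
    proof (cases "act g \<rho> \<in> pos_roots")
      case True
      then show ?thesis using r pos_root_V by simp
    next
      case False
      then have "\<rho> = \<delta>" using d r by (auto simp: orth_simple_def g_def)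
      then show ?thesis using avg by blast
    qed
  qed (use avg dd d in \<open>auto\<close>)
  then obtain a w K where aw: "a \<in> vertices" "w \<in> Y_hom a z" "w \<in> generate G J" "K \<subseteq> J"
    "supp_of a \<subseteq> K" "act w \<delta> \<in> roots_on K"
    and sp: "\<forall>r \<in> K. \<exists>c d. \<exists>v \<in> span_on (supp_of a). simple_root r = (\<lambda>q. c * act w \<delta> q + d * act w \<delta> q + v q)"
    by (elim exE conjE)
  define \<epsilon> where "\<epsilon> = act w \<delta>"
  have e: "\<epsilon> \<in> roots" "orth (supp_of a) \<epsilon>"
    using act_root Y_hom_carrier[OF aw(2)] Y_hom_orth[OF aw(2) z(1) dd(4,2)] dd
    by (auto simp: \<epsilon>_def)
  have "K \<noteq> supp_of a"
    using root_orth_span[OF supp_of_S[OF aw(1)] e] roots_on_span aw(6) by (auto simp: \<epsilon>_def)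
  then obtain s where s: "s \<in> K" "s \<notin> supp_of a" using aw by blast
  have "r = s" if r: "r \<in> K" "r \<notin> supp_of a" for r
  proof (rule ccontr)
    assume rs: "r \<noteq> s"
    obtain c d v where 1: "v \<in> span_on (supp_of a)" "simple_root r = (\<lambda>q. c * \<epsilon> q + d * \<epsilon> q + v q)"
      using bspec[OF sp r(1)] unfolding \<epsilon>_def by (elim exE bexE)
    obtain c' d' v' where 2: "v' \<in> span_on (supp_of a)"
      "simple_root s = (\<lambda>q. c' * \<epsilon> q + d' * \<epsilon> q + v' q)"
      using bspec[OF sp s(1)] unfolding \<epsilon>_def by (elim exE bexE)
    have z0: "v r = 0" "v' r = 0" "v s = 0" "v' s = 0" using 1(1) 2(1) span_on_zero r s by blast+
    have "(c + d) * \<epsilon> r = 1" "(c' + d') * \<epsilon> r = 0" "(c' + d') * \<epsilon> s = 1"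
      using fun_cong[OF 1(2), of r] fun_cong[OF 2(2), of r] fun_cong[OF 2(2), of s] z0 rs
      by (auto simp: simple_root_def algebra_simps)
    then show False by (metis mult_eq_0_iff zero_neq_one mult_zero_left)
  qed
  then have "K = insert s (supp_of a)" using s aw by blast
  moreover have "s \<in> S" using s aw J by blast
  ultimately show ?thesis using aw s by blast
qed

text \<open>\<open>fixed_facet\<close> for the dihedral group of the two reflections. Modulo the
  labels the simple roots of K are combinations of two vectors, which bounds the further indices by
  two; a single one would carry only one positive orthogonal root.\<close>

lemma two_reflections_facet:
  assumes y: "y \<in> vertices" and c: "orth_simple y \<gamma>" and d: "orth_simple y \<epsilon>" and ne: "\<gamma> \<noteq> \<epsilon>"
    and fin: "ord (root_refl \<gamma> \<otimes> root_refl \<epsilon>) \<noteq> 0"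
  shows "\<exists>a w J. w \<in> Y_hom a y \<and> rank_two J a \<and> act w \<gamma> \<in> roots_on J \<and> act w \<epsilon> \<in> roots_on J"
proof -
  have cc: "\<gamma> \<in> pos_roots" "orth (supp_of y) \<gamma>" "\<gamma> \<in> roots" "\<gamma> \<in> V" "\<gamma> \<in> roots_on S"
    and dd: "\<epsilon> \<in> pos_roots" "orth (supp_of y) \<epsilon>" "\<epsilon> \<in> roots" "\<epsilon> \<in> V" "\<epsilon> \<in> roots_on S"
    using c d pos_root pos_root_V roots_on_S by (auto simp: orth_simple_def)
  define F where "F = generate G {root_refl \<gamma>, root_refl \<epsilon>}"
  have Fc: "F \<subseteq> carrier G" using generate_incl cc dd by (simp add: F_def)
  have finF: "finite F" unfolding F_def using finite_dihedral root_refl_sq cc dd fin by simp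
  have gens: "P g" if "g \<in> F" "P \<one>" "P (root_refl \<gamma>)" "P (root_refl \<epsilon>)"
    "\<And>g h. g \<in> F \<Longrightarrow> h \<in> F \<Longrightarrow> P g \<Longrightarrow> P h \<Longrightarrow> P (g \<otimes> h)" for P g
    using that(1) unfolding F_def
  proof (induction rule: generate.induct)
    case (inv h)
    then show ?case using that root_refl_inv cc dd by auto
  qed (use that in \<open>auto simp: F_def\<close>)
  have span: "\<forall>v \<in> V. \<exists>c d. act g v = (\<lambda>r. v r + c * \<gamma> r + d * \<epsilon> r)" if "g \<in> F" for g
    using that
  proof (rule gens)
    show "\<forall>v \<in> V. \<exists>c d. act \<one> v = (\<lambda>r. v r + c * \<gamma> r + d * \<epsilon> r)"
      by (intro ballI exI[of _ 0]) simp
    show "\<forall>v \<in> V. \<exists>c d. act (root_refl \<gamma>) v = (\<lambda>r. v r + c * \<gamma> r + d * \<epsilon> r)"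
    proof
      fix v assume "v \<in> V"
      then show "\<exists>c d. act (root_refl \<gamma>) v = (\<lambda>r. v r + c * \<gamma> r + d * \<epsilon> r)"
        using root_refl_span[OF cc(3)] by (intro exI[of _ "- 2 * bform \<gamma> v"] exI[of _ 0]) simp
    qed
    show "\<forall>v \<in> V. \<exists>c d. act (root_refl \<epsilon>) v = (\<lambda>r. v r + c * \<gamma> r + d * \<epsilon> r)"
    proof
      fix v assume "v \<in> V"
      then show "\<exists>c d. act (root_refl \<epsilon>) v = (\<lambda>r. v r + c * \<gamma> r + d * \<epsilon> r)"
        using root_refl_span[OF dd(3)] by (intro exI[of _ 0] exI[of _ "- 2 * bform \<epsilon> v"]) simp
    qed
    fix g h assume gh: "g \<in> F" "h \<in> F" and
      IH: "\<forall>v \<in> V. \<exists>c d. act g v = (\<lambda>r. v r + c * \<gamma> r + d * \<epsilon> r)"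
        "\<forall>v \<in> V. \<exists>c d. act h v = (\<lambda>r. v r + c * \<gamma> r + d * \<epsilon> r)"
    show "\<forall>v \<in> V. \<exists>c d. act (g \<otimes> h) v = (\<lambda>r. v r + c * \<gamma> r + d * \<epsilon> r)"
    proof
      fix v assume v: "v \<in> V"
      have ghc: "g \<in> carrier G" "h \<in> carrier G" using gh Fc by auto
      obtain c d where 1: "act h v = (\<lambda>r. v r + c * \<gamma> r + d * \<epsilon> r)" using IH v by blast
      obtain c' d' where 2: "act g (act h v) = (\<lambda>r. act h v r + c' * \<gamma> r + d' * \<epsilon> r)"
        using IH(1) act_V[OF ghc(2) v] by blast
      have "act (g \<otimes> h) v = (\<lambda>r. v r + (c + c') * \<gamma> r + (d + d') * \<epsilon> r)"
        using 2 unfolding act_mult[OF ghc v] by (simp add: 1 algebra_simps)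
      then show "\<exists>c d. act (g \<otimes> h) v = (\<lambda>r. v r + c * \<gamma> r + d * \<epsilon> r)" by blast
    qed
  qed
  have Fix: "act g (simple_root a) = simple_root a" if a: "a \<in> supp_of y" and g: "g \<in> F" for g a
    using g
  proof (rule gens)
    have aV: "simple_root a \<in> V" using a vertices_V[OF y] by auto
    show "act \<one> (simple_root a) = simple_root a" using aV by simp
    show "act (root_refl \<gamma>) (simple_root a) = simple_root a"
      "act (root_refl \<epsilon>) (simple_root a) = simple_root a"
      using root_refl_orth_fix[OF _ _ supp_of_S[OF y] a] cc dd by auto
    fix g h assume "g \<in> F" "h \<in> F" "act g (simple_root a) = simple_root a"
      "act h (simple_root a) = simple_root a"
    then show "act (g \<otimes> h) (simple_root a) = simple_root a" using aV Fc
      by (auto simp: act_mult subset_iff)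
  qed
  \<comment> \<open>Right multiplication by the reflection permutes F and negates \<beta>, so the
    sum equals its own negative.\<close>
  have avg: "(\<Sum>g\<in>F. act g \<beta> r) = 0" if b: "\<beta> \<in> roots" "root_refl \<beta> \<in> F" for \<beta> r
  proof -
    let ?s = "root_refl \<beta>"
    have s: "?s \<in> carrier G" "?s \<otimes> ?s = \<one>" "\<beta> \<in> V" using b root_refl_sq root_V by auto
    have closed: "g \<otimes> ?s \<in> F" if "g \<in> F" for g using that b
      by (auto simp: F_def intro: generate.eng)
    have cancel: "g \<otimes> ?s \<otimes> ?s = g" if "g \<in> F" for g using that s Fc by (auto simp: m_assoc)
    have "(\<Sum>g\<in>F. act g \<beta> r) = (\<Sum>g\<in>F. act (g \<otimes> ?s) \<beta> r)"
      by (rule sum.reindex_bij_witness[of _ "\<lambda>g. g \<otimes> ?s" "\<lambda>g. g \<otimes> ?s"]) (use closed cancel in auto)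
    also have "\<dots> = (\<Sum>g\<in>F. - act g \<beta> r)"
    proof (rule sum.cong)
      fix g assume "g \<in> F"
      then have "g \<in> carrier G" using Fc by blast
      then show "act (g \<otimes> ?s) \<beta> r = - act g \<beta> r" using s b root_refl_self
        by (simp add: act_mult act_uminus)
    qed simp
    finally show ?thesis by (simp add: sum_negf)
  qed
  have avgs: "(\<Sum>g\<in>F. act g \<gamma> r) = 0" "(\<Sum>g\<in>F. act g \<epsilon> r) = 0" for r
    using avg cc dd by (auto simp: F_def intro: generate.incl)
  \<comment> \<open>Roots in the plane Q sum to 0 over F. Among the positive orthogonal roots the
    two reflections invert only \<gamma> and \<epsilon>, which lie in Q, so those outside Q stay
    positive under all of F.\<close>
  define Q where "Q = {\<rho>. \<exists>c d. \<rho> = (\<lambda>r. c * \<gamma> r + d * \<epsilon> r)}"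
  define R where "R = {\<rho> \<in> pos_roots. orth (supp_of y) \<rho> \<and> \<rho> \<notin> Q}"
  have RF: "act g ` R \<subseteq> R" if "g \<in> F" for g using that
  proof (rule gens)
    show "act \<one> ` R \<subseteq> R" using pos_root_V by (auto simp: R_def)
    have one: "act (root_refl \<beta>) ` R \<subseteq> R" if b: "orth_simple y \<beta>" "\<beta> \<in> Q" "root_refl \<beta> \<in> F" for \<beta>
    proof
      fix \<tau> assume "\<tau> \<in> act (root_refl \<beta>) ` R"
      then obtain \<rho> where r: "\<rho> \<in> R" "\<tau> = act (root_refl \<beta>) \<rho>" by blast
      have bb: "\<beta> \<in> roots" "orth (supp_of y) \<beta>" using b pos_root by (auto simp: orth_simple_def)
      have rV: "\<rho> \<in> pos_roots" "\<rho> \<in> V" "orth (supp_of y) \<rho>" "\<rho> \<notin> Q" using r pos_root_V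
        by (auto simp: R_def)
      have "\<tau> \<in> pos_roots" using b rV r(2) by (auto simp: orth_simple_def)
      moreover have "root_refl \<beta> \<in> C_hom y y" using root_refl_orth_fix[OF bb supp_of_S[OF y]] bb
        by (auto simp: C_hom_def)
      then have "orth (supp_of y) \<tau>" using C_hom_orth[OF _ y rV(2,3)] r(2) by blast
      moreover have "\<tau> \<notin> Q"
      proof
        assume "\<tau> \<in> Q"
        then obtain c d where t: "\<tau> = (\<lambda>r. c * \<gamma> r + d * \<epsilon> r)" by (auto simp: Q_def)
        obtain c' d' where t': "\<tau> = (\<lambda>r. \<rho> r + c' * \<gamma> r + d' * \<epsilon> r)" using span[OF b(3)] rV(2) r(2)
          by blast
        have "\<rho> r = (c - c') * \<gamma> r + (d - d') * \<epsilon> r" for r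
          using fun_cong[OF t, of r] fun_cong[OF t', of r] by (simp add: algebra_simps)
        then have "\<rho> = (\<lambda>r. (c - c') * \<gamma> r + (d - d') * \<epsilon> r)" by (rule ext)
        then have "\<rho> \<in> Q" unfolding Q_def by blast
        then show False using rV by blast
      qed
      ultimately show "\<tau> \<in> R" by (simp add: R_def)
    qed
    have "\<gamma> \<in> Q" unfolding Q_def by (rule CollectI, rule exI[of _ 1], rule exI[of _ 0]) simp
    moreover have "\<epsilon> \<in> Q" unfolding Q_def
      by (rule CollectI, rule exI[of _ 0], rule exI[of _ 1]) simp
    ultimately show "act (root_refl \<gamma>) ` R \<subseteq> R" "act (root_refl \<epsilon>) ` R \<subseteq> R"
      using one c d by (auto simp: F_def generate.incl)
    fix g h assume gh: "g \<in> F" "h \<in> F" "act g ` R \<subseteq> R" "act h ` R \<subseteq> R"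
    have "act (g \<otimes> h) \<rho> \<in> R" if "\<rho> \<in> R" for \<rho>
    proof -
      have "\<rho> \<in> V" using that pos_root_V by (auto simp: R_def)
      then have eq: "act (g \<otimes> h) \<rho> = act g (act h \<rho>)" using gh(1,2) Fc act_mult by blast
      have "act h \<rho> \<in> R" using gh(4) that by blast
      then show ?thesis unfolding eq using gh(3) by blast
    qed
    then show "act (g \<otimes> h) ` R \<subseteq> R" by blast
  qed
  have "\<exists>a w K. a \<in> vertices \<and> w \<in> Y_hom a y \<and> w \<in> generate G S \<and> K \<subseteq> S \<and> supp_of a \<subseteq> K \<and>
    act w \<gamma> \<in> roots_on K \<and> act w \<epsilon> \<in> roots_on K \<and>
    (\<forall>r \<in> K. \<exists>c d. \<exists>v \<in> span_on (supp_of a). simple_root r = (\<lambda>q. c * act w \<gamma> q + d * act w \<epsilon> q + v q)) \<and>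
    finite (rel_roots K (supp_of a))"
  proof (rule fixed_facet[OF y supp_of_S[OF y] order_refl finF])
    show "\<one> \<in> F" by (simp add: F_def generate.one)
    show "F \<subseteq> generate G S" using Fc gens_generate by simp
    fix \<rho> assume r: "\<rho> \<in> pos_roots" "orth (supp_of y) \<rho>"
    show "(\<forall>g\<in>F. act g \<rho> \<in> pos_roots) \<or> (\<forall>r. (\<Sum>g\<in>F. act g \<rho> r) = 0)"
    proof (cases "\<rho> \<in> Q")
      case True
      then obtain c d where t: "\<rho> = (\<lambda>r. c * \<gamma> r + d * \<epsilon> r)" by (auto simp: Q_def)
      have "(\<Sum>g\<in>F. act g \<rho> r) = (\<Sum>g\<in>F. c * act g \<gamma> r + d * act g \<epsilon> r)" for r
        unfolding t using act_lin[OF _ cc(4) dd(4)] Fc by (intro sum.cong) (auto simp: subset_iff)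
      then have "(\<Sum>g\<in>F. act g \<rho> r) = c * (\<Sum>g\<in>F. act g \<gamma> r) + d * (\<Sum>g\<in>F. act g \<epsilon> r)" for r
        by (simp add: sum.distrib sum_distrib_left)
      then show ?thesis using avgs by simp
    next
      case False
      then have "\<rho> \<in> R" using r by (simp add: R_def)
      then show ?thesis using RF by (auto simp: R_def image_subset_iff)
    qed
  next
    fix g v assume "g \<in> F" "v \<in> V"
    then show "\<exists>c d. act g v = (\<lambda>r. v r + c * \<gamma> r + d * \<epsilon> r)" using span by blast
  qed (use Fix avgs cc(1,2,5) dd(1,2,5) in \<open>simp_all\<close>)
  then obtain a w K where aw: "a \<in> vertices" "w \<in> Y_hom a y" "K \<subseteq> S" "supp_of a \<subseteq> K"
    "act w \<gamma> \<in> roots_on K" "act w \<epsilon> \<in> roots_on K"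
    and sp: "\<forall>r \<in> K. \<exists>c d. \<exists>v \<in> span_on (supp_of a). simple_root r = (\<lambda>q. c * act w \<gamma> q + d * act w \<epsilon> q + v q)"
    and finK: "finite (rel_roots K (supp_of a))" by (elim exE conjE)
  define \<gamma>' \<epsilon>' where "\<gamma>' = act w \<gamma>" and "\<epsilon>' = act w \<epsilon>"
  have wc: "w \<in> carrier G" using Y_hom_carrier aw by blast
  have g': "\<gamma>' \<in> pos_roots" "orth (supp_of a) \<gamma>'" "\<epsilon>' \<in> pos_roots" "orth (supp_of a) \<epsilon>'" "\<gamma>' \<noteq> \<epsilon>'"
    using Y_hom_pos[OF aw(2)] Y_hom_orth[OF aw(2) y] cc dd ne act_inj[OF wc]
    by (auto simp: \<gamma>'_def \<epsilon>'_def)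
  have "K \<noteq> supp_of a"
    using root_orth_span[OF supp_of_S[OF aw(1)] pos_root[OF g'(1)] g'(2)] roots_on_span aw(5)
    by (auto simp: \<gamma>'_def)
  then obtain s where s: "s \<in> K" "s \<notin> supp_of a" using aw by blast
  have sS: "s \<in> S" using s aw by blast
  have "K \<noteq> insert s (supp_of a)"
    using orth_root_unique[OF supp_of_S[OF aw(1)] sS s(2) g'(1) _ g'(2,3) _ g'(4)] aw(5,6) g'(5)
    by (auto simp: \<gamma>'_def \<epsilon>'_def)
  then obtain t where t: "t \<in> K" "t \<notin> supp_of a" "t \<noteq> s" using aw s by blast
  have "r = s \<or> r = t" if r: "r \<in> K" "r \<notin> supp_of a" for r
  proof (rule ccontr)
    assume "\<not> (r = s \<or> r = t)"
    then have rs: "r \<noteq> s" "r \<noteq> t" by auto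
    obtain c1 d1 v1 where 1: "v1 \<in> span_on (supp_of a)"
      "simple_root r = (\<lambda>q. c1 * \<gamma>' q + d1 * \<epsilon>' q + v1 q)"
      using bspec[OF sp r(1)] unfolding \<gamma>'_def \<epsilon>'_def by (elim exE bexE)
    obtain c2 d2 v2 where 2: "v2 \<in> span_on (supp_of a)"
      "simple_root s = (\<lambda>q. c2 * \<gamma>' q + d2 * \<epsilon>' q + v2 q)"
      using bspec[OF sp s(1)] unfolding \<gamma>'_def \<epsilon>'_def by (elim exE bexE)
    obtain c3 d3 v3 where 3: "v3 \<in> span_on (supp_of a)"
      "simple_root t = (\<lambda>q. c3 * \<gamma>' q + d3 * \<epsilon>' q + v3 q)"
      using bspec[OF sp t(1)] unfolding \<gamma>'_def \<epsilon>'_def by (elim exE bexE)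
    obtain k1 k2 k3 where k: "k1 \<noteq> 0 \<or> k2 \<noteq> 0 \<or> k3 \<noteq> 0" "k1 * c1 + k2 * c2 + k3 * c3 = 0"
      "k1 * d1 + k2 * d2 + k3 * d3 = 0"
      using real_dependence by metis
    have eq: "k1 * simple_root r q + k2 * simple_root s q + k3 * simple_root t q = 0"
      if q: "q \<notin> supp_of a" for q
    proof -
      have "v1 q = 0" "v2 q = 0" "v3 q = 0" using 1(1) 2(1) 3(1) span_on_zero q by blast+
      then have "k1 * simple_root r q + k2 * simple_root s q + k3 * simple_root t q =
          (k1 * c1 + k2 * c2 + k3 * c3) * \<gamma>' q + (k1 * d1 + k2 * d2 + k3 * d3) * \<epsilon>' q"
        unfolding 1(2) 2(2) 3(2) by (simp add: algebra_simps)
      then show ?thesis using k by simp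
    qed
    have "k1 = 0" "k2 = 0" "k3 = 0" using eq[of r] eq[of s] eq[of t] r s t rs
      by (simp_all add: simple_root_def)
    then show False using k by blast
  qed
  then have "K = insert s (insert t (supp_of a))" using s t aw by blast
  then have "rank_two K a" unfolding rank_two_def using aw finK s t by blast
  then show ?thesis using aw by blast
qed

text \<open>Both reflections are compared at the vertex of u, where their roots \<gamma> and
  \<epsilon> are simple among the orthogonal ones. After the passage to a rank two component each
  root is turned into a loop there separately. The new pairs define the same reflections, so
  \<open>equal_reflections_equiv\<close> relates them to the given ones.\<close>

lemma finite_order_tour:
  assumes T: "maximal_tree TV TE" and x: "x \<in> vertices"
    and wu: "(w, u) \<in> refl_pairs x" and wu': "(w', u') \<in> refl_pairs x"
    and k: "ord (refl_of TE x (w, u) \<otimes> refl_of TE x (w', u')) = k" "k \<ge> 2"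
  shows "\<exists>w1 u1 w2 u2. tour_equiv TE x (w, u) (w1, u1) \<and> tour_rel TE x k (w1, u1) (w2, u2) \<and> tour_equiv TE x (w2, u2) (w', u')"
proof -
  have ug: "u \<in> loop_gens" "u' \<in> loop_gens" using wu wu' by (auto simp: refl_pairs_def)
  note u = loop_genD[OF ug(1)] and u' = loop_genD[OF ug(2)]
  let ?y = "src u" and ?z = "src u'"
  define v v' where "v = w \<otimes> tree_elt_of TE x ?y" and "v' = w' \<otimes> tree_elt_of TE x ?z"
  note e = refl_of_eq[OF T x wu v_def] and e' = refl_of_eq[OF T x wu' v'_def]
  have vc: "v \<in> carrier G" "v' \<in> carrier G" using e e' Y_hom_carrier by auto
  obtain \<gamma> where c: "elt u = root_refl \<gamma>" "orth_simple ?y \<gamma>" using loop_orth_simple[OF ug(1)]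
    by metis
  obtain \<delta> where d: "elt u' = root_refl \<delta>" "orth_simple ?z \<delta>" using loop_orth_simple[OF ug(2)]
    by metis
  have cr: "\<gamma> \<in> roots" "\<gamma> \<in> V" and dr: "\<delta> \<in> roots" "\<delta> \<in> V"
    using c d pos_root pos_root_V by (auto simp: orth_simple_def)
  define g where "g = inv v \<otimes> v'"
  have gY: "g \<in> Y_hom ?y ?z" unfolding g_def
    using Y_hom_mult[OF Y_hom_inv[OF e(2) x u(3)] e'(2) x u'(3)] .
  have gc: "g \<in> carrier G" using gY Y_hom_carrier by blast
  define \<epsilon> where "\<epsilon> = act g \<delta>"
  have es: "orth_simple ?y \<epsilon>" unfolding \<epsilon>_def by (rule orth_simple_act[OF gY u(3) u'(3) d(2)])
  have er: "\<epsilon> \<in> roots" "\<epsilon> \<in> V" using es pos_root pos_root_V by (auto simp: orth_simple_def)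
  have r1: "refl_of TE x (w, u) = root_refl (act v \<gamma>)" using e(1) c root_refl_conj[OF vc(1) cr(1)]
    by simp
  have "act v \<epsilon> = act v' \<delta>" using vc dr gc by (simp add: \<epsilon>_def g_def act_mult act_V)
  then have r2: "refl_of TE x (w', u') = root_refl (act v \<epsilon>)"
    using e'(1) d root_refl_conj[OF vc(2) dr(1)] by simp
  have o1: "ord (root_refl \<gamma> \<otimes> root_refl \<epsilon>) = k"
  proof -
    have "refl_of TE x (w, u) \<otimes> refl_of TE x (w', u') = v \<otimes> (root_refl \<gamma> \<otimes> root_refl \<epsilon>) \<otimes> inv v"
      unfolding r1 r2 root_refl_conj[OF vc(1) cr(1), symmetric] root_refl_conj[OF vc(1) er(1), symmetric]
      using vc cr er by (simp add: m_assoc inv_mult_cancel)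
    then show ?thesis using k(1) ord_conj[OF vc(1)] cr er by simp
  qed
  have ne: "\<gamma> \<noteq> \<epsilon>"
  proof
    assume "\<gamma> = \<epsilon>"
    then have "root_refl \<gamma> \<otimes> root_refl \<epsilon> = \<one>" using root_refl_sq cr by simp
    then have "ord (root_refl \<gamma> \<otimes> root_refl \<epsilon>) = 1" using ord_id by simp
    then show False using o1 k by simp
  qed
  obtain a h J where h: "h \<in> Y_hom a ?y" "rank_two J a" "act h \<gamma> \<in> roots_on J"
    "act h \<epsilon> \<in> roots_on J"
    using two_reflections_facet[OF u(3) c(2) es ne] o1 k by auto
  have a: "a \<in> vertices" "J \<subseteq> S" "supp_of a \<subseteq> J" using h(2) by (auto simp: rank_two_def)
  have hc: "h \<in> carrier G" using h Y_hom_carrier by blast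
  \<comment> \<open>\<open>one_reflection_facet\<close> is applied within J, so the loop is reached
    without leaving the component.\<close>
  have reach: "\<exists>b q f. rank_two J b \<and> q \<in> Y_hom b a \<and> q \<in> generate G J \<and> f \<in> edges_within J \<and> tgt f = b \<and> src f = b \<and>
      elt f = root_refl (act q \<beta>)" if b: "orth_simple a \<beta>" "\<beta> \<in> roots_on J" for \<beta>
  proof -
    obtain b q s where q: "b \<in> vertices" "q \<in> Y_hom b a" "q \<in> generate G J" "s \<in> S" "s \<notin> supp_of b"
      "insert s (supp_of b) \<subseteq> J"
      "act q \<beta> \<in> roots_on (insert s (supp_of b))" using one_reflection_facet[OF a(1,3,2) b]
        by (elim exE conjE)
    obtain p where "arrow_path (edges_within J) b p a"
      using reduced_path_exists[OF q(1) a(1) _ a(2) Y_hom_C[OF q(2)] q(3)] q(6) by auto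
    then have "rank_two J b" using rank_two_path h(2) by blast
    moreover have "orth (supp_of b) (act q \<beta>)" using Y_hom_orth[OF q(2) a(1)] b pos_root_V
      by (auto simp: orth_simple_def)
    then have "(b, root_refl (act q \<beta>), b) \<in> edges_within J" using loopI q by blast
    ultimately show ?thesis using q
      by (intro exI[of _ b] exI[of _ q] exI[of _ "(b, root_refl (act q \<beta>), b)"]) simp
  qed
  have hs: "orth_simple a (act h \<gamma>)" "orth_simple a (act h \<epsilon>)"
    using orth_simple_act[OF h(1) a(1) u(3)] c(2) es by auto
  obtain b1 q1 f1 where 1: "rank_two J b1" "q1 \<in> Y_hom b1 a" "q1 \<in> generate G J"
    "f1 \<in> edges_within J" "tgt f1 = b1" "src f1 = b1"
    "elt f1 = root_refl (act q1 (act h \<gamma>))" using reach[OF hs(1) h(3)] by (elim exE conjE)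
  obtain b2 q2 f2 where 2: "rank_two J b2" "q2 \<in> Y_hom b2 a" "q2 \<in> generate G J"
    "f2 \<in> edges_within J" "tgt f2 = b2" "src f2 = b2"
    "elt f2 = root_refl (act q2 (act h \<epsilon>))" using reach[OF hs(2) h(4)] by (elim exE conjE)
  have bv: "b1 \<in> vertices" "b2 \<in> vertices" using 1 2 by (auto simp: rank_two_def)
  have qc: "q1 \<in> carrier G" "q2 \<in> carrier G" using 1 2 Y_hom_carrier by auto
  have fl: "f1 \<in> loop_gens" "f2 \<in> loop_gens" using 1 2 edges_within_edges
    by (auto simp: loop_gens_def)
  define v1 v2 where "v1 = v \<otimes> inv h \<otimes> inv q1" and "v2 = v \<otimes> inv h \<otimes> inv q2"
  have vh: "v \<otimes> inv h \<in> Y_hom x a"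
    using Y_hom_mult[OF e(2) Y_hom_inv[OF h(1) a(1) u(3)] u(3) a(1)] .
  have v12: "v1 \<in> Y_hom x b1" "v2 \<in> Y_hom x b2"
    using Y_hom_mult[OF vh Y_hom_inv[OF 1(2) bv(1) a(1)] a(1) bv(1)] Y_hom_mult[OF vh Y_hom_inv[OF 2(2) bv(2) a(1)] a(1) bv(2)]
    by (auto simp: v1_def v2_def)
  have vc12: "v1 \<in> carrier G" "v2 \<in> carrier G" using v12 Y_hom_carrier by auto
  define w1 w2 where "w1 = v1 \<otimes> inv (tree_elt_of TE x b1)" and "w2 = v2 \<otimes> inv (tree_elt_of TE x b2)"
  have pr: "(w1, f1) \<in> refl_pairs x" "(w2, f2) \<in> refl_pairs x"
    and wv: "w1 \<otimes> tree_elt_of TE x b1 = v1" "w2 \<otimes> tree_elt_of TE x b2 = v2"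
    using pair_of_arrow[OF T x fl(1)] pair_of_arrow[OF T x fl(2)] v12 1 2
    by (simp_all add: w1_def w2_def)
  have ac: "act v1 (act q1 (act h \<gamma>)) = act v \<gamma>" "act v2 (act q2 (act h \<epsilon>)) = act v \<epsilon>"
    using vc hc qc cr er by (simp_all add: v1_def v2_def act_mult act_V)
  have rr: "act q1 (act h \<gamma>) \<in> roots" "act q2 (act h \<epsilon>) \<in> roots" using act_root qc hc cr er by auto
  have eq1: "refl_of TE x (w1, f1) = refl_of TE x (w, u)"
    using refl_of_eq(1)[OF T x pr(1), of v1] 1 wv root_refl_conj[OF vc12(1) rr(1)] ac r1 by simp
  have eq2: "refl_of TE x (w2, f2) = refl_of TE x (w', u')"
    using refl_of_eq(1)[OF T x pr(2), of v2] 2 wv root_refl_conj[OF vc12(2) rr(2)] ac r2 by simp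
  have te1: "tour_equiv TE x (w, u) (w1, f1)"
    unfolding tour_equiv_def using wu pr(1) equal_reflections_equiv[OF T x pr(1) wu eq1] by blast
  have te2: "tour_equiv TE x (w2, f2) (w', u')"
    unfolding tour_equiv_def using wu' pr(2) equal_reflections_equiv[OF T x wu' pr(2)] eq2 by metis
  \<comment> \<open>The connecting element of the two loops lies in Y and in the parabolic subgroup
    of J, so a reduced path within J represents it without loops.\<close>
  define m where "m = q1 \<otimes> inv q2"
  have mY: "m \<in> Y_hom b1 b2" unfolding m_def
    using Y_hom_mult[OF 1(2) Y_hom_inv[OF 2(2) bv(2) a(1)] a(1) bv(2)] .
  have mg: "m \<in> generate G J" "m \<in> carrier G"
    using 1 2 qc generate_m_inv_closed[of J q2] a gens_carrier
    by (auto simp: m_def intro: generate.eng)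
  have bJ: "supp_of b1 \<subseteq> J" using 1(1) by (auto simp: rank_two_def)
  obtain p where p: "arrow_path (edges_within J) b1 p b2" "path_elt p = m" "reduced p"
    using reduced_path_exists[OF bv bJ a(2) Y_hom_C[OF mY] mg(1)] by blast
  have nl: "\<forall>e \<in> set p. tgt e \<noteq> src e" using reduced_Y_nonloop[OF p(1,3) bv(2)] p(2) mY by simp
  obtain s t where st: "s \<noteq> t" "s \<notin> supp_of b1" "t \<notin> supp_of b1" "J = supp_of b1 \<union> {s, t}"
    using 1(1) by (auto simp: rank_two_def)
  \<comment> \<open>A trivial connection of a loop with itself would force \<gamma> =
    \<epsilon>.\<close>
  have nf: "path_elt p \<noteq> \<one>" if ff: "f1 = f2"
  proof
    assume "path_elt p = \<one>"
    then have "q1 = q2" using p(2) qc unfolding m_def by (metis inv_closed inv_equality inv_inv)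
    moreover have "act q1 (act h \<gamma>) = act q2 (act h \<epsilon>)"
    proof (rule root_refl_inj)
      show "act q1 (act h \<gamma>) \<in> pos_roots" using Y_hom_pos[OF 1(2)] hs(1)
        by (auto simp: orth_simple_def)
      show "act q2 (act h \<epsilon>) \<in> pos_roots" using Y_hom_pos[OF 2(2)] hs(2)
        by (auto simp: orth_simple_def)
    qed (use ff 1 2 in simp)
    ultimately have "act h \<gamma> = act h \<epsilon>" using act_inj[OF qc(2)] act_V hc cr er by blast
    then show False using act_inj[OF hc cr(2) er(2)] ne by blast
  qed
  have "m \<otimes> elt f2 \<otimes> inv m = root_refl (act m (act q2 (act h \<epsilon>)))"
    using root_refl_conj[OF mg(2) rr(2)] 2 by simp
  also have "act m (act q2 (act h \<epsilon>)) = act q1 (act h \<epsilon>)" using qc hc er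
    by (simp add: m_def act_mult act_V)
  finally have me: "m \<otimes> elt f2 \<otimes> inv m = root_refl (act q1 (act h \<epsilon>))" .
  have qh: "q1 \<otimes> h \<in> carrier G" using qc hc by simp
  have "elt f1 \<otimes> (m \<otimes> elt f2 \<otimes> inv m) = (q1 \<otimes> h) \<otimes> (root_refl \<gamma> \<otimes> root_refl \<epsilon>) \<otimes> inv (q1 \<otimes> h)"
  proof -
    have "elt f1 = (q1 \<otimes> h) \<otimes> root_refl \<gamma> \<otimes> inv (q1 \<otimes> h)"
      "m \<otimes> elt f2 \<otimes> inv m = (q1 \<otimes> h) \<otimes> root_refl \<epsilon> \<otimes> inv (q1 \<otimes> h)"
      using root_refl_conj[OF qh cr(1)] root_refl_conj[OF qh er(1)] 1 me qc hc cr er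
      by (simp_all add: act_mult)
    then show ?thesis using qh cr er by (simp add: m_assoc inv_mult_cancel del: inv_mult_group)
  qed
  then have ok: "ord (elt f1 \<otimes> (path_elt p \<otimes> elt f2 \<otimes> inv (path_elt p))) = k"
    using ord_conj[OF qh] o1 cr er p(2) by simp
  have "v1 \<otimes> path_elt p = v2"
    using vc hc qc p(2) by (simp add: v1_def v2_def m_def m_assoc inv_mult_cancel)
  then have "tour_rel TE x k (w1, f1) (w2, f2)"
    using tour_relI[OF T x 1(1) st(4,1,2,3) 1(4,5,6) 2(4,5,6) p(1) nl nf v12(1) ok] k
    by (simp add: w1_def w2_def)
  then show ?thesis using te1 te2 by blast
qed

theorem tour_theorem:
  assumes T: "maximal_tree TV TE" and x: "x \<in> vertices"
    and wu: "(w, u) \<in> refl_pairs x" and wu': "(w', u') \<in> refl_pairs x"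
  shows "refl_of TE x (w, u) = refl_of TE x (w', u') \<longleftrightarrow> tour_equiv TE x (w, u) (w', u')"
    and "2 \<le> k \<Longrightarrow> ord (refl_of TE x (w, u) \<otimes> refl_of TE x (w', u')) = k \<longleftrightarrow>
      (\<exists>w1 u1 w2 u2. (w1, u1) \<in> refl_pairs x \<and> (w2, u2) \<in> refl_pairs x \<and> tour_equiv TE x (w, u) (w1, u1) \<and>
        tour_rel TE x k (w1, u1) (w2, u2) \<and> tour_equiv TE x (w2, u2) (w', u'))"
proof -
  show "refl_of TE x (w, u) = refl_of TE x (w', u') \<longleftrightarrow> tour_equiv TE x (w, u) (w', u')"
    using tour_equiv_refl_of[OF T x] equal_reflections_equiv[OF T x wu' wu] wu wu'
    unfolding tour_equiv_def by metis
  show "ord (refl_of TE x (w, u) \<otimes> refl_of TE x (w', u')) = k \<longleftrightarrow>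
      (\<exists>w1 u1 w2 u2. (w1, u1) \<in> refl_pairs x \<and> (w2, u2) \<in> refl_pairs x \<and> tour_equiv TE x (w, u) (w1, u1) \<and>
        tour_rel TE x k (w1, u1) (w2, u2) \<and> tour_equiv TE x (w2, u2) (w', u'))" if k: "2 \<le> k"
  proof
    assume "ord (refl_of TE x (w, u) \<otimes> refl_of TE x (w', u')) = k"
    then obtain w1 u1 w2 u2 where t: "tour_equiv TE x (w, u) (w1, u1)"
      "tour_rel TE x k (w1, u1) (w2, u2)" "tour_equiv TE x (w2, u2) (w', u')"
      using finite_order_tour[OF T x wu wu' _ k] by blast
    moreover have "(w1, u1) \<in> refl_pairs x" "(w2, u2) \<in> refl_pairs x" using t
      unfolding tour_equiv_def by blast+
    ultimately show "\<exists>w1 u1 w2 u2. (w1, u1) \<in> refl_pairs x \<and> (w2, u2) \<in> refl_pairs x \<and> tour_equiv TE x (w, u) (w1, u1) \<and>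
        tour_rel TE x k (w1, u1) (w2, u2) \<and> tour_equiv TE x (w2, u2) (w', u')" by blast
  next
    assume "\<exists>w1 u1 w2 u2. (w1, u1) \<in> refl_pairs x \<and> (w2, u2) \<in> refl_pairs x \<and> tour_equiv TE x (w, u) (w1, u1) \<and>
        tour_rel TE x k (w1, u1) (w2, u2) \<and> tour_equiv TE x (w2, u2) (w', u')"
    then obtain w1 u1 w2 u2 where t: "tour_equiv TE x (w, u) (w1, u1)"
      "tour_rel TE x k (w1, u1) (w2, u2)" "tour_equiv TE x (w2, u2) (w', u')"
      by blast
    show "ord (refl_of TE x (w, u) \<otimes> refl_of TE x (w', u')) = k"
      using tour_relD[OF T x t(2)] tour_equiv_refl_of[OF T x t(1)] tour_equiv_refl_of[OF T x t(3)]
      by metis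
  qed
qed

end

theorem theorem4p14:
  fixes G :: "('a, 'b) monoid_scheme" and S I :: "'a set"
    and \<Lambda> :: "'l set" and xI x :: "'l \<Rightarrow> 'a"
    and TV :: "('l \<Rightarrow> 'a) set" and TE :: "('l \<Rightarrow> 'a, 'a) arrow set"
    and w u :: 'a and \<gamma> \<beta> :: "('l \<Rightarrow> 'a, 'a) arrow"
  assumes "coxeter_groupoid G S I \<Lambda> xI"
    and "x \<in> coxeter_groupoid.vertices G S \<Lambda> xI"
    and "coxeter_groupoid.maximal_tree G S \<Lambda> xI TV TE"
    and "(w, \<gamma>) \<in> coxeter_groupoid.refl_pairs G S \<Lambda> xI x"
    and "(u, \<beta>) \<in> coxeter_groupoid.refl_pairs G S \<Lambda> xI x"
  shows "(coxeter_groupoid.refl_of G TE x (w, \<gamma>) = coxeter_groupoid.refl_of G TE x (u, \<beta>) \<longleftrightarrow>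
           coxeter_groupoid.tour_equiv G S \<Lambda> xI TE x (w, \<gamma>) (u, \<beta>)) \<and>
         (\<forall>k::nat. 2 \<le> k \<longrightarrow>
           (group.ord G (coxeter_groupoid.refl_of G TE x (w, \<gamma>) \<otimes>\<^bsub>G\<^esub>
                         coxeter_groupoid.refl_of G TE x (u, \<beta>)) = k \<longleftrightarrow>
            (\<exists>w' \<gamma>' u' \<beta>'.
               (w', \<gamma>') \<in> coxeter_groupoid.refl_pairs G S \<Lambda> xI x \<and>
               (u', \<beta>') \<in> coxeter_groupoid.refl_pairs G S \<Lambda> xI x \<and>
               coxeter_groupoid.tour_equiv G S \<Lambda> xI TE x (w, \<gamma>) (w', \<gamma>') \<and>
               coxeter_groupoid.tour_rel G S \<Lambda> xI TE x k (w', \<gamma>') (u', \<beta>') \<and>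
               coxeter_groupoid.tour_equiv G S \<Lambda> xI TE x (u', \<beta>') (u, \<beta>))))"
proof -
  interpret coxeter_groupoid G S I \<Lambda> xI by (rule assms(1))
  show ?thesis using tour_theorem[OF assms(3,2,4,5)] by blast
qed

end
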